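(* Let $n\ge1$, $d\ge 0$, and let $\kappa=(\kappa_1,\ldots,\kappa_n)$ be a vector of positive integers with $d\le \kappa_1+\cdots+\kappa_n$. Let $\mathbb{P}\mathrm{L}^d_\kappa$ be the set of all Lorentzian polynomials $f\in \mathrm{H}^d_n$ with $f(1,\ldots,1)=1$ whose degree in $w_i$ is at most $\kappa_i$ for each $1\le i\le n$. Then $\mathbb{P}\mathrm{L}^d_\kappa$ (with the Euclidean topology on coefficients) is homeomorphic to a closed Euclidean ball.
   Context: $\mathrm{H}^d_n$ denotes the real vector space of homogeneous polynomials of degree $d$ in $\mathbb{R}[w_1,\ldots,w_n]$ together with the zero polynomial. For $d\ge 2$, $f\in \mathrm{H}^d_n$ is strictly Lorentzian if all its coefficients (of all degree-$d$ monomials) are positive and for all $1\le i_1,\ldots,i_{d-2}\le n$ the quadratic form $\partial_{i_1}\cdots\partial_{i_{d-2}} f$ has signature $(+,-,\ldots,-)$. For $d\in\{0,1\}$, $f$ is strictly Lorentzian if all its coefficients are positive. A polynomial in $\mathrm{H}^d_n$ is Lorentzian if it is a coefficientwise limit of strictly Lorentzian polynomials. A closed Euclidean ball of dimension $0$ is a point. *)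

theory Defs
  imports
    "HOL-Analysis.Analysis"
    "HOL-Library.Poly_Mapping"
    "Jordan_Normal_Form.Matrix"
begin

text \<open>
  Real polynomials are finitely supported maps from monomials (exponent vectors) to
  coefficients; the variables \<open>w\<^sub>1, \<dots>, w\<^sub>n\<close> are indexed by \<open>{..<n}\<close>.
\<close>

type_synonym rpoly = "(nat \<Rightarrow>\<^sub>0 nat) \<Rightarrow>\<^sub>0 real"

definition monomials :: "nat \<Rightarrow> nat \<Rightarrow> (nat \<Rightarrow>\<^sub>0 nat) set" where
  "monomials n d = {m. Poly_Mapping.keys m \<subseteq> {..<n} \<and> (\<Sum>i<n. Poly_Mapping.lookup m i) = d}"

definition homogeneous_polys :: "nat \<Rightarrow> nat \<Rightarrow> rpoly set" where
  "homogeneous_polys n d = {f. Poly_Mapping.keys f \<subseteq> monomials n d}"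

definition poly_eval :: "rpoly \<Rightarrow> (nat \<Rightarrow> real) \<Rightarrow> real" where
  "poly_eval f x =
     (\<Sum>m\<in>Poly_Mapping.keys f. Poly_Mapping.lookup f m *
        (\<Prod>i\<in>Poly_Mapping.keys m. x i ^ Poly_Mapping.lookup m i))"

definition degree_in :: "nat \<Rightarrow> rpoly \<Rightarrow> nat" where
  "degree_in i f = Max (insert 0 ((\<lambda>m. Poly_Mapping.lookup m i) ` Poly_Mapping.keys f))"

text \<open>
  If \<open>w\<^sub>i\<close> does not occur in \<open>m\<close>, the truncated subtraction leaves \<open>m\<close> unchanged, but the
  coefficient of the summand is zero.
\<close>

definition partial_deriv :: "nat \<Rightarrow> rpoly \<Rightarrow> rpoly" where
  "partial_deriv i f =
     (\<Sum>m\<in>Poly_Mapping.keys f. Poly_Mapping.single (m - Poly_Mapping.single i 1)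
                                     (of_nat (Poly_Mapping.lookup m i) * Poly_Mapping.lookup f m))"

text \<open>
  A quadratic form \<open>q\<close> in \<open>n\<close> variables has signature \<open>(p, r)\<close> if some invertible linear
  change of variables \<open>w = A y\<close> turns it into
  a sum of \<open>p\<close> squares minus a sum of \<open>r\<close> further squares of distinct variables.
\<close>

definition has_signature :: "nat \<Rightarrow> nat \<Rightarrow> nat \<Rightarrow> rpoly \<Rightarrow> bool" where
  "has_signature n p r q \<longleftrightarrow>
     q \<in> homogeneous_polys n 2 \<and> p + r \<le> n \<and>
     (\<exists>A \<in> carrier_mat n n. invertible_mat A \<and>
        (\<forall>y \<in> carrier_vec n.
           poly_eval q (vec_index (A *\<^sub>v y)) =
             (\<Sum>j\<in>{..<p}. (vec_index y j)\<^sup>2) - (\<Sum>j\<in>{p..<p+r}. (vec_index y j)\<^sup>2)))"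

definition strictly_Lorentzian :: "nat \<Rightarrow> nat \<Rightarrow> rpoly \<Rightarrow> bool" where
  "strictly_Lorentzian n d f \<longleftrightarrow>
     f \<in> homogeneous_polys n d \<and>
     (\<forall>m \<in> monomials n d. Poly_Mapping.lookup f m > 0) \<and>
     (d \<ge> 2 \<longrightarrow>
       (\<forall>is. length is = d - 2 \<and> set is \<subseteq> {..<n} \<longrightarrow>
          has_signature n 1 (n - 1) (foldr partial_deriv is f)))"

definition Lorentzian :: "nat \<Rightarrow> nat \<Rightarrow> rpoly \<Rightarrow> bool" where
  "Lorentzian n d f \<longleftrightarrow>
     f \<in> homogeneous_polys n d \<and>
     (\<exists>F :: nat \<Rightarrow> rpoly. (\<forall>k. strictly_Lorentzian n d (F k)) \<and>
        (\<forall>m. (\<lambda>k. Poly_Mapping.lookup (F k) m) \<longlonglongrightarrow> Poly_Mapping.lookup f m))"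

definition PL :: "nat \<Rightarrow> nat \<Rightarrow> (nat \<Rightarrow> nat) \<Rightarrow> rpoly set" where
  "PL n d \<kappa> =
     {f. Lorentzian n d f \<and> poly_eval f (\<lambda>_. 1) = 1 \<and> (\<forall>i<n. degree_in i f \<le> \<kappa> i)}"

text \<open>
  The Euclidean topology on coefficients: \<open>powertop_real (monomials n d)\<close> is the Euclidean
  space whose coordinates are indexed by the finitely many monomials of degree \<open>d\<close>.
\<close>

definition coeff_topology :: "nat \<Rightarrow> nat \<Rightarrow> rpoly topology" where
  "coeff_topology n d =
     pullback_topology (homogeneous_polys n d) (\<lambda>f. restrict (Poly_Mapping.lookup f) (monomials n d))
       (powertop_real (monomials n d))"

definition closed_ball_topology :: "nat \<Rightarrow> (nat \<Rightarrow> real) topology" where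
  "closed_ball_topology k = subtopology (Euclidean_space k) {x. (\<Sum>i<k. (x i)\<^sup>2) \<le> 1}"

end

theory Submission
  imports Defs "HOL-Library.Multiset"
begin

text \<open>
  A homogeneous polynomial \<open>f\<close> of degree \<open>d\<close> is encoded by the numbers \<open>\<partial>\<^sup>A f\<close>, indexed by the
  multisets \<open>A\<close> of \<open>d\<close> variables; the polynomials with degree at most \<open>\<kappa>\<^sub>i\<close> in \<open>w\<^sub>i\<close> are those
  supported on the submultisets of the multiset \<open>k\<close> with multiplicities \<open>\<kappa>\<^sub>i\<close>.

  The symmetric exclusion process with equal rates, transported through polarization, is a linear
  flow on these polynomials which preserves \<open>f(1, \<dots>, 1)\<close>. It is self-adjoint with a positive fixed
  vector, so in eigencoordinates on the hyperplane \<open>f(1, \<dots>, 1) = 1\<close> it is a diagonal contraction.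
  If along the flow a Hessian \<open>\<partial>\<^sup>\<alpha> f\<close>, \<open>|\<alpha>| = d - 2\<close>, degenerates with kernel vector \<open>y\<close>, then the
  derivative of its value at \<open>y\<close> is strictly negative, because all neighbouring Hessians are
  Lorentzian and have \<open>y\<close> orthogonal to a unit vector. Hence at every positive time the flow maps
  the Lorentzian polynomials into the open set of polynomials with full support in the box and
  nondegenerate Hessians. The latter are again Lorentzian: by a Bochner-type argument for cubics all
  their mixed directional derivatives of order \<open>d - 2\<close> are nondegenerate of Lorentzian signature,
  so that \<open>w\<^sub>i \<mapsto> w\<^sub>i + \<epsilon>(w\<^sub>1 + \<dots> + w\<^sub>n)\<close> turns them into strictly Lorentzian polynomials.

  A compact set that a diagonal contraction flow maps into its interior at all positive times is
  homeomorphic to the unit ball: move each point along its orbit by the difference of the times at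
  which the orbit enters the set and the ball.
\<close>

section \<open>The spectral theorem for finite index sets\<close>

text \<open>The set is not convex in general, and its relative interior is not described by
  \<open>strictly_Lorentzian\<close>: coefficients outside the box vanish, so that notion fails as
  soon as some degree-d monomial exceeds a cap. The interior therefore needs its own description,
  \<open>strict\<close>: positive coefficients in the box, and Hessians that are nondegenerate in
  those variables whose cap the derivative has not exhausted. Two passages connect it with the
  definition. Downwards, cutting a strictly Lorentzian polynomial to the box keeps its Hessians
  Lorentzian; upwards, a positive linear substitution fills in the missing coefficients.

  The flow has to respect degree, caps and normalisation at once. Exclusion does so, because a move
  into a full variable has rate zero. The awkward boundary points are the polynomials with zero
  coefficients inside the box: the criterion for Lorentzian Hessians used below presupposes a
  positive value at the all-ones vector. Hence the flow is first shown to make all coefficients in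
  the box positive, and only then to make the Hessians nondegenerate.\<close>

definition dot :: "'a set \<Rightarrow> ('a \<Rightarrow> real) \<Rightarrow> ('a \<Rightarrow> real) \<Rightarrow> real" where
  "dot I x y = (\<Sum>p\<in>I. x p * y p)"

text \<open>Vectors and forms are functions on a whole type, read only on the index set: the set of
  variables changes with the Hessian under consideration, and matrices of fixed size would have to
  be reindexed each time.\<close>

definition bil :: "'a set \<Rightarrow> ('a \<Rightarrow> 'a \<Rightarrow> real) \<Rightarrow> ('a \<Rightarrow> real) \<Rightarrow> ('a \<Rightarrow> real) \<Rightarrow> real" where
  "bil I B x y = (\<Sum>p\<in>I. \<Sum>q\<in>I. B p q * x p * y q)"

definition app :: "'a set \<Rightarrow> ('a \<Rightarrow> 'a \<Rightarrow> real) \<Rightarrow> ('a \<Rightarrow> real) \<Rightarrow> 'a \<Rightarrow> real" where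
  "app I B x p = (\<Sum>q\<in>I. B p q * x q)"

definition sym_form :: "'a set \<Rightarrow> ('a \<Rightarrow> 'a \<Rightarrow> real) \<Rightarrow> bool" where
  "sym_form I B \<longleftrightarrow> (\<forall>p\<in>I. \<forall>q\<in>I. B p q = B q p)"

lemma dot_commute: "dot I x y = dot I y x"
  by (simp add: dot_def mult.commute)

lemma dot_add_left: "dot I (\<lambda>p. x p + y p) z = dot I x z + dot I y z"
  by (simp add: dot_def algebra_simps sum.distrib)

lemma dot_diff_left: "dot I (\<lambda>p. x p - y p) z = dot I x z - dot I y z"
  by (simp add: dot_def algebra_simps sum_subtractf)

lemma dot_scale_left: "dot I (\<lambda>p. c * x p) z = c * dot I x z"
  by (simp add: dot_def algebra_simps sum_distrib_left)

lemma dot_sum_left: "dot I (\<lambda>p. \<Sum>i\<in>K. f i p) z = (\<Sum>i\<in>K. dot I (f i) z)"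
  unfolding dot_def by (simp add: sum_distrib_right) (rule sum.swap)

lemma dot_self_nonneg: "dot I x x \<ge> 0"
  by (simp add: dot_def sum_nonneg)

lemma dot_self_eq_0: "finite I \<Longrightarrow> dot I x x = 0 \<longleftrightarrow> (\<forall>p\<in>I. x p = 0)"
  by (simp add: dot_def sum_nonneg_eq_0_iff)

lemma bil_eq_dot_app: "bil I B x y = dot I x (app I B y)"
  unfolding bil_def dot_def app_def by (simp add: sum_distrib_left algebra_simps)

lemma bil_commute: "sym_form I B \<Longrightarrow> bil I B x y = bil I B y x"
  unfolding bil_def sym_form_def
  by (subst sum.swap) (auto intro!: sum.cong simp: algebra_simps)

lemma bil_add_left: "bil I B (\<lambda>p. x p + y p) z = bil I B x z + bil I B y z"
  by (simp add: bil_def algebra_simps sum.distrib)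

lemma bil_add_right: "bil I B z (\<lambda>p. x p + y p) = bil I B z x + bil I B z y"
  by (simp add: bil_def algebra_simps sum.distrib)

lemma bil_scale_left: "bil I B (\<lambda>p. c * x p) z = c * bil I B x z"
  by (simp add: bil_def algebra_simps sum_distrib_left)

lemma bil_scale_right: "bil I B z (\<lambda>p. c * x p) = c * bil I B z x"
  by (simp add: bil_def algebra_simps sum_distrib_left)

lemma bil_cong:
  "(\<And>p q. p \<in> I \<Longrightarrow> q \<in> I \<Longrightarrow> B p q = B' p q) \<Longrightarrow> (\<And>p. p \<in> I \<Longrightarrow> x p = x' p) \<Longrightarrow> (\<And>p. p \<in> I \<Longrightarrow> y p = y' p)
   \<Longrightarrow> bil I B x y = bil I B' x' y'"
  by (simp add: bil_def)

lemma bil_diff_self: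
  assumes "sym_form I B"
  shows "bil I B (\<lambda>p. x p - c * y p) (\<lambda>p. x p - c * y p)
       = bil I B x x - 2 * c * bil I B x y + c\<^sup>2 * bil I B y y"
proof -
  have "bil I B (\<lambda>p. x p + (-c) * y p) (\<lambda>p. x p + (-c) * y p)
       = bil I B x x + (-c) * bil I B x y + (-c) * bil I B y x + (-c) * (-c) * bil I B y y"
    by (simp only: bil_add_left bil_add_right bil_scale_left bil_scale_right add.assoc distrib_left
        mult.assoc)
  then show ?thesis using bil_commute[OF assms, of y x] by (simp add: power2_eq_square)
qed

text \<open>Tychonoff's theorem in place of Heine-Borel: the bounds may depend on the coordinate,
  and the index type may be infinite.\<close>

lemma compact_finite_support:
  fixes C :: "('a \<Rightarrow> real) set"
  assumes "closed C" and "\<And>x p. x \<in> C \<Longrightarrow> \<bar>x p\<bar> \<le> M p"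
  shows "compact C"
proof -
  have "compactin (product_topology (\<lambda>i. euclidean) UNIV) (PiE UNIV (\<lambda>p. {- M p..M p}))"
    by (subst compactin_PiE) auto
  then have "compact (PiE UNIV (\<lambda>p. {- M p..M p}) :: ('a \<Rightarrow> real) set)"
    by (simp add: euclidean_product_topology)
  moreover have "C = C \<inter> PiE UNIV (\<lambda>p. {- M p..M p})"
    using assms(2) by (auto simp: abs_le_iff) (metis minus_le_iff)
  ultimately show ?thesis using assms(1) by (metis closed_Int_compact)
qed

lemma continuous_on_coord [continuous_intros]: "continuous_on S (\<lambda>x. (x :: 'a \<Rightarrow> 'b::topological_space) i)"
  by (rule continuous_on_subset[OF continuous_on_product_coordinates subset_UNIV])

lemma continuous_on_dot [continuous_intros]:
  "(\<And>p. p \<in> I \<Longrightarrow> continuous_on S (\<lambda>x. f x p)) \<Longrightarrow> (\<And>p. p \<in> I \<Longrightarrow> continuous_on S (\<lambda>x. g x p))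
      \<Longrightarrow> continuous_on S (\<lambda>x. dot I (f x) (g x))"
  unfolding dot_def by (intro continuous_intros) auto

lemma continuous_on_bil [continuous_intros]:
  assumes "\<And>p q. p \<in> I \<Longrightarrow> q \<in> I \<Longrightarrow> continuous_on S (\<lambda>x. B x p q)"
    "\<And>p. p \<in> I \<Longrightarrow> continuous_on S (\<lambda>x. f x p)" "\<And>p. p \<in> I \<Longrightarrow> continuous_on S (\<lambda>x. g x p)"
  shows "continuous_on S (\<lambda>x. bil I (B x) (f x) (g x))"
  unfolding bil_def using assms by (intro continuous_intros) auto

lemma closed_support: "closed {x :: 'a \<Rightarrow> real. \<forall>p. p \<notin> I \<longrightarrow> x p = 0}"
proof -
  have "{x :: 'a \<Rightarrow> real. \<forall>p. p \<notin> I \<longrightarrow> x p = 0} = (\<Inter>p\<in>-I. {x. x p = 0})" by auto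
  also have "closed \<dots>" by (intro closed_INT ballI closed_Collect_eq continuous_intros)
  finally show ?thesis .
qed

lemma compact_sphere_finite:
  assumes "finite I" "closed D"
  shows "compact ({x :: 'a \<Rightarrow> real. (\<forall>p. p \<notin> I \<longrightarrow> x p = 0) \<and> dot I x x = 1} \<inter> D)"
proof (rule compact_finite_support)
  have "closed {x :: 'a \<Rightarrow> real. dot I x x = 1}"
    by (intro closed_Collect_eq continuous_intros)
  then show "closed ({x :: 'a \<Rightarrow> real. (\<forall>p. p \<notin> I \<longrightarrow> x p = 0) \<and> dot I x x = 1} \<inter> D)"
    using closed_support[of I] assms(2) by (simp add: Collect_conj_eq closed_Int)
next
  fix x :: "'a \<Rightarrow> real" and p
  assume x: "x \<in> {x. (\<forall>p. p \<notin> I \<longrightarrow> x p = 0) \<and> dot I x x = 1} \<inter> D"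
  show "\<bar>x p\<bar> \<le> 1"
  proof (cases "p \<in> I")
    case True
    have "x p * x p \<le> dot I x x"
      unfolding dot_def by (rule member_le_sum[OF True]) (use assms in auto)
    then show ?thesis using x by (simp add: power2_eq_square[symmetric] abs_square_le_1)
  qed (use x in auto)
qed

text \<open>The eigenvalues are listed in nonincreasing order so that index 0 is the largest: it
  becomes the fixed direction of the flow, and the only positive square of a nondegenerate
  Lorentzian form.\<close>

definition orthonormal_eigen :: "'a set \<Rightarrow> ('a \<Rightarrow> 'a \<Rightarrow> real) \<Rightarrow> nat \<Rightarrow> (nat \<Rightarrow> 'a \<Rightarrow> real) \<Rightarrow> (nat \<Rightarrow> real) \<Rightarrow> bool"
    where
  "orthonormal_eigen I S k v l \<longleftrightarrow>
     (\<forall>i<k. \<forall>j<k. dot I (v i) (v j) = (if i = j then 1 else 0)) \<and>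
     (\<forall>i<k. \<forall>p\<in>I. app I S (v i) p = l i * v i p) \<and>
     (\<forall>i<k. \<forall>j<k. i \<le> j \<longrightarrow> l j \<le> l i)"

text \<open>Summing \<open>\<bar>e\<^sub>p - P e\<^sub>p\<bar>\<^sup>2\<close> over \<open>p\<close>, where \<open>P\<close> is the orthogonal projection onto the span of the \<open>v
    i\<close>.\<close>

lemma sum_projection_residual:
  assumes "finite I" and on: "\<And>i j. i < k \<Longrightarrow> j < k \<Longrightarrow> dot I (v i) (v j) = (if i = j then 1 else 0)"
  defines "r \<equiv> \<lambda>p q. (if p = q then 1 else 0) - (\<Sum>i<k. v i p * v i q)"
  shows "(\<Sum>p\<in>I. dot I (r p) (r p)) = real (card I) - real k"
    and "\<And>p i. p \<in> I \<Longrightarrow> i < k \<Longrightarrow> dot I (r p) (v i) = 0"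
proof -
  show 0: "dot I (r p) (v i) = 0" if "p \<in> I" "i < k" for p i
  proof -
    have "dot I (r p) (v i) = (\<Sum>q\<in>I. (if p = q then v i q else 0) - (\<Sum>j<k. v j p * v j q * v i q))"
      unfolding dot_def r_def by (intro sum.cong) (auto simp: left_diff_distrib sum_distrib_right)
    also have "\<dots> = (\<Sum>q\<in>I. (if p = q then v i q else 0)) - (\<Sum>q\<in>I. \<Sum>j<k. v j p * v j q * v i q)"
      by (rule sum_subtractf)
    also have "(\<Sum>q\<in>I. \<Sum>j<k. v j p * v j q * v i q) = (\<Sum>j<k. v j p * dot I (v j) (v i))"
      by (subst sum.swap) (simp add: dot_def sum_distrib_left mult.assoc)
    also have "\<dots> = (\<Sum>j<k. v j p * (if j = i then 1 else 0))"
      using on that by (intro sum.cong) auto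
    also have "\<dots> = v i p" using that by (simp add: if_distrib cong: if_cong)
    finally show ?thesis using that assms(1) by simp
  qed
  have "(\<Sum>p\<in>I. dot I (r p) (r p)) = (\<Sum>p\<in>I. r p p)"
  proof (rule sum.cong)
    fix p assume p: "p \<in> I"
    have "dot I (r p) (r p) = dot I (\<lambda>q. (if p = q then 1 else 0) - (\<Sum>i<k. v i p * v i q)) (r p)"
      by (simp add: r_def)
    also have "\<dots> = dot I (\<lambda>q. (if p = q then 1 else 0)) (r p) - (\<Sum>i<k. v i p * dot I (v i) (r p))"
      by (simp add: dot_diff_left dot_sum_left dot_scale_left)
    also have "(\<Sum>i<k. v i p * dot I (v i) (r p)) = 0"
      using 0[OF p] by (simp add: dot_commute)
    also have "dot I (\<lambda>q. (if p = q then 1 else 0)) (r p) = (\<Sum>q\<in>I. if p = q then r p q else 0)"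
      unfolding dot_def by (intro sum.cong) auto
    finally show "dot I (r p) (r p) = r p p" using p assms(1) by simp
  qed simp
  also have "\<dots> = real (card I) - (\<Sum>i<k. dot I (v i) (v i))"
    unfolding r_def by (simp add: sum_subtractf dot_def) (rule sum.swap)
  also have "(\<Sum>i<k. dot I (v i) (v i)) = real k" using on by simp
  finally show "(\<Sum>p\<in>I. dot I (r p) (r p)) = real (card I) - real k" .
qed

text \<open>The squared distances of the basis vectors from the span add up to its codimension, here
  0.\<close>

lemma orthonormal_complete:
  assumes "finite I" and on: "\<And>i j. i < card I \<Longrightarrow> j < card I \<Longrightarrow> dot I (v i) (v j) = (if i = j then 1 else 0)"
    and "p \<in> I" "q \<in> I"
  shows "(\<Sum>i<card I. v i p * v i q) = (if p = q then 1 else 0)"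
proof -
  define r where "r = (\<lambda>p q. (if p = q then 1 else 0) - (\<Sum>i<card I. v i p * v i q))"
  have "(\<Sum>p\<in>I. dot I (r p) (r p)) = 0"
    using sum_projection_residual(1)[OF assms(1) on] by (simp add: r_def)
  then have "dot I (r p) (r p) = 0"
    using assms by (subst (asm) sum_nonneg_eq_0_iff) (auto simp: dot_self_nonneg)
  then have "r p q = 0" using assms by (simp add: dot_self_eq_0)
  then show ?thesis by (simp add: r_def)
qed

text \<open>The next eigenvector maximises the Rayleigh quotient on the unit sphere of the
  orthogonal complement of the previous ones.\<close>

lemma spectral_step:
  assumes fin: "finite I" and sy: "sym_form I S" and oe: "orthonormal_eigen I S k v l" and "k < card I"
    and mx: "\<And>x i. i < k \<Longrightarrow> dot I x x = 1 \<Longrightarrow> (\<forall>j<i. dot I x (v j) = 0) \<Longrightarrow> bil I S x x \<le> l i"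
  obtains u m where "dot I u u = 1" "\<And>j. j < k \<Longrightarrow> dot I u (v j) = 0"
    "\<And>p. p \<in> I \<Longrightarrow> app I S u p = m * u p"
    "\<And>x. dot I x x = 1 \<Longrightarrow> (\<forall>j<k. dot I x (v j) = 0) \<Longrightarrow> bil I S x x \<le> m"
proof -
  define D where "D = {x :: 'a \<Rightarrow> real. \<forall>j<k. dot I x (v j) = 0}"
  define C where "C = {x. (\<forall>p. p \<notin> I \<longrightarrow> x p = 0) \<and> dot I x x = 1} \<inter> D"
  have on: "dot I (v i) (v j) = (if i = j then 1 else 0)" if "i < k" "j < k" for i j
    using oe that by (auto simp: orthonormal_eigen_def)
  have ev: "app I S (v i) p = l i * v i p" if "i < k" "p \<in> I" for i p
    using oe that by (auto simp: orthonormal_eigen_def)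
  have "D = (\<Inter>j\<in>{..<k}. {x. dot I x (v j) = 0})" by (auto simp: D_def)
  also have "closed \<dots>"
    by (intro closed_INT ballI closed_Collect_eq continuous_intros)
  finally have "compact C" unfolding C_def using fin by (intro compact_sphere_finite)
  have restr: "\<exists>y\<in>C. (\<forall>p\<in>I. y p = x p)" if "dot I x x = 1" "\<forall>j<k. dot I x (v j) = 0" for x
  proof -
    have "(\<lambda>p. if p \<in> I then x p else 0) \<in> C"
      using that by (simp add: C_def D_def dot_def cong: sum.cong)
    then show ?thesis by (metis (mono_tags, lifting))
  qed
  have "C \<noteq> {}"
  proof -
    \<comment> \<open>Since \<open>k < card I\<close>, some basis vector has a nonzero residual
      after projection; normalised, it is a point of the sphere over which the maximum is
      taken.\<close>
    define r where "r = (\<lambda>p q. (if p = q then 1 else 0) - (\<Sum>i<k. v i p * v i q))"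
    have rs: "(\<Sum>p\<in>I. dot I (r p) (r p)) = real (card I) - real k"
      and ro: "\<And>p i. p \<in> I \<Longrightarrow> i < k \<Longrightarrow> dot I (r p) (v i) = 0"
      using sum_projection_residual[where k=k and v=v, OF fin on] unfolding r_def by auto
    have "\<exists>p\<in>I. dot I (r p) (r p) \<noteq> 0"
    proof (rule ccontr)
      assume "\<not> ?thesis"
      then have "(\<Sum>p\<in>I. dot I (r p) (r p)) = 0" by (intro sum.neutral) auto
      then show False using rs assms(4) by simp
    qed
    then obtain p where p: "p \<in> I" "dot I (r p) (r p) \<noteq> 0" by blast
    define c where "c = sqrt (dot I (r p) (r p))"
    have c: "c > 0" "c * c = dot I (r p) (r p)" using p(2) dot_self_nonneg[of I "r p"] by (auto simp: c_def)
    have 1: "dot I (\<lambda>q. (1/c) * r p q) (\<lambda>q. (1/c) * r p q) = 1"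
      using c p(2) unfolding dot_scale_left
          by (subst dot_commute, unfold dot_scale_left) (simp add: field_simps)
    have 2: "\<forall>j<k. dot I (\<lambda>q. (1/c) * r p q) (v j) = 0"
      by (simp only: dot_scale_left) (simp add: ro p)
    show ?thesis using restr[OF 1 2] by blast
  qed
  moreover have "continuous_on C (\<lambda>x. bil I S x x)" by (intro continuous_intros)
  ultimately obtain u where u: "u \<in> C" and umax: "\<And>y. y \<in> C \<Longrightarrow> bil I S y y \<le> bil I S u u"
    using continuous_attains_sup[OF \<open>compact C\<close>, of "\<lambda>x. bil I S x x"] by blast
  define m where "m = bil I S u u"
  have uu: "dot I u u = 1" and uv: "\<And>j. j < k \<Longrightarrow> dot I u (v j) = 0" using u by (auto simp: C_def D_def)
  have max: "bil I S x x \<le> m" if x: "dot I x x = 1" "\<forall>j<k. dot I x (v j) = 0" for x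
  proof -
    obtain y where y: "y \<in> C" "\<forall>p\<in>I. y p = x p" using restr[OF x] by blast
    have "bil I S x x = bil I S y y" using y by (intro bil_cong) auto
    then show ?thesis using umax[OF y(1)] by (simp add: m_def)
  qed
  have max': "bil I S x x \<le> m * dot I x x" if x: "\<forall>j<k. dot I x (v j) = 0" for x
  proof (cases "dot I x x = 0")
    case True
    then have "\<forall>p\<in>I. x p = 0" using fin by (simp add: dot_self_eq_0)
    then show ?thesis using True by (simp add: bil_def)
  next
    case False
    define c where "c = sqrt (dot I x x)"
    have c: "c > 0" "c * c = dot I x x" using False dot_self_nonneg[of I x] by (auto simp: c_def)
    have 1: "dot I (\<lambda>q. (1/c) * x q) (\<lambda>q. (1/c) * x q) = 1"
      using c False unfolding dot_scale_left
          by (subst dot_commute, unfold dot_scale_left) (simp add: field_simps)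
    have 2: "\<forall>j<k. dot I (\<lambda>q. (1/c) * x q) (v j) = 0"
      by (simp only: dot_scale_left) (simp add: x)
    have "bil I S x x / (c * c) \<le> m"
      using max[OF 1 2] by (simp only: bil_scale_left bil_scale_right) simp
    then show ?thesis using c mult_pos_pos[OF c(1) c(1)] by (subst (asm) pos_divide_le_eq) auto
  qed
  \<comment> \<open>The residual stays orthogonal to the earlier eigenvectors. Moving
    \<open>u\<close> in its direction increases the quotient to first order by a multiple of
    \<open>dot I y y\<close>, so maximality forces it to vanish on \<open>I\<close>.\<close>
  define y where "y = (\<lambda>p. app I S u p - m * u p)"
  have appv: "dot I (app I S u) (v j) = 0" if "j < k" for j
  proof -
    have "dot I (app I S u) (v j) = bil I S (v j) u" by (simp add: bil_eq_dot_app dot_commute)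
    also have "\<dots> = dot I u (app I S (v j))" using bil_commute[OF sy] by (simp add: bil_eq_dot_app)
    also have "\<dots> = dot I u (\<lambda>p. l j * v j p)" unfolding dot_def using ev that by (intro sum.cong) auto
    also have "\<dots> = 0" using uv[OF that] by (simp add: dot_commute[of I u] dot_scale_left)
    finally show ?thesis .
  qed
  have yv: "dot I y (v j) = 0" if "j < k" for j
    unfolding y_def by (simp add: dot_diff_left dot_scale_left appv uv that)
  have yy: "dot I y y = 0"
  proof (rule ccontr)
    assume "dot I y y \<noteq> 0"
    then have pos: "dot I y y > 0" using dot_self_nonneg[of I y] by simp
    define a where "a = bil I S y y - m * dot I y y"
    have key: "2 * e * dot I y y + e * e * a \<le> 0" for e
    proof -
      have "\<forall>j<k. dot I (\<lambda>p. u p + e * y p) (v j) = 0"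
        by (simp add: dot_add_left dot_scale_left uv yv)
      from max'[OF this]
      have "bil I S (\<lambda>p. u p + e * y p) (\<lambda>p. u p + e * y p)
          \<le> m * dot I (\<lambda>p. u p + e * y p) (\<lambda>p. u p + e * y p)" .
      moreover have "bil I S (\<lambda>p. u p + e * y p) (\<lambda>p. u p + e * y p)
          = m + 2 * e * bil I S y u + e * e * bil I S y y"
        unfolding m_def by (simp only: bil_add_left bil_add_right bil_scale_left bil_scale_right)
          (simp add: bil_commute[OF sy, of u y] algebra_simps)
      moreover have "dot I (\<lambda>p. u p + e * y p) (\<lambda>p. u p + e * y p)
          = 1 + 2 * e * dot I y u + e * e * dot I y y"
        using uu by (simp add: dot_def algebra_simps sum.distrib sum_distrib_left)
      moreover have "bil I S y u - m * dot I y u = dot I y y"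
      proof -
        have "dot I (\<lambda>p. app I S u p - m * u p) y = bil I S y u - m * dot I y u"
          by (simp only: dot_diff_left dot_scale_left bil_eq_dot_app dot_commute[of I y])
        then show ?thesis by (simp add: y_def)
      qed
      ultimately show ?thesis unfolding a_def by (simp add: algebra_simps)
    qed
    \<comment> \<open>Small enough for the linear term to dominate: \<open>e * \<bar>a\<bar>\<close>
      is at most \<open>dot I y y\<close>.\<close>
    define e where "e = dot I y y / (\<bar>a\<bar> + 1)"
    have e: "e > 0" using pos by (simp add: e_def)
    have "e * \<bar>a\<bar> \<le> dot I y y" using pos by (simp add: e_def field_simps)
    then have "2 * dot I y y + e * a > 0" using e pos
      by (smt (verit, best) abs_le_D2 minus_mult_right mult_left_mono)
    then have "e * (2 * dot I y y + e * a) > 0" using e by simp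
    then show False using key[of e] by (simp add: algebra_simps)
  qed
  show thesis
  proof (rule that[of u m])
    show "app I S u p = m * u p" if "p \<in> I" for p
      using yy fin that by (simp add: dot_self_eq_0 y_def)
  qed (use uu uv max in auto)
qed

lemma spectral_theorem:
  assumes fin: "finite I" and sy: "sym_form I S"
  obtains v l where "orthonormal_eigen I S (card I) v l"
proof -
  \<comment> \<open>The maximality of each earlier eigenvalue is carried through the induction
    because the ordering of the eigenvalues follows from it.\<close>
  have "\<exists>v l. orthonormal_eigen I S k v l \<and>
      (\<forall>x i. i < k \<longrightarrow> dot I x x = 1 \<longrightarrow> (\<forall>j<i. dot I x (v j) = 0) \<longrightarrow> bil I S x x \<le> l i)"
    if "k \<le> card I" for k
    using that
  proof (induction k)
    case 0
    then show ?case by (simp add: orthonormal_eigen_def)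
  next
    case (Suc k)
    then obtain v l where oe: "orthonormal_eigen I S k v l"
      and mx: "\<And>x i. i < k \<Longrightarrow> dot I x x = 1 \<Longrightarrow> (\<forall>j<i. dot I x (v j) = 0) \<Longrightarrow> bil I S x x \<le> l i"
      by auto
    obtain u m where u: "dot I u u = 1" "\<And>j. j < k \<Longrightarrow> dot I u (v j) = 0"
      "\<And>p. p \<in> I \<Longrightarrow> app I S u p = m * u p"
      "\<And>x. dot I x x = 1 \<Longrightarrow> (\<forall>j<k. dot I x (v j) = 0) \<Longrightarrow> bil I S x x \<le> m"
      using spectral_step[OF fin sy oe Suc_le_lessD[OF Suc.prems] mx] by blast
    have "bil I S u u = dot I (\<lambda>p. m * u p) u"
      unfolding bil_eq_dot_app dot_commute[of I u] dot_def using u(3) by (intro sum.cong) auto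
    then have "bil I S u u = m"
      using u(1) by (simp add: dot_scale_left)
    then have "m \<le> l i" if "i < k" for i
      using mx[OF that u(1)] u(2) that by auto
    then have "orthonormal_eigen I S (Suc k) (v(k := u)) (l(k := m))"
      unfolding orthonormal_eigen_def
    proof (intro conjI allI impI ballI)
      fix i j assume "i < Suc k" "j < Suc k"
      then show "dot I ((v(k := u)) i) ((v(k := u)) j) = (if i = j then 1 else 0)"
        using oe u(1) u(2)[of i] u(2)[of j] dot_commute[of I u "v i"]
        by (cases "i = k"; cases "j = k") (simp_all add: orthonormal_eigen_def)
    next
      fix i p assume "i < Suc k" "p \<in> I"
      then show "app I S ((v(k := u)) i) p = (l(k := m)) i * (v(k := u)) i p"
        using oe u(3)[of p] by (cases "i = k") (simp_all add: orthonormal_eigen_def)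
    next
      fix i j assume "i < Suc k" "j < Suc k" "i \<le> j"
      then show "(l(k := m)) j \<le> (l(k := m)) i"
        using oe \<open>\<And>i. i < k \<Longrightarrow> m \<le> l i\<close>
            by (cases "i = k"; cases "j = k") (simp_all add: orthonormal_eigen_def)
    qed
    moreover have "\<forall>x i. i < Suc k \<longrightarrow> dot I x x = 1 \<longrightarrow> (\<forall>j<i. dot I x ((v(k := u)) j) = 0) \<longrightarrow> bil I S x x
        \<le> (l(k := m)) i"
      using mx u(4) by (auto simp: less_Suc_eq)
    ultimately show ?case by blast
  qed
  from this[OF order_refl] show thesis using that by blast
qed

section \<open>Lorentzian bilinear forms\<close>

text \<open>For symmetric forms this reverse Cauchy-Schwarz inequality says that there is at most
  one positive eigenvalue. Forms without positive values qualify.\<close>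

definition Lor :: "'a set \<Rightarrow> ('a \<Rightarrow> 'a \<Rightarrow> real) \<Rightarrow> bool" where
  "Lor I B \<longleftrightarrow> (\<forall>x y. bil I B y y > 0 \<longrightarrow> bil I B x x * bil I B y y \<le> (bil I B x y)\<^sup>2)"

definition nondeg :: "'a set \<Rightarrow> ('a \<Rightarrow> 'a \<Rightarrow> real) \<Rightarrow> bool" where
  "nondeg I B \<longleftrightarrow> (\<forall>x. (\<forall>p\<in>I. app I B x p = 0) \<longrightarrow> (\<forall>p\<in>I. x p = 0))"

lemma LorD: "Lor I B \<Longrightarrow> bil I B y y > 0 \<Longrightarrow> bil I B x x * bil I B y y \<le> (bil I B x y)\<^sup>2"
  by (simp add: Lor_def)

lemma Lor_orthogonal_nonpos:
  assumes "Lor I B" "bil I B a a > 0" "bil I B x a = 0"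
  shows "bil I B x x \<le> 0"
  using LorD[OF assms(1,2), of x] assms(2,3) by (simp add: mult_le_0_iff)

lemma bil_diff_scale_left: "bil I B (\<lambda>p. x p - c * y p) z = bil I B x z - c * bil I B y z"
  using bil_add_left[of I B x "\<lambda>p. (-c) * y p" z] bil_scale_left[of I B "-c" y z] by simp

lemma discriminant_nonneg:
  fixes a b c d :: real
  assumes "a - 2 * c * b + c\<^sup>2 * d \<le> 0" "d > 0"
  shows "a * d \<le> b\<^sup>2"
proof -
  have "(a - 2 * c * b + c\<^sup>2 * d) * d \<le> 0" using assms by (simp add: mult_le_0_iff)
  moreover have "(b - c * d)\<^sup>2 \<ge> 0" by simp
  ultimately show ?thesis by (simp add: power2_eq_square algebra_simps)
qed

text \<open>The span of x and y meets the orthogonal complement of \<open>a\<close>, so the form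
  cannot be positive definite on it.\<close>

lemma LorI:
  assumes sy: "sym_form I B" and a: "bil I B a a > 0" and orth: "\<And>x. bil I B x a = 0 \<Longrightarrow> bil I B x x \<le> 0"
  shows "Lor I B"
  unfolding Lor_def
proof (intro allI impI)
  fix x y assume y: "bil I B y y > 0"
  have ya: "bil I B y a \<noteq> 0" using orth[of y] y by force
  define c where "c = bil I B x a / bil I B y a"
  have "bil I B (\<lambda>p. x p - c * y p) a = 0" unfolding bil_diff_scale_left using ya by (simp add: c_def)
  from orth[OF this] have "bil I B x x - 2 * c * bil I B x y + c\<^sup>2 * bil I B y y \<le> 0"
    by (simp add: bil_diff_self[OF sy])
  then show "bil I B x x * bil I B y y \<le> (bil I B x y)\<^sup>2" using y by (rule discriminant_nonneg)
qed

text \<open>The inequality covers congruent forms as well as restrictions from which a nonnegative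
  form has been subtracted.\<close>

lemma Lor_pullback:
  assumes sy: "sym_form J B" and L: "Lor J B" and sy': "sym_form I B'"
    and lin: "\<And>x y c. f (\<lambda>p. x p - c * y p) = (\<lambda>p. f x p - c * f y p)"
    and le: "\<And>x. bil I B' x x \<le> bil J B (f x) (f x)"
  shows "Lor I B'"
  unfolding Lor_def
proof (intro allI impI)
  fix x y assume y: "bil I B' y y > 0"
  then have fy: "bil J B (f y) (f y) > 0" using le[of y] by simp
  define c where "c = bil J B (f x) (f y) / bil J B (f y) (f y)"
  have "bil J B (\<lambda>p. f x p - c * f y p) (f y) = 0" unfolding bil_diff_scale_left using fy
      by (simp add: c_def)
  then have "bil J B (\<lambda>p. f x p - c * f y p) (\<lambda>p. f x p - c * f y p) \<le> 0"
    by (rule Lor_orthogonal_nonpos[OF L fy])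
  then have "bil I B' (\<lambda>p. x p - c * y p) (\<lambda>p. x p - c * y p) \<le> 0"
    using le[of "\<lambda>p. x p - c * y p"] by (simp add: lin)
  then have "bil I B' x x - 2 * c * bil I B' x y + c\<^sup>2 * bil I B' y y \<le> 0"
    by (simp add: bil_diff_self[OF sy'])
  then show "bil I B' x x * bil I B' y y \<le> (bil I B' x y)\<^sup>2" using y by (rule discriminant_nonneg)
qed

text \<open>The first-order perturbation argument, tested at e = p/r with \<open>r\<close> a
  positive upper bound of \<open>q\<close>.\<close>

lemma linear_le_quadratic_imp_0:
  fixes p q :: real
  assumes "\<And>e. 2 * e * p \<le> e\<^sup>2 * q"
  shows "p = 0"
proof (rule ccontr)
  assume p: "p \<noteq> 0"
  define r where "r = \<bar>q\<bar> + 1"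
  have r: "r > 0" "q \<le> r" by (auto simp: r_def)
  have "2 * (p / r) * p \<le> (p / r)\<^sup>2 * q" by (rule assms)
  also have "\<dots> \<le> (p / r)\<^sup>2 * r" using r by (intro mult_left_mono) auto
  also have "\<dots> = (p / r) * p" using r by (simp add: power2_eq_square)
  finally have "(p / r) * p \<le> 0" by simp
  moreover have "(p / r) * p > 0" using p r by (simp add: zero_less_mult_iff zero_less_divide_iff) auto
  ultimately show False by simp
qed

lemma bil_add_scaled_self:
  assumes "sym_form I B"
  shows "bil I B (\<lambda>p. y p + e * z p) (\<lambda>p. y p + e * z p)
      = bil I B y y + 2 * e * bil I B y z + e\<^sup>2 * bil I B z z"
  using bil_diff_self[OF assms, of y "-e" z] by simp

text \<open>Extends \<open>Lor_orthogonal_nonpos\<close> to isotropic \<open>y\<close> outside the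
  kernel, such as unit vectors with zero diagonal entry. If \<open>x\<close> were positive, reverse
  Cauchy-Schwarz for y + e z against x would bound a term linear in e by one quadratic in e.\<close>

lemma Lor_null_orthogonal_nonpos:
  assumes sy: "sym_form I B" and L: "Lor I B" and "bil I B y y \<ge> 0" "bil I B y z \<noteq> 0" "bil I B x y = 0"
  shows "bil I B x x \<le> 0"
proof (rule ccontr)
  assume "\<not> ?thesis"
  then have x: "bil I B x x > 0" by simp
  have "2 * e * (bil I B y z * bil I B x x) \<le> e\<^sup>2 * ((bil I B z x)\<^sup>2 - bil I B z z * bil I B x x)" for e
  proof -
    have "bil I B (\<lambda>p. y p + e * z p) x = e * bil I B z x"
      using assms(5) by (simp add: bil_add_left bil_scale_left bil_commute[OF sy, of y x])
    then have "(bil I B y y + 2 * e * bil I B y z + e\<^sup>2 * bil I B z z) * bil I B x x \<le> (e * bil I B z x)\<^sup>2"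
      using LorD[OF L x, of "\<lambda>p. y p + e * z p"] by (simp add: bil_add_scaled_self[OF sy])
    moreover have "bil I B y y * bil I B x x \<ge> 0" using assms x by simp
    ultimately show ?thesis by (simp add: algebra_simps power_mult_distrib)
  qed
  from linear_le_quadratic_imp_0[OF this] show False using x assms by simp
qed

text \<open>On the orthogonal complement of \<open>a\<close> the form is negative semidefinite, so
  an isotropic vector there is orthogonal to that complement; being orthogonal to \<open>a\<close>
  too, it is orthogonal to everything.\<close>

lemma Lor_null_imp_kernel:
  assumes sy: "sym_form I B" and L: "Lor I B" and a: "bil I B a a > 0" "bil I B y a = 0" "bil I B y y = 0"
  shows "bil I B y z = 0"
proof -
  define c where "c = bil I B z a / bil I B a a"
  define w where "w = (\<lambda>p. z p - c * a p)"
  have wa: "bil I B w a = 0" unfolding w_def bil_diff_scale_left using a by (simp add: c_def)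
  have "2 * e * bil I B y w \<le> e\<^sup>2 * (- bil I B w w)" for e
  proof -
    have "bil I B (\<lambda>p. y p + e * w p) a = 0" using wa a by (simp add: bil_add_left bil_scale_left)
    from Lor_orthogonal_nonpos[OF L a(1) this] show ?thesis
      using a by (simp add: bil_add_scaled_self[OF sy])
  qed
  then have "bil I B y w = 0" by (rule linear_le_quadratic_imp_0)
  then have "bil I B w y = 0" using bil_commute[OF sy] by simp
  then have "bil I B z y = 0" using a unfolding w_def bil_diff_scale_left
      by (simp add: bil_commute[OF sy, of a y])
  then show ?thesis using bil_commute[OF sy] by simp
qed

lemma app_eq_0_imp_bil_eq_0: "(\<And>p. p \<in> I \<Longrightarrow> app I B x p = 0) \<Longrightarrow> bil I B y x = 0"
  by (simp add: bil_eq_dot_app dot_def)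

lemma bil_eq_0_imp_app_eq_0:
  assumes "finite I" "\<And>y. bil I B y x = 0" "p \<in> I"
  shows "app I B x p = 0"
proof -
  have "0 = bil I B (\<lambda>q. if q = p then 1 else 0) x" using assms by simp
  also have "\<dots> = (\<Sum>q\<in>I. if q = p then app I B x q else 0)"
    unfolding bil_eq_dot_app dot_def by (intro sum.cong) auto
  finally show ?thesis using assms by simp
qed

section \<open>Lorentzian forms tested on a compact set\<close>

abbreviation ones :: "'a \<Rightarrow> real" where "ones \<equiv> (\<lambda>_. 1)"

text \<open>A form with \<open>B(1, 1) > 0\<close> is Lorentzian iff \<open>gap\<close> is nonnegative, and moreover nondegenerate iff
  \<open>gap\<close> is positive off the line of constant vectors; the latter is an open condition on \<open>B\<close>.\<close>

definition gap :: "'a set \<Rightarrow> ('a \<Rightarrow> 'a \<Rightarrow> real) \<Rightarrow> ('a \<Rightarrow> real) \<Rightarrow> real" where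
  "gap I B x = (bil I B x ones)\<^sup>2 - bil I B x x * bil I B ones ones"

text \<open>Representatives, up to scaling, of the nonzero classes modulo constants. Compactness
  turns pointwise positivity of \<open>gap\<close> into uniform statements.\<close>

definition sphere0 :: "'a set \<Rightarrow> ('a \<Rightarrow> real) set" where
  "sphere0 I = {x. (\<forall>p. p \<notin> I \<longrightarrow> x p = 0) \<and> dot I x x = 1} \<inter> {x. (\<Sum>p\<in>I. x p) = 0}"

lemma compact_sphere0: "finite I \<Longrightarrow> compact (sphere0 I)"
  unfolding sphere0_def by (intro compact_sphere_finite closed_Collect_eq continuous_intros)

lemma gap_nonneg: "Lor I B \<Longrightarrow> bil I B ones ones > 0 \<Longrightarrow> gap I B x \<ge> 0"
  using LorD[of I B ones x] by (simp add: gap_def)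

text \<open>\<open>gap\<close> is minus the Gram determinant of \<open>x\<close> and the constant
  vector.\<close>

lemma gap_shift:
  assumes sy: "sym_form I B"
  shows "gap I B (\<lambda>p. x p - c) = gap I B x"
proof -
  define y where "y = (\<lambda>p. x p - c * ones p)"
  have 1: "bil I B y ones = bil I B x ones - c * bil I B ones ones"
    unfolding y_def by (rule bil_diff_scale_left)
  have 2: "bil I B y y = bil I B x x - 2 * c * bil I B x ones + c\<^sup>2 * bil I B ones ones"
    unfolding y_def by (rule bil_diff_self[OF sy])
  have "gap I B y = gap I B x"
    unfolding gap_def 1 2 by (simp add: power2_eq_square algebra_simps)
  then show ?thesis by (simp add: y_def)
qed

text \<open>Removing from \<open>x\<close> its component along the constant vector leaves an
  isotropic vector orthogonal to a positive one. The last conclusion lets the gap of any other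
  symmetric form, in particular along the flow, be evaluated at the kernel vector instead of at
  \<open>x\<close>.\<close>

lemma gap_0_kernel:
  assumes sy: "sym_form I B" and L: "Lor I B" and pos: "bil I B ones ones > 0" and x: "x \<in> sphere0 I"
      and "gap I B x = 0" and fin: "finite I"
  obtains y where "\<And>p. p \<in> I \<Longrightarrow> app I B y p = 0" "\<exists>p\<in>I. y p \<noteq> 0" "\<And>p. p \<notin> I \<Longrightarrow> y p = 0"
    "\<And>B'. sym_form I B' \<Longrightarrow> gap I B' x = gap I B' y"
proof -
  define c where "c = bil I B x ones / bil I B ones ones"
  define y where "y = (\<lambda>p. x p - c)"
  define y' where "y' = (\<lambda>p. if p \<in> I then y p else 0)"
  have yy': "bil I B' y z = bil I B' y' z" "bil I B' z y = bil I B' z y'" for B' z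
    by (auto intro!: bil_cong simp: y'_def)
  have y1: "bil I B y ones = 0"
    using bil_diff_scale_left[of I B x c ones ones] pos by (simp add: y_def c_def)
  have "gap I B y = 0" using gap_shift[OF sy] assms by (simp add: y_def)
  then have y0: "bil I B y y = 0" using y1 pos by (simp add: gap_def)
  have "bil I B z y = 0" for z
    using Lor_null_imp_kernel[OF sy L pos y1 y0] bil_commute[OF sy] by metis
  then have 1: "app I B y' p = 0" if "p \<in> I" for p using that fin yy' by (intro bil_eq_0_imp_app_eq_0) auto
  have 2: "\<exists>p\<in>I. y' p \<noteq> 0"
  proof (rule ccontr)
    assume "\<not> ?thesis"
    then have xc: "\<forall>p\<in>I. x p = c" by (auto simp: y'_def y_def)
    have "dot I x x = 1" "(\<Sum>p\<in>I. x p) = 0" using x by (auto simp: sphere0_def)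
    moreover have "dot I x x = c * (\<Sum>p\<in>I. x p)" using xc by (simp add: dot_def)
    ultimately show False by simp
  qed
  have 3: "gap I B' x = gap I B' y'" if "sym_form I B'" for B'
    using gap_shift[OF that, of x c] by (simp add: y_def[symmetric]) (simp add: gap_def yy')
  show thesis by (rule that[of y']) (use 1 2 3 in \<open>auto simp: y'_def\<close>)
qed

lemma strict_imp_gap_pos:
  assumes "sym_form I B" "Lor I B" "nondeg I B" "bil I B ones ones > 0" "finite I" "x \<in> sphere0 I"
  shows "gap I B x > 0"
proof (rule ccontr)
  assume "\<not> ?thesis"
  then have "gap I B x = 0" using gap_nonneg[of I B x] assms by simp
  from gap_0_kernel[OF assms(1,2,4,6) this assms(5)] obtain y where
    "\<And>p. p \<in> I \<Longrightarrow> app I B y p = 0" "\<exists>p\<in>I. y p \<noteq> 0" by metis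
  then show False using assms(3) unfolding nondeg_def by blast
qed

lemma gap_pos_imp_strict:
  assumes sy: "sym_form I B" and gp: "\<And>x. x \<in> sphere0 I
      \<Longrightarrow> gap I B x > 0" and pos: "bil I B ones ones > 0" and fin: "finite I"
  shows "Lor I B \<and> nondeg I B"
proof -
  have I: "card I > 0" using pos fin by (auto simp: card_gt_0_iff bil_def)
  have main: "gap I B x \<ge> 0 \<and> (gap I B x = 0 \<longrightarrow> (\<exists>c. \<forall>p\<in>I. x p = c))" for x
  proof -
    \<comment> \<open>Subtracting the mean and normalising brings every nonconstant vector into
      \<open>sphere0\<close>.\<close>
    define c where "c = (\<Sum>p\<in>I. x p) / card I"
    define y where "y = (\<lambda>p. if p \<in> I then x p - c else 0)"
    have gy: "gap I B y = gap I B x"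
    proof -
      have "gap I B y = gap I B (\<lambda>p. x p - c)"
        unfolding gap_def by (intro arg_cong2[of _ _ _ _ "(-)"] arg_cong2[of _ _ _ _
            "(*)"] arg_cong[of _ _ power2] arg_cong[of _ _ "\<lambda>x. x\<^sup>2"] bil_cong) (auto simp: y_def)
      then show ?thesis by (simp add: gap_shift[OF sy])
    qed
    have sy0: "(\<Sum>p\<in>I. y p) = 0" using I by (simp add: y_def c_def sum_subtractf)
    show ?thesis
    proof (cases "dot I y y = 0")
      case True
      then have y0: "\<forall>p\<in>I. y p = 0" using fin by (simp add: dot_self_eq_0)
      then have "gap I B y = 0" by (simp add: gap_def bil_def)
      moreover have "\<forall>p\<in>I. x p = c" using y0 by (auto simp: y_def)
      ultimately show ?thesis using gy by auto
    next
      case False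
      define s where "s = sqrt (dot I y y)"
      have s: "s > 0" "s * s = dot I y y" using False dot_self_nonneg[of I y] by (auto simp: s_def)
      define z where "z = (\<lambda>p. (1/s) * y p)"
      have "dot I z z = 1"
        unfolding z_def dot_scale_left by (subst dot_commute, unfold dot_scale_left)
            (use s False in \<open>simp add: field_simps\<close>)
      moreover have "(\<Sum>p\<in>I. z p) = 0" using sy0 by (simp add: z_def sum_divide_distrib[symmetric])
      ultimately have "z \<in> sphere0 I" by (auto simp: sphere0_def z_def y_def)
      then have "gap I B z > 0" by (rule gp)
      moreover have "gap I B z = (1/s)\<^sup>2 * gap I B y"
        unfolding gap_def z_def bil_scale_left bil_scale_right by (simp add: power2_eq_square algebra_simps)
      ultimately show ?thesis using gy by (simp add: zero_less_mult_iff)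
    qed
  qed
  have L: "Lor I B"
  proof (rule LorI[OF sy pos])
    fix x assume "bil I B x ones = 0"
    then show "bil I B x x \<le> 0" using main[of x] pos by (simp add: gap_def mult_le_0_iff)
  qed
  moreover have "nondeg I B"
    unfolding nondeg_def
  proof (intro allI impI)
    fix x assume x: "\<forall>p\<in>I. app I B x p = 0"
    have k: "bil I B y x = 0" for y using x app_eq_0_imp_bil_eq_0 by metis
    then have "gap I B x = 0" using bil_commute[OF sy, of x ones] by (simp add: gap_def)
    then obtain c where c: "\<forall>p\<in>I. x p = c" using main by blast
    have "0 = bil I B ones x" using k by simp
    also have "\<dots> = bil I B ones (\<lambda>p. c * ones p)" using c by (intro bil_cong) auto
    also have "\<dots> = c * bil I B ones ones" by (rule bil_scale_right)
    finally have "c = 0" using pos by simp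
    then show "\<forall>p\<in>I. x p = 0" using c by simp
  qed
  ultimately show ?thesis by simp
qed

section \<open>Comparison with a positive vector\<close>

lemma spectral_expand:
  assumes fin: "finite I" and oe: "orthonormal_eigen I S (card I) v l"
  shows "bil I S x y = (\<Sum>k<card I. l k * dot I x (v k) * dot I y (v k))"
    and "p \<in> I \<Longrightarrow> x p = (\<Sum>k<card I. dot I x (v k) * v k p)"
proof -
  have complete: "(\<Sum>i<card I. v i p * v i q) = (if p = q then 1 else 0)" if "p \<in> I" "q \<in> I" for p q
    using orthonormal_complete[OF fin _ that] oe by (simp add: orthonormal_eigen_def)
  show ex: "x p = (\<Sum>k<card I. dot I x (v k) * v k p)" if p: "p \<in> I" for x p
  proof -
    have "(\<Sum>k<card I. dot I x (v k) * v k p) = (\<Sum>q\<in>I. \<Sum>k<card I. x q * (v k p * v k q))"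
      by (subst sum.swap) (simp add: dot_def sum_distrib_right sum_distrib_left algebra_simps)
    also have "\<dots> = (\<Sum>q\<in>I. if p = q then x q else 0)"
      using complete[OF p] by (intro sum.cong refl) (simp add: sum_distrib_left[symmetric])
    also have "\<dots> = x p" using p fin by simp
    finally show ?thesis by simp
  qed
  have ap: "app I S y p = (\<Sum>k<card I. l k * dot I y (v k) * v k p)" if p: "p \<in> I" for p
  proof -
    have "app I S y p = (\<Sum>q\<in>I. S p q * (\<Sum>k<card I. dot I y (v k) * v k q))"
      unfolding app_def by (intro sum.cong refl) (use ex in metis)
    also have "\<dots> = (\<Sum>k<card I. dot I y (v k) * app I S (v k) p)"
      unfolding app_def by (simp add: sum_distrib_left) (subst sum.swap, simp add: algebra_simps)
    also have "\<dots> = (\<Sum>k<card I. l k * dot I y (v k) * v k p)"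
      using oe p by (intro sum.cong) (auto simp: orthonormal_eigen_def)
    finally show ?thesis .
  qed
  have "bil I S x y = (\<Sum>p\<in>I. x p * (\<Sum>k<card I. l k * dot I y (v k) * v k p))"
    unfolding bil_eq_dot_app dot_def[of I x] using ap by (intro sum.cong) auto
  also have "\<dots> = (\<Sum>k<card I. l k * dot I x (v k) * dot I y (v k))"
    by (simp add: sum_distrib_left) (subst sum.swap, simp add: dot_def sum_distrib_left sum_distrib_right
        algebra_simps)
  finally show "bil I S x y = (\<Sum>k<card I. l k * dot I x (v k) * dot I y (v k))" .
qed

text \<open>Ground state substitution: write x as a times x/a and expand the square; by symmetry the
  two square terms have the same sum.\<close>

lemma perron_identity:
  assumes sy: "sym_form I Q" and a: "\<And>p. p \<in> I \<Longrightarrow> a p \<noteq> 0"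
  shows "(\<Sum>p\<in>I. \<Sum>q\<in>I. Q p q * a p * a q * (x p / a p - x q / a q)\<^sup>2)
       = 2 * ((\<Sum>p\<in>I. app I Q a p / a p * (x p)\<^sup>2) - bil I Q x x)"
proof -
  have "(\<Sum>p\<in>I. \<Sum>q\<in>I. Q p q * a p * a q * (x p / a p - x q / a q)\<^sup>2)
      = (\<Sum>p\<in>I. \<Sum>q\<in>I. Q p q * a q / a p * (x p)\<^sup>2 - 2 * (Q p q * x p * x q) + Q q p * a p / a q * (x q)\<^sup>2)"
  proof (intro sum.cong refl)
    fix p q assume pq: "p \<in> I" "q \<in> I"
    then have "Q q p = Q p q" using sy by (simp add: sym_form_def)
    then show "Q p q * a p * a q * (x p / a p - x q / a q)\<^sup>2
        = Q p q * a q / a p * (x p)\<^sup>2 - 2 * (Q p q * x p * x q) + Q q p * a p / a q * (x q)\<^sup>2"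
      using a pq by (simp add: field_simps power2_eq_square)
  qed
  also have "\<dots> = (\<Sum>p\<in>I. \<Sum>q\<in>I. Q p q * a q / a p * (x p)\<^sup>2) - 2 * bil I Q x x
      + (\<Sum>p\<in>I. \<Sum>q\<in>I. Q q p * a p / a q * (x q)\<^sup>2)"
    by (simp add: sum.distrib sum_subtractf bil_def sum_distrib_left)
  also have "(\<Sum>p\<in>I. \<Sum>q\<in>I. Q q p * a p / a q * (x q)\<^sup>2) = (\<Sum>p\<in>I. \<Sum>q\<in>I. Q p q * a q / a p * (x p)\<^sup>2)"
    by (rule sum.swap)
  also have "(\<Sum>p\<in>I. \<Sum>q\<in>I. Q p q * a q / a p * (x p)\<^sup>2) = (\<Sum>p\<in>I. app I Q a p / a p * (x p)\<^sup>2)"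
    by (simp add: app_def sum_divide_distrib sum_distrib_right)
  finally show ?thesis by simp
qed

text \<open>Diagonal entries may have any sign, since the terms with p = q vanish in
  \<open>perron_identity\<close>. Equality makes x/a agree across every positive entry, hence x a
  multiple of a when those entries connect the index set.\<close>

lemma perron_bound:
  assumes fin: "finite I" and sy: "sym_form I Q" and a: "\<And>p. p \<in> I \<Longrightarrow> a p > 0"
    and off: "\<And>p q. p \<in> I \<Longrightarrow> q \<in> I \<Longrightarrow> p \<noteq> q \<Longrightarrow> Q p q \<ge> 0"
  shows "bil I Q x x \<le> (\<Sum>p\<in>I. app I Q a p / a p * (x p)\<^sup>2)"
    and "bil I Q x x = (\<Sum>p\<in>I. app I Q a p / a p * (x p)\<^sup>2) \<Longrightarrow> p \<in> I \<Longrightarrow> q \<in> I \<Longrightarrow> p \<noteq> q \<Longrightarrow> Q p q > 0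
       \<Longrightarrow> x p / a p = x q / a q"
proof -
  have nn: "Q p q * a p * a q * (x p / a p - x q / a q)\<^sup>2 \<ge> 0" if "p \<in> I" "q \<in> I" for p q
    using a[of p] a[of q] off[of p q] that by (cases "p = q") auto
  have id: "(\<Sum>p\<in>I. \<Sum>q\<in>I. Q p q * a p * a q * (x p / a p - x q / a q)\<^sup>2)
       = 2 * ((\<Sum>p\<in>I. app I Q a p / a p * (x p)\<^sup>2) - bil I Q x x)"
    using a by (intro perron_identity[OF sy]) force
  have "(\<Sum>p\<in>I. \<Sum>q\<in>I. Q p q * a p * a q * (x p / a p - x q / a q)\<^sup>2) \<ge> 0"
    by (intro sum_nonneg nn)
  with id show "bil I Q x x \<le> (\<Sum>p\<in>I. app I Q a p / a p * (x p)\<^sup>2)" by simp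
  assume eq: "bil I Q x x = (\<Sum>p\<in>I. app I Q a p / a p * (x p)\<^sup>2)" and pq: "p \<in> I" "q \<in> I" "p \<noteq> q" "Q p q > 0"
  then have "(\<Sum>p\<in>I. \<Sum>q\<in>I. Q p q * a p * a q * (x p / a p - x q / a q)\<^sup>2) = 0" using id by simp
  then have "(\<Sum>q\<in>I. Q p q * a p * a q * (x p / a p - x q / a q)\<^sup>2) = 0"
    using fin nn pq by (subst (asm) sum_nonneg_eq_0_iff) (auto intro: sum_nonneg)
  then have "Q p q * a p * a q * (x p / a p - x q / a q)\<^sup>2 = 0"
    using fin nn pq by (subst (asm) sum_nonneg_eq_0_iff) auto
  then show "x p / a p = x q / a q" using a[OF pq(1)] a[OF pq(2)] pq by simp
qed

text \<open>In terms of the form normalised by \<open>app I Q a / a\<close>, the hypothesis says that every eigenvalue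
  satisfies \<open>l \<le> l\<^sup>2\<close>, while by Perron's argument \<open>l \<le> 1\<close> with equality only for \<open>a\<close>.\<close>

lemma bochner_Lor:
  assumes fin: "finite I" and sy: "sym_form I Q" and a: "\<And>p. p \<in> I \<Longrightarrow> a p > 0"
    and off: "\<And>p q. p \<in> I \<Longrightarrow> q \<in> I \<Longrightarrow> p \<noteq> q \<Longrightarrow> Q p q > 0"
    and pos: "\<And>p. p \<in> I \<Longrightarrow> app I Q a p > 0"
    and boch: "\<And>x. bil I Q x x \<le> (\<Sum>p\<in>I. a p / app I Q a p * (app I Q x p)\<^sup>2)"
  shows "Lor I Q"
proof (cases "I = {}")
  case True
  then show ?thesis by (simp add: Lor_def bil_def)
next
  case False
  define D where "D p = app I Q a p / a p" for p
  \<comment> \<open>Conjugation by the square root of \<open>D\<close> symmetrises the operator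
    \<open>Q\<close> divided rowwise by \<open>D\<close>, which fixes \<open>a\<close>.\<close>
  define s where "s p = sqrt (D p)" for p
  have D: "D p > 0" "s p > 0" "s p * s p = D p" if "p \<in> I" for p
    using a[OF that] pos[OF that] by (auto simp: D_def s_def)
  have nz: "s p \<noteq> 0" if "p \<in> I" for p using D(2)[OF that] by simp
  define S where "S p q = Q p q / (s p * s q)" for p q
  have "sym_form I S" using sy by (auto simp: sym_form_def S_def)
  then obtain v l where oe: "orthonormal_eigen I S (card I) v l" using spectral_theorem[OF fin] by blast
  have top: "\<exists>c. \<forall>p\<in>I. v k p = c * (s p * a p)" if k: "k < card I" "l k > 0" for k
  proof -
    define x where "x p = v k p / s p" for p
    have vv: "dot I (v k) (v k) = 1" using oe k by (simp add: orthonormal_eigen_def)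
    have ax: "app I Q x p = s p * (l k * v k p)" if p: "p \<in> I" for p
    proof -
      have "app I Q x p = s p * app I S (v k) p"
        unfolding app_def sum_distrib_left x_def S_def using nz p
            by (intro sum.cong) (auto simp: field_simps)
      then show ?thesis using oe k p by (simp add: orthonormal_eigen_def)
    qed
    have qx: "bil I Q x x = l k"
    proof -
      have "bil I Q x x = (\<Sum>p\<in>I. l k * (v k p * v k p))"
        unfolding bil_eq_dot_app dot_def using ax nz by (intro sum.cong) (auto simp: x_def field_simps)
      then show ?thesis using vv by (simp add: dot_def sum_distrib_left[symmetric])
    qed
    have "(\<Sum>p\<in>I. a p / app I Q a p * (app I Q x p)\<^sup>2) = (\<Sum>p\<in>I. (l k)\<^sup>2 * (v k p * v k p))"
    proof (intro sum.cong refl)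
      fix p assume p: "p \<in> I"
      have "a p / app I Q a p = 1 / (s p * s p)" unfolding D(3)[OF p] by (simp add: D_def)
      then show "a p / app I Q a p * (app I Q x p)\<^sup>2 = (l k)\<^sup>2 * (v k p * v k p)"
        unfolding ax[OF p] using nz[OF p] by (simp add: power2_eq_square)
    qed
    also have "\<dots> = (l k)\<^sup>2" using vv by (simp add: dot_def sum_distrib_left[symmetric])
    finally have "l k \<le> (l k)\<^sup>2" using boch[of x] qx by simp
    then have l1: "l k \<ge> 1" using k by (simp add: power2_eq_square)
    have Dx: "(\<Sum>p\<in>I. app I Q a p / a p * (x p)\<^sup>2) = 1"
    proof -
      have "(\<Sum>p\<in>I. app I Q a p / a p * (x p)\<^sup>2) = (\<Sum>p\<in>I. v k p * v k p)"
      proof (intro sum.cong refl)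
        fix p assume p: "p \<in> I"
        have "app I Q a p / a p = s p * s p" using D[OF p] by (simp add: D_def)
        then show "app I Q a p / a p * (x p)\<^sup>2 = v k p * v k p"
          using D[OF p] by (simp add: x_def power2_eq_square field_simps)
      qed
      then show ?thesis using vv by (simp add: dot_def)
    qed
    have nn: "\<And>p q. p \<in> I \<Longrightarrow> q \<in> I \<Longrightarrow> p \<noteq> q \<Longrightarrow> Q p q \<ge> 0" using off by force
    have eq: "bil I Q x x = (\<Sum>p\<in>I. app I Q a p / a p * (x p)\<^sup>2)"
      using perron_bound(1)[where x=x and a=a, OF fin sy a nn] qx Dx l1 by simp
    obtain q where q: "q \<in> I" using False by blast
    have "v k p = (x q / a q) * (s p * a p)" if p: "p \<in> I" for p
    proof -
      have "x p / a p = x q / a q"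
        using perron_bound(2)[where x=x and a=a, OF fin sy a nn eq p q] off[OF p q] by (cases "p = q") auto
      moreover have "v k p = x p / a p * (s p * a p)" using nz[OF p] a[OF p] by (simp add: x_def)
      ultimately show ?thesis by simp
    qed
    then show ?thesis by blast
  qed
  show ?thesis
  proof (rule LorI[OF sy])
    show "bil I Q a a > 0"
      unfolding bil_eq_dot_app dot_def using False fin a pos by (intro sum_pos) auto
    fix z assume z: "bil I Q z a = 0"
    define y where "y p = s p * z p" for p
    have "bil I Q z z = bil I S y y"
      unfolding bil_def y_def S_def using nz by (intro sum.cong) (auto simp: field_simps)
    also have "\<dots> = (\<Sum>k<card I. l k * (dot I y (v k))\<^sup>2)"
      by (simp add: spectral_expand(1)[OF fin oe] power2_eq_square mult.assoc)
    \<comment> \<open>A positive eigenvalue occurs only with eigenvectors proportional to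
      \<open>s * a\<close>, and \<open>y\<close> is orthogonal to those because \<open>z\<close> is
      orthogonal to \<open>a\<close> under \<open>Q\<close>.\<close>
    also have "\<dots> \<le> 0"
    proof (rule sum_nonpos)
      fix k assume k: "k \<in> {..<card I}"
      show "l k * (dot I y (v k))\<^sup>2 \<le> 0"
      proof (cases "l k > 0")
        case True
        then obtain c where c: "\<forall>p\<in>I. v k p = c * (s p * a p)" using top k by auto
        have "dot I y (v k) = (\<Sum>p\<in>I. c * (z p * app I Q a p))"
          unfolding dot_def
        proof (intro sum.cong refl)
          fix p assume p: "p \<in> I"
          have "app I Q a p = s p * s p * a p" using D[OF p] a[OF p] by (simp add: D_def)
          then show "y p * v k p = c * (z p * app I Q a p)" using c p by (simp add: y_def)
        qed
        also have "\<dots> = c * bil I Q z a" by (simp add: bil_eq_dot_app dot_def sum_distrib_left)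
        finally show ?thesis using z by simp
      qed (simp add: mult_nonpos_nonneg)
    qed
    finally show "bil I Q z z \<le> 0" .
  qed
qed

section \<open>Contraction flows and balls\<close>

text \<open>The tube lemma in filter form; the local neighbourhoods are glued by a finite
  subcover.\<close>

lemma compact_eventually:
  assumes "compact C" and ev: "\<And>z. z \<in> C \<Longrightarrow> eventually (\<lambda>(x, w). w \<in> C \<longrightarrow> P x w) (F \<times>\<^sub>F nhds z)"
  shows "eventually (\<lambda>x. \<forall>w\<in>C. P x w) F"
proof -
  have "\<forall>z\<in>C. \<exists>Q S. eventually Q F \<and> open S \<and> z \<in> S \<and> (\<forall>x w. Q x \<longrightarrow> w \<in> S \<longrightarrow> w \<in> C \<longrightarrow> P x w)"
  proof
    fix z assume "z \<in> C"
    from ev[OF this] obtain Q R where QR: "eventually Q F" "eventually R (nhds z)"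
      "\<forall>x w. Q x \<longrightarrow> R w \<longrightarrow> w \<in> C \<longrightarrow> P x w" by (auto simp: eventually_prod_filter)
    then obtain S where "open S" "z \<in> S" "\<forall>w\<in>S. R w" by (auto simp: eventually_nhds)
    then show "\<exists>Q S. eventually Q F \<and> open S \<and> z \<in> S \<and> (\<forall>x w. Q x \<longrightarrow> w \<in> S \<longrightarrow> w \<in> C \<longrightarrow> P x w)"
      using QR by blast
  qed
  then obtain Q S where QS: "\<And>z. z \<in> C \<Longrightarrow> eventually (Q z) F \<and> open (S z) \<and> z \<in> S z \<and>
      (\<forall>x w. Q z x \<longrightarrow> w \<in> S z \<longrightarrow> w \<in> C \<longrightarrow> P x w)" by metis
  obtain C' where C': "C' \<subseteq> C" "finite C'" "C \<subseteq> (\<Union>c\<in>C'. S c)"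
    using compactE_image[OF assms(1), of C S] QS by blast
  have "eventually (\<lambda>x. \<forall>c\<in>C'. Q c x) F" using C' QS by (auto simp: eventually_ball_finite_distrib)
  then show ?thesis
  proof eventually_elim
    case (elim x)
    then show ?case using C' QS by blast
  qed
qed

section \<open>Orbits and entry times\<close>

definition Esp :: "nat \<Rightarrow> (nat \<Rightarrow> real) set" where
  "Esp k = {x. \<forall>i\<ge>k. x i = 0}"

definition contraction :: "(nat \<Rightarrow> real) \<Rightarrow> real \<Rightarrow> (nat \<Rightarrow> real) \<Rightarrow> nat \<Rightarrow> real" where
  "contraction \<mu> t x = (\<lambda>i. exp (- \<mu> i * t) * x i)"

text \<open>The interior is meant relative to \<open>Esp k\<close>, which is not open in the space
  of all sequences; \<open>W\<close> is an ambient open set cutting out a part of it.\<close>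

definition absorbing :: "nat \<Rightarrow> (nat \<Rightarrow> real) \<Rightarrow> (nat \<Rightarrow> real) set \<Rightarrow> bool" where
  "absorbing k \<mu> K \<longleftrightarrow> compact K \<and> K \<subseteq> Esp k \<and> K \<noteq> {} \<and>
     (\<exists>W. open W \<and> Esp k \<inter> W \<subseteq> K \<and> (\<forall>t>0. \<forall>x\<in>K. contraction \<mu> t x \<in> W))"

lemma absorbingE:
  assumes "absorbing k \<mu> K"
  obtains W where "compact K" "K \<subseteq> Esp k" "K \<noteq> {}" "open W" "Esp k \<inter> W \<subseteq> K"
    "\<And>t x. t > 0 \<Longrightarrow> x \<in> K \<Longrightarrow> contraction \<mu> t x \<in> W"
proof -
  obtain W where "open W \<and> Esp k \<inter> W \<subseteq> K \<and> (\<forall>t>0. \<forall>x\<in>K. contraction \<mu> t x \<in> W)"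
    using assms unfolding absorbing_def by blast
  then show thesis using that[of W] assms unfolding absorbing_def by blast
qed

definition entry_time :: "(nat \<Rightarrow> real) \<Rightarrow> (nat \<Rightarrow> real) set \<Rightarrow> (nat \<Rightarrow> real) \<Rightarrow> real" where
  "entry_time \<mu> K x = Inf {t. contraction \<mu> t x \<in> K}"

lemma contraction_add: "contraction \<mu> s (contraction \<mu> t x) = contraction \<mu> (s + t) x"
  by (auto simp: contraction_def mult_exp_exp algebra_simps)

lemma contraction_0 [simp]: "contraction \<mu> 0 x = x" "contraction \<mu> t (\<lambda>_. 0) = (\<lambda>_. 0)"
  by (auto simp: contraction_def)

lemma contraction_Esp: "x \<in> Esp k \<Longrightarrow> contraction \<mu> t x \<in> Esp k"
  by (auto simp: contraction_def Esp_def)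

lemma continuous_on_contraction [continuous_intros]:
  assumes "continuous_on S f" "continuous_on S g"
  shows "continuous_on S (\<lambda>x. contraction \<mu> (f x) (g x))"
  unfolding contraction_def
  by (intro continuous_intros assms continuous_on_product_then_coordinatewise[OF assms(2)])

lemma tendsto_fun:
  assumes "\<And>i. ((\<lambda>x. f x i) \<longlongrightarrow> l i) F"
  shows "(f \<longlongrightarrow> (l :: 'a \<Rightarrow> 'b::topological_space)) F"
proof -
  have "limitin (product_topology (\<lambda>i. euclidean) UNIV) f l F"
    using assms by (simp add: limitin_componentwise)
  then show ?thesis by (simp add: euclidean_product_topology)
qed

lemma exp_decay_tendsto_0:
  fixes m c :: real
  assumes "m > 0"
  shows "((\<lambda>t. exp (- (m * t)) * c) \<longlongrightarrow> 0) at_top"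
proof -
  have "((\<lambda>t. exp (- (m * t))) \<longlongrightarrow> 0) at_top"
    by (intro filterlim_compose[OF exp_at_bot] filterlim_compose[OF filterlim_uminus_at_bot_at_top]
      filterlim_tendsto_pos_mult_at_top[OF tendsto_const] assms filterlim_ident)
  from tendsto_mult_left_zero[OF this] show ?thesis .
qed

lemma contraction_tendsto_0:
  assumes "x \<in> Esp k" "\<And>i. i < k \<Longrightarrow> \<mu> i > 0"
  shows "((\<lambda>t. contraction \<mu> t x) \<longlongrightarrow> (\<lambda>_. 0)) at_top"
proof (rule tendsto_fun)
  fix i
  show "((\<lambda>t. contraction \<mu> t x i) \<longlongrightarrow> 0) at_top"
  proof (cases "i < k")
    case True
    then show ?thesis using exp_decay_tendsto_0 assms(2) by (simp add: contraction_def)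
  next
    case False
    then show ?thesis using assms(1) by (simp add: contraction_def Esp_def)
  qed
qed

context
  fixes k :: nat and \<mu> :: "nat \<Rightarrow> real"
  assumes mu: "\<And>i. i < k \<Longrightarrow> \<mu> i > 0"
begin

text \<open>Forward orbits stay in \<open>K\<close> and converge to 0, and \<open>K\<close> is
  closed.\<close>

lemma absorbing_zero:
  assumes "absorbing k \<mu> K"
  shows "(\<lambda>_. 0) \<in> K"
proof -
  obtain W where W: "compact K" "K \<subseteq> Esp k" "K \<noteq> {}" "open W" "Esp k \<inter> W \<subseteq> K"
    "\<And>t x. t > 0 \<Longrightarrow> x \<in> K \<Longrightarrow> contraction \<mu> t x \<in> W"
    using absorbingE[OF assms] by metis
  obtain y where y: "y \<in> K" using W by blast
  have K: "contraction \<mu> t y \<in> K" if "t > 0" for t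
    using W(6)[OF that y] W(5) contraction_Esp[of y k \<mu> t] y W(2) by blast
  have "eventually (\<lambda>t. contraction \<mu> t y \<in> K) at_top"
    using eventually_gt_at_top[of 0] by eventually_elim (rule K)
  moreover have "y \<in> Esp k" using y W(2) by blast
  ultimately show ?thesis
    using Lim_in_closed_set[OF compact_imp_closed[OF W(1)] _ trivial_limit_at_top_linorder
        contraction_tendsto_0[where \<mu>=\<mu> and k=k, OF _ mu]]
    by blast
qed

lemma absorbing_bounded:
  assumes "absorbing k \<mu> K"
  obtains M where "M > 0" "\<And>y. y \<in> K \<Longrightarrow> \<bar>y i\<bar> \<le> M"
proof -
  have "compact K" using assms by (simp add: absorbing_def)
  then have "compact ((\<lambda>y. y i) ` K)" by (intro compact_continuous_image continuous_intros)
  from compact_imp_bounded[OF this] obtain M where "M > 0" "\<forall>z\<in>(\<lambda>y. y i) ` K. norm z \<le> M"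
    unfolding bounded_pos by blast
  then show thesis using that[of M] by auto
qed

text \<open>The times spent in \<open>K\<close> form a closed up-set. It is nonempty because the
  orbit converges to 0, which lies in \<open>W\<close>, and bounded below because a nonzero
  coordinate grows without bound backwards in time.\<close>

lemma entry_time_iff:
  assumes a: "absorbing k \<mu> K" and x: "x \<in> Esp k" "x \<noteq> (\<lambda>_. 0)"
  shows "contraction \<mu> t x \<in> K \<longleftrightarrow> entry_time \<mu> K x \<le> t"
proof -
  obtain W where W: "compact K" "K \<subseteq> Esp k" "K \<noteq> {}" "open W" "Esp k \<inter> W \<subseteq> K"
    "\<And>t x. t > 0 \<Longrightarrow> x \<in> K \<Longrightarrow> contraction \<mu> t x \<in> W"
    using absorbingE[OF a] by metis
  define A where "A = {t. contraction \<mu> t x \<in> K}"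
  have up: "t' \<in> A" if "t \<in> A" "t \<le> t'" for t t'
  proof (cases "t = t'")
    case False
    then have "contraction \<mu> (t' - t) (contraction \<mu> t x) \<in> W" using that by (intro W) (auto simp: A_def)
    then have "contraction \<mu> t' x \<in> W" by (simp add: contraction_add)
    then show ?thesis using W(5) contraction_Esp[OF x(1)] by (auto simp: A_def)
  qed (use that in auto)
  have "A \<noteq> {}"
  proof -
    have "(\<lambda>_. 0) \<in> W" using W(6)[of 1, OF _ absorbing_zero[OF a]] by simp
    then have "eventually (\<lambda>t. contraction \<mu> t x \<in> W) at_top"
      using contraction_tendsto_0[OF x(1) mu] W(4) by (auto simp: tendsto_def)
    then obtain t where "contraction \<mu> t x \<in> W" by (auto simp: eventually_at_top_linorder)
    then show ?thesis using W(5) contraction_Esp[OF x(1)] by (auto simp: A_def)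
  qed
  moreover have bdd: "bdd_below A"
  proof -
    obtain i where i: "x i \<noteq> 0" using x(2) by auto
    then have "i < k" using x(1) unfolding Esp_def by (metis (mono_tags) mem_Collect_eq not_le)
    then have mi: "\<mu> i > 0" by (rule mu)
    obtain M where M: "M > 0" "\<And>y. y \<in> K \<Longrightarrow> \<bar>y i\<bar> \<le> M" using absorbing_bounded[OF a, of i] by blast
    \<comment> \<open>Comes from exp(u) \<ge> 1 + u: at earlier times coordinate \<open>i\<close>
      would exceed the bound \<open>M\<close>.\<close>
    have "(1 - M / \<bar>x i\<bar>) / \<mu> i \<le> t" if "t \<in> A" for t
    proof -
      have "exp (- \<mu> i * t) * \<bar>x i\<bar> \<le> M" using M(2) that by (force simp: A_def contraction_def abs_mult)
      moreover have "(1 - \<mu> i * t) * \<bar>x i\<bar> \<le> exp (- \<mu> i * t) * \<bar>x i\<bar>"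
        using exp_ge_add_one_self[of "- \<mu> i * t"] by (intro mult_right_mono) auto
      ultimately have "(1 - \<mu> i * t) * \<bar>x i\<bar> \<le> M" by simp
      then have "1 - \<mu> i * t \<le> M / \<bar>x i\<bar>" using i by (simp add: pos_le_divide_eq)
      then have "1 - M / \<bar>x i\<bar> \<le> t * \<mu> i" by (simp add: mult.commute)
      then show ?thesis using mi by (simp only: pos_divide_le_eq)
    qed
    then show ?thesis by (rule bdd_belowI)
  qed
  moreover have "closed A"
  proof -
    have "A = (\<lambda>t. contraction \<mu> t x) -` K" by (auto simp: A_def)
    then show ?thesis
      using closed_vimage[OF compact_imp_closed[OF W(1)], of "\<lambda>t. contraction \<mu> t x"]
      by (simp add: continuous_on_contraction continuous_on_const continuous_on_id)
  qed
  ultimately have "Inf A \<in> A" by (intro closed_contains_Inf)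
  then have "t \<in> A \<longleftrightarrow> Inf A \<le> t"
    using up[of "Inf A" t] cInf_lower[OF _ bdd, of t] by blast
  then show ?thesis by (simp add: A_def entry_time_def)
qed

lemma contraction_nonzero: "x \<noteq> (\<lambda>_. 0) \<Longrightarrow> contraction \<mu> t x \<noteq> (\<lambda>_. 0)"
  by (auto simp: contraction_def fun_eq_iff)

lemma entry_time_contraction:
  assumes "absorbing k \<mu> K" "x \<in> Esp k" "x \<noteq> (\<lambda>_. 0)"
  shows "entry_time \<mu> K (contraction \<mu> s x) = entry_time \<mu> K x - s"
proof -
  have "entry_time \<mu> K (contraction \<mu> s x) \<le> t \<longleftrightarrow> entry_time \<mu> K x \<le> t + s" for t
    using entry_time_iff[OF assms, of "t + s"] entry_time_iff[OF assms(1) contraction_Esp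
        contraction_nonzero, OF assms(2,3), of t s]
    by (simp add: contraction_add)
  from this[of "entry_time \<mu> K x - s"] this[of "entry_time \<mu> K (contraction \<mu> s x)"] show ?thesis by simp
qed

text \<open>The lower estimate uses that \<open>K\<close> is closed. The upper one uses that at any
  time after entry the orbit is in the open set \<open>W\<close>, so that nearby orbits have entered
  as well.\<close>

lemma continuous_entry_time:
  assumes a: "absorbing k \<mu> K"
  shows "continuous_on (Esp k - {\<lambda>_. 0}) (entry_time \<mu> K)"
  unfolding continuous_on_def
proof
  fix x assume x: "x \<in> Esp k - {\<lambda>_. 0}"
  let ?F = "at x within (Esp k - {\<lambda>_. 0})"
  obtain W where W: "compact K" "K \<subseteq> Esp k" "open W" "Esp k \<inter> W \<subseteq> K"
    "\<And>t x. t > 0 \<Longrightarrow> x \<in> K \<Longrightarrow> contraction \<mu> t x \<in> W"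
    using absorbingE[OF a] by metis
  have lim: "((\<lambda>y. contraction \<mu> s y) \<longlongrightarrow> contraction \<mu> s x) ?F" for s
    using x continuous_on_contraction[OF continuous_on_const continuous_on_id, of "Esp k - {\<lambda>_. 0}" \<mu> s]
    by (auto simp: continuous_on_def)
  have E: "eventually (\<lambda>y. y \<in> Esp k - {\<lambda>_. 0}) ?F" by (simp add: eventually_at_filter)
  show "(entry_time \<mu> K \<longlongrightarrow> entry_time \<mu> K x) ?F"
  proof (rule order_tendstoI)
    fix s assume "s < entry_time \<mu> K x"
    then have "contraction \<mu> s x \<in> - K" using entry_time_iff[OF a, of x s] x by auto
    then have "eventually (\<lambda>y. contraction \<mu> s y \<in> - K) ?F"
      using lim[of s] compact_imp_closed[OF W(1)] by (auto simp: tendsto_def closed_def)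
    with E show "eventually (\<lambda>y. s < entry_time \<mu> K y) ?F"
      by eventually_elim (use entry_time_iff[OF a] in \<open>auto simp: not_le[symmetric]\<close>)
  next
    fix s assume s: "s > entry_time \<mu> K x"
    define r where "r = (s + entry_time \<mu> K x) / 2"
    have r: "r > entry_time \<mu> K x" "r < s" using s by (auto simp: r_def)
    have "contraction \<mu> (entry_time \<mu> K x) x \<in> K" using entry_time_iff[OF a, of x] x by auto
    from W(5)[OF _ this, of "r - entry_time \<mu> K x"] r have "contraction \<mu> r x \<in> W"
      by (simp add: contraction_add)
    then have "eventually (\<lambda>y. contraction \<mu> r y \<in> W) ?F"
      using lim[of r] W(3) by (auto simp: tendsto_def)
    with E show "eventually (\<lambda>y. entry_time \<mu> K y < s) ?F"
    proof eventually_elim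
      case (elim y)
      then have "contraction \<mu> r y \<in> K" using W(4) contraction_Esp by blast
      then have "entry_time \<mu> K y \<le> r" using entry_time_iff[OF a, of y r] elim by auto
      then show ?case using r by simp
    qed
  qed
qed

text \<open>Slides each point along its own orbit so that its time since entry into \<open>K\<close>
  becomes the time since entry into \<open>L\<close>.\<close>

definition transport :: "(nat \<Rightarrow> real) set \<Rightarrow> (nat \<Rightarrow> real) set \<Rightarrow> (nat \<Rightarrow> real) \<Rightarrow> nat \<Rightarrow> real" where
  "transport K L x = (if x = (\<lambda>_. 0) then (\<lambda>_. 0) else contraction \<mu> (entry_time \<mu> L x
      - entry_time \<mu> K x) x)"

lemma transport_Esp: "x \<in> Esp k \<Longrightarrow> transport K L x \<in> Esp k"
  using contraction_Esp by (auto simp: transport_def Esp_def)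

lemma transport_contraction:
  assumes "absorbing k \<mu> K" "absorbing k \<mu> L" "x \<in> Esp k"
  shows "transport K L (contraction \<mu> s x) = contraction \<mu> s (transport K L x)"
proof (cases "x = (\<lambda>_. 0)")
  case False
  have "entry_time \<mu> L (contraction \<mu> s x) - entry_time \<mu> K (contraction \<mu> s x) + s
      = s + (entry_time \<mu> L x - entry_time \<mu> K x)"
    using entry_time_contraction[OF assms(1,3) False, of s] entry_time_contraction[OF assms(2,3) False, of
        s] by simp
  then show ?thesis
    using False contraction_nonzero[OF False, of s] unfolding transport_def
        by (simp only: if_False contraction_add)
qed (simp add: transport_def)

lemma transport_mem:
  assumes "absorbing k \<mu> K" "absorbing k \<mu> L" "x \<in> K"
  shows "transport K L x \<in> L"
proof (cases "x = (\<lambda>_. 0)")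
  case True
  then show ?thesis using absorbing_zero[OF assms(2)] by (simp add: transport_def)
next
  case False
  have x: "x \<in> Esp k" using assms by (auto simp: absorbing_def)
  have "entry_time \<mu> K x \<le> 0" using entry_time_iff[OF assms(1) x False, of 0] assms(3) by simp
  then show ?thesis using False entry_time_iff[OF assms(2) x False] by (simp add: transport_def)
qed

lemma transport_inverse:
  assumes "absorbing k \<mu> K" "absorbing k \<mu> L" "x \<in> Esp k"
  shows "transport L K (transport K L x) = x"
proof (cases "x = (\<lambda>_. 0)")
  case False
  define s where "s = entry_time \<mu> L x - entry_time \<mu> K x"
  have "transport L K (contraction \<mu> s x) = contraction \<mu> s (transport L K x)"
    by (rule transport_contraction[OF assms(2,1,3)])
  then show ?thesis using False by (simp add: transport_def s_def contraction_add)
qed (simp add: transport_def)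

text \<open>At the origin there is no entry time to pass to the limit, so continuity there comes
  from commutation with the flow: if y is so close to 0 that moving it back by time s still leaves
  it in \<open>K\<close>, then its image moved back by s lies in the bounded set \<open>L\<close>,
  and coordinate i of the image itself is smaller by the factor
  \<open>exp (- \<mu> i * s)\<close>.\<close>

lemma continuous_transport:
  assumes K: "absorbing k \<mu> K" and L: "absorbing k \<mu> L"
  shows "continuous_on (Esp k) (transport K L)"
  unfolding continuous_on_def
proof
  fix x assume x: "x \<in> Esp k"
  show "(transport K L \<longlongrightarrow> transport K L x) (at x within Esp k)"
  proof (cases "x = (\<lambda>_. 0)")
    case False
    have "continuous_on (Esp k - {\<lambda>_. 0}) (\<lambda>x. contraction \<mu> (entry_time \<mu> L x - entry_time \<mu> K x) x)"
      by (intro continuous_intros continuous_entry_time K L)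
    then have "continuous_on (Esp k - {\<lambda>_. 0}) (transport K L)"
      by (rule continuous_on_eq) (auto simp: transport_def)
    then have "(transport K L \<longlongrightarrow> transport K L x) (at x within (Esp k - {\<lambda>_. 0}))"
      using x False by (auto simp: continuous_on_def)
    moreover have "at x within (Esp k - {\<lambda>_. 0}) = at x within Esp k"
      by (rule at_within_nhd[where S="- {\<lambda>_. 0}"]) (use False in auto)
    ultimately show ?thesis by simp
  next
    case True
    obtain W where W: "open W" "Esp k \<inter> W \<subseteq> K" "\<And>t x. t > 0 \<Longrightarrow> x \<in> K \<Longrightarrow> contraction \<mu> t x \<in> W"
      using absorbingE[OF K] by metis
    have W0: "(\<lambda>_. 0) \<in> W" using W(3)[of 1, OF _ absorbing_zero[OF K]] by simp
    have "((\<lambda>y. transport K L y i) \<longlongrightarrow> 0) (at x within Esp k)" for i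
    proof (cases "i < k")
      case i: True
      obtain M where M: "M > 0" "\<And>y. y \<in> L \<Longrightarrow> \<bar>y i\<bar> \<le> M" using absorbing_bounded[OF L, of i] by blast
      show ?thesis
        unfolding tendsto_iff
      proof (intro allI impI)
        fix e :: real assume e: "e > 0"
        have "eventually (\<lambda>t. exp (- \<mu> i * t) * M < e) at_top"
          using order_tendstoD(2)[OF exp_decay_tendsto_0[OF mu[OF i], of M] e] by simp
        then obtain s where s: "exp (- \<mu> i * s) * M < e" by (auto simp: eventually_at_top_linorder)
        have "((\<lambda>y. contraction \<mu> (-s) y) \<longlongrightarrow> contraction \<mu> (-s) x) (at x within Esp k)"
          using x continuous_on_contraction[OF continuous_on_const continuous_on_id, of "Esp k" \<mu> "-s"]
          by (auto simp: continuous_on_def)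
        then have "eventually (\<lambda>y. contraction \<mu> (-s) y \<in> W) (at x within Esp k)"
          using W(1) W0 True by (auto simp: tendsto_def)
        moreover have "eventually (\<lambda>y. y \<in> Esp k) (at x within Esp k)" by (simp add: eventually_at_filter)
        ultimately show "eventually (\<lambda>y. dist (transport K L y i) 0 < e) (at x within Esp k)"
        proof eventually_elim
          case (elim y)
          then have "contraction \<mu> (-s) y \<in> K" using W(2) contraction_Esp by blast
          then have "transport K L (contraction \<mu> (-s) y) \<in> L" by (rule transport_mem[OF K L])
          then have "\<bar>contraction \<mu> (-s) (transport K L y) i\<bar> \<le> M"
            using M(2) transport_contraction[OF K L] elim by auto
          then have "exp (\<mu> i * s) * \<bar>transport K L y i\<bar> \<le> M" by (simp add: contraction_def abs_mult)
          then have "exp (- \<mu> i * s) * (exp (\<mu> i * s) * \<bar>transport K L y i\<bar>) \<le> exp (- \<mu> i * s) * M"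
            by (intro mult_left_mono) auto
          then have "\<bar>transport K L y i\<bar> \<le> exp (- \<mu> i * s) * M"
            by (simp add: mult.assoc[symmetric] mult_exp_exp)
          then show ?case using s by simp
        qed
      qed
    next
      case False
      have "eventually (\<lambda>y. y \<in> Esp k) (at x within Esp k)" by (simp add: eventually_at_filter)
      then have "eventually (\<lambda>y. transport K L y i = 0) (at x within Esp k)"
        by eventually_elim (use transport_Esp False in \<open>force simp: Esp_def\<close>)
      then show ?thesis by (rule tendsto_eventually)
    qed
    then have "(transport K L \<longlongrightarrow> (\<lambda>_. 0)) (at x within Esp k)" by (rule tendsto_fun)
    then show ?thesis using True by (simp add: transport_def)
  qed
qed

lemma absorbing_homeomorphic:
  assumes K: "absorbing k \<mu> K" and L: "absorbing k \<mu> L"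
  shows "homeomorphism K L (transport K L) (transport L K)"
proof -
  have sub: "K \<subseteq> Esp k" "L \<subseteq> Esp k" using assms by (auto simp: absorbing_def)
  show ?thesis
  proof (rule homeomorphismI)
    show "continuous_on K (transport K L)" "continuous_on L (transport L K)"
      using continuous_on_subset[OF continuous_transport] sub K L by blast+
    show "transport K L ` K \<subseteq> L" "transport L K ` L \<subseteq> K"
      using transport_mem K L by blast+
    show "transport L K (transport K L x) = x" if "x \<in> K" for x
      using transport_inverse[OF K L] that sub by blast
    show "transport K L (transport L K y) = y" if "y \<in> L" for y
      using transport_inverse[OF L K] that sub by blast
  qed
qed

lemma absorbing_ball: "absorbing k \<mu> {x \<in> Esp k. (\<Sum>i<k. (x i)\<^sup>2) \<le> 1}"
proof -
  let ?B = "{x \<in> Esp k. (\<Sum>i<k. (x i)\<^sup>2) \<le> 1}" and ?W = "{x :: nat \<Rightarrow> real. (\<Sum>i<k. (x i)\<^sup>2) < 1}"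
  have "closed {x :: nat \<Rightarrow> real. (\<Sum>i<k. (x i)\<^sup>2) \<le> 1}"
    by (intro closed_Collect_le continuous_intros)
  moreover have "closed (Esp k)"
    using closed_support[of "{..<k}"] by (simp add: Esp_def not_less)
  ultimately have "closed ?B" by (simp add: Collect_conj_eq closed_Int)
  then have "compact ?B"
  proof (rule compact_finite_support)
    fix x p assume x: "x \<in> ?B"
    show "\<bar>x p\<bar> \<le> 1"
    proof (cases "p < k")
      case True
      then have "(x p)\<^sup>2 \<le> (\<Sum>i<k. (x i)\<^sup>2)" by (intro member_le_sum) auto
      then have "(x p)\<^sup>2 \<le> 1" using x by simp
      then show ?thesis by (simp add: abs_square_le_1)
    qed (use x in \<open>auto simp: Esp_def\<close>)
  qed
  moreover have "(\<lambda>_. 0) \<in> ?B" by (simp add: Esp_def)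
  moreover have "open ?W" by (intro open_Collect_less continuous_intros)
  moreover have "contraction \<mu> t x \<in> ?W" if "t > 0" "x \<in> ?B" for t x
  proof (cases "\<forall>i<k. x i = 0")
    case True
    then show ?thesis by (simp add: contraction_def)
  next
    case False
    then obtain i where i: "i < k" "x i \<noteq> 0" by blast
    have e1: "(exp (- \<mu> j * t))\<^sup>2 < 1" if "j < k" for j
      using mu[OF that] \<open>t > 0\<close> by (simp add: abs_square_less_1)
    have "(\<Sum>i<k. (contraction \<mu> t x i)\<^sup>2) < (\<Sum>i<k. (x i)\<^sup>2)"
    proof (rule sum_strict_mono_ex1)
      show "\<forall>j\<in>{..<k}. (contraction \<mu> t x j)\<^sup>2 \<le> (x j)\<^sup>2"
        using mult_right_mono[OF less_imp_le[OF e1] zero_le_power2]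
            by (simp add: contraction_def power_mult_distrib)
      have "(exp (- \<mu> i * t))\<^sup>2 * (x i)\<^sup>2 < 1 * (x i)\<^sup>2"
        using e1[OF i(1)] i(2) by (intro mult_strict_right_mono) auto
      then show "\<exists>j\<in>{..<k}. (contraction \<mu> t x j)\<^sup>2 < (x j)\<^sup>2"
        using i by (intro bexI[of _ i]) (auto simp: contraction_def power_mult_distrib)
    qed simp
    then show ?thesis using that by simp
  qed
  ultimately show ?thesis
    unfolding absorbing_def by (intro conjI exI[of _ ?W]) auto
qed

end

section \<open>The exclusion process on submultisets\<close>

definition mbox :: "nat multiset \<Rightarrow> nat \<Rightarrow> nat multiset set" where
  "mbox k d = {A. A \<subseteq># k \<and> size A = d}"

definition mfact :: "nat multiset \<Rightarrow> real" where
  "mfact A = (\<Prod>i\<in>set_mset A. fact (count A i))"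

text \<open>On the coefficients of monomials the weight becomes A! (k - A)!, which is, up to the
  factor k!, the inner product of the polarized multiaffine polynomials.\<close>

definition rho :: "nat multiset \<Rightarrow> nat multiset \<Rightarrow> real" where
  "rho k A = mfact (k - A) / mfact A"

definition Dsum :: "nat multiset \<Rightarrow> (nat multiset \<Rightarrow> real) \<Rightarrow> nat multiset \<Rightarrow> real" where
  "Dsum k \<phi> A = (\<Sum>i\<in>set_mset k. \<phi> (add_mset i A))"

text \<open>The generator of the exclusion process, up to adding a constant, acting on the numbers \<open>\<partial>\<^sup>A f\<close>.
  It is \<open>X \<circ> D\<close> with \<open>D = \<Sum>\<partial>\<^sub>i\<close> and \<open>X = \<Sum>(\<kappa>\<^sub>j w\<^sub>j - w\<^sub>j\<^sup>2 \<partial>\<^sub>j)\<close>; with respect to the weights \<open>rho\<close> the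
  operator \<open>X\<close> is the adjoint of \<open>D\<close>, and \<open>ker\<close> is the resulting symmetric form.\<close>

definition gen :: "nat multiset \<Rightarrow> (nat multiset \<Rightarrow> real) \<Rightarrow> nat multiset \<Rightarrow> real" where
  "gen k \<phi> A = (\<Sum>j\<in>set_mset A. real (count A j) * (real (count k j) + 1 - real (count A j)) * Dsum k \<phi> (A
      - {#j#}))"

definition ker :: "nat multiset \<Rightarrow> nat multiset \<Rightarrow> nat multiset \<Rightarrow> real" where
  "ker k A B = (\<Sum>\<gamma> | \<gamma> \<subseteq># A \<and> \<gamma> \<subseteq># B \<and> Suc (size \<gamma>) = size A. rho k \<gamma>)"

lemma finite_subsets_mset: "finite {A. A \<subseteq># (k :: 'a multiset)}"
proof (induction k)
  case (add x k)
  have "{A. A \<subseteq># add_mset x k} \<subseteq> {A. A \<subseteq># k} \<union> add_mset x ` {A. A \<subseteq># k}"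
  proof
    fix A assume A: "A \<in> {A. A \<subseteq># add_mset x k}"
    show "A \<in> {A. A \<subseteq># k} \<union> add_mset x ` {A. A \<subseteq># k}"
    proof (cases "x \<in># A")
      case True
      then obtain B where "A = add_mset x B" by (metis insert_DiffM)
      then show ?thesis using A by auto
    next
      case False
      have "A \<subseteq># k"
        unfolding subseteq_mset_def
      proof
        fix a
        have le: "count A a \<le> count (add_mset x k) a" using A by (intro mset_subset_eq_count) simp
        have "count A x = 0" using False by (simp only: count_eq_zero_iff not_False_eq_True)
        then show "count A a \<le> count k a" using le by (cases "a = x") auto
      qed
      then show ?thesis by simp
    qed
  qed
  from finite_subset[OF this] show ?case using add by simp
qed simp

lemma finite_mbox [simp]: "finite (mbox k d)"
  by (rule finite_subset[OF _ finite_subsets_mset[of k]]) (auto simp: mbox_def)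

lemma mfact_superset: "finite S \<Longrightarrow> set_mset A \<subseteq> S \<Longrightarrow> mfact A = (\<Prod>i\<in>S. fact (count A i))"
  unfolding mfact_def by (rule prod.mono_neutral_left) (auto simp: not_in_iff)

lemma mfact_add_mset: "mfact (add_mset i A) = (real (count A i) + 1) * mfact A"
proof -
  let ?S = "insert i (set_mset A)"
  have "mfact (add_mset i A) = (\<Prod>j\<in>?S. fact (count (add_mset i A) j))" by (rule mfact_superset) auto
  also have "\<dots> = fact (Suc (count A i)) * (\<Prod>j\<in>?S - {i}. fact (count (add_mset i A) j))"
    by (subst prod.remove[of _ i]) auto
  also have "(\<Prod>j\<in>?S - {i}. fact (count (add_mset i A) j)) = (\<Prod>j\<in>?S - {i}. fact (count A j) :: real)"
    by (intro prod.cong) auto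
  also have "fact (Suc (count A i)) * (\<Prod>j\<in>?S - {i}. fact (count A j) :: real)
      = (real (count A i) + 1) * (\<Prod>j\<in>?S. fact (count A j))"
    by (subst (2) prod.remove[of _ i]) (auto simp: algebra_simps)
  also have "(\<Prod>j\<in>?S. fact (count A j)) = mfact A" by (rule mfact_superset[symmetric]) auto
  finally show ?thesis .
qed

lemma mfact_pos [simp]: "mfact A > 0"
  unfolding mfact_def by (intro prod_pos) auto

lemma mfact_nonzero [simp]: "mfact A \<noteq> 0" using mfact_pos[of A] by linarith

lemma rho_pos [simp]: "rho k A > 0" by (simp add: rho_def)

lemma rho_nonzero [simp]: "rho k A \<noteq> 0" using rho_pos[of k A] by linarith

lemma mfact_diff:
  assumes "add_mset i A \<subseteq># k"
  shows "mfact (k - A) = real (count k i - count A i) * mfact (k - add_mset i A)"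
proof -
  have e: "k - A = add_mset i (k - add_mset i A)"
    using assms by (intro multiset_eqI) (auto simp: subseteq_mset_def Suc_diff_Suc dest: spec[of _ i])
  have "count A i < count k i" using assms by (metis count_add_mset mset_subset_eq_count Suc_le_lessD)
  then have "real (count (k - add_mset i A) i) + 1 = real (count k i - count A i)" by simp
  then show ?thesis by (subst e) (simp only: mfact_add_mset)
qed

text \<open>Detailed balance: the quotient of the weights of A and A + i is the coefficient with
  which \<open>gen\<close> removes i from A + i.\<close>

lemma rho_add_mset:
  assumes "add_mset i A \<subseteq># k"
  shows "rho k A = rho k (add_mset i A) * (real (count A i) + 1) * (real (count k i) - real (count A i))"
proof -
  have "count A i < count k i" using assms by (metis count_add_mset mset_subset_eq_count Suc_le_lessD)
  moreover have "real (count A i) + 1 \<noteq> 0" by linarith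
  ultimately show ?thesis
    unfolding rho_def mfact_diff[OF assms] mfact_add_mset by (simp add: of_nat_diff)
qed

text \<open>Exchanging a variable in which \<open>A\<close> exceeds \<open>B\<close> for one in
  which it falls short stays in the box, since the new multiplicity is at most that in
  \<open>B\<close>, and it decreases \<open>size (B - A)\<close>.\<close>

lemma mbox_connected:
  assumes A: "A \<in> mbox k d" "P A"
    and step: "\<And>C i j. add_mset i C \<in> mbox k d \<Longrightarrow> add_mset j C \<in> mbox k d \<Longrightarrow> P (add_mset i C)
        \<Longrightarrow> P (add_mset j C)"
    and B: "B \<in> mbox k d"
  shows "P B"
  using A
proof (induction "size (B - A)" arbitrary: A rule: less_induct)
  case less
  show ?case
  proof (cases "A = B")
    case False
    have sz: "size A = size B" using less B by (simp add: mbox_def)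
    have "\<not> A \<subseteq># B" using False sz by (metis mset_subset_size nless_le subset_mset.nless_le)
    then obtain i where i: "count A i > count B i" by (auto simp: subseteq_mset_def not_le)
    have "\<not> B \<subseteq># A" using False sz by (metis mset_subset_size nless_le subset_mset.nless_le)
    then obtain j where j: "count B j > count A j" by (auto simp: subseteq_mset_def not_le)
    have "i \<in># A" using i by (metis count_inI gr_implies_not0)
    then obtain C where C: "A = add_mset i C" by (metis insert_DiffM)
    have ij: "i \<noteq> j" using i j by auto
    have Aj: "add_mset j C \<subseteq># k"
      unfolding subseteq_mset_def
    proof
      fix a
      show "count (add_mset j C) a \<le> count k a"
      proof (cases "a = j")
        case True
        have "count (add_mset j C) j \<le> count B j" using j ij by (simp add: C)
        then show ?thesis using True B mset_subset_eq_count[of B k j] by (simp add: mbox_def)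
      next
        case False
        then show ?thesis using less(2) C mset_subset_eq_count[of A k a]
            by (auto simp: mbox_def split: if_splits)
      qed
    qed
    then have bx: "add_mset j C \<in> mbox k d" using less(2) C by (simp add: mbox_def)
    have "B - add_mset j C \<subset># B - A"
    proof -
      have 1: "count (B - add_mset j C) a \<le> count (B - A) a" for a
        using i j ij by (auto simp: C)
      have "count (B - add_mset j C) j < count (B - A) j" using i j ij by (auto simp: C)
      then show ?thesis using 1 by (metis nat_less_le subset_mset.less_le subseteq_mset_def)
    qed
    then have "size (B - add_mset j C) < size (B - A)" by (rule mset_subset_size)
    moreover have "P (add_mset j C)" using step[of i C j] less(2,3) C bx by simp
    ultimately show ?thesis using less(1) bx by blast
  qed (use less in simp)
qed

lemma mbox_extend:
  assumes "A \<subseteq># k" "size A \<le> d" "d \<le> size k"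
  obtains B where "B \<in> mbox k d" "A \<subseteq># B"
proof -
  have "\<exists>B. B \<in> mbox k d \<and> A \<subseteq># B"
    using assms
  proof (induction "d - size A" arbitrary: A)
    case 0
    then show ?case by (auto simp: mbox_def)
  next
    case (Suc m)
    then have "size A < size k" by linarith
    have "\<exists>i. count A i < count k i"
    proof (rule ccontr)
      assume "\<nexists>i. count A i < count k i"
      then have "k \<subseteq># A" by (simp add: subseteq_mset_def not_less)
      then show False using size_mset_mono \<open>size A < size k\<close> by fastforce
    qed
    then obtain i where "count A i < count k i" by blast
    then have "add_mset i A \<subseteq># k" using Suc by (auto simp: subseteq_mset_def)
    moreover have "m = d - size (add_mset i A)" "size (add_mset i A) \<le> d" using Suc by auto
    ultimately obtain B where "B \<in> mbox k d" "add_mset i A \<subseteq># B" using Suc(1)[of "add_mset i A"] Suc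
        by blast
    then show ?case by (metis mset_subset_eq_insertD subset_mset.less_imp_le)
  qed
  then show thesis using that by blast
qed

lemma ker_commute: "size A = size B \<Longrightarrow> ker k A B = ker k B A"
  unfolding ker_def by (metis (no_types, lifting))

lemma ker_nonneg: "ker k A B \<ge> 0"
  unfolding ker_def by (intro sum_nonneg) (simp add: less_imp_le)

lemma ker_pos: "ker k (add_mset i C) (add_mset j C) > 0"
  unfolding ker_def
proof (rule sum_pos2)
  show "finite {\<gamma>. \<gamma> \<subseteq># add_mset i C \<and> \<gamma> \<subseteq># add_mset j C \<and> Suc (size \<gamma>) = size (add_mset i C)}"
    by (rule finite_subset[OF _ finite_subsets_mset[of "add_mset i C"]]) auto
  show "C \<in> {\<gamma>. \<gamma> \<subseteq># add_mset i C \<and> \<gamma> \<subseteq># add_mset j C \<and> Suc (size \<gamma>) = size (add_mset i C)}"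
    by (simp add: subset_mset.less_imp_le)
qed (auto simp: less_imp_le)

lemma one_smaller_subsets: "{\<gamma>. \<gamma> \<subseteq># A \<and> Suc (size \<gamma>) = size A} = (\<lambda>j. A - {#j#}) ` set_mset A"
proof (intro equalityI subsetI)
  fix \<gamma> assume g: "\<gamma> \<in> {\<gamma>. \<gamma> \<subseteq># A \<and> Suc (size \<gamma>) = size A}"
  then have "size (A - \<gamma>) = 1" by (auto simp: size_Diff_submset)
  then obtain j where j: "A - \<gamma> = {#j#}" using size_1_singleton_mset by blast
  then have "A = add_mset j \<gamma>" using g
      by (metis add_mset_add_single mem_Collect_eq subset_mset.diff_add union_commute)
  then show "\<gamma> \<in> (\<lambda>j. A - {#j#}) ` set_mset A" by auto
next
  fix \<gamma> assume "\<gamma> \<in> (\<lambda>j. A - {#j#}) ` set_mset A"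
  then obtain j where j: "j \<in># A" "\<gamma> = A - {#j#}" by blast
  then have "A = add_mset j \<gamma>" by simp
  then show "\<gamma> \<in> {\<gamma>. \<gamma> \<subseteq># A \<and> Suc (size \<gamma>) = size A}" by (simp add: subset_mset.less_imp_le)
qed

text \<open>Double counting: the multisets of size d above a one-smaller \<gamma> are the \<gamma> +
  i, so summing over them gives \<open>Dsum\<close>. This exhibits \<open>gen\<close> as a symmetric
  operator with nonnegative entries, on which the spectral and the Perron arguments both
  rest.\<close>

lemma sum_ker:
  assumes A: "A \<in> mbox k d" and supp: "\<And>B. B \<notin> mbox k d \<Longrightarrow> \<phi> B = 0"
  shows "(\<Sum>B\<in>mbox k d. ker k A B * \<phi> B) = rho k A * gen k \<phi> A"
proof -
  let ?G = "{\<gamma>. \<gamma> \<subseteq># A \<and> Suc (size \<gamma>) = size A}"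
  have finG: "finite ?G" by (rule finite_subset[OF _ finite_subsets_mset[of A]]) auto
  have "(\<Sum>B\<in>mbox k d. ker k A B * \<phi> B) = (\<Sum>B\<in>mbox k d. \<Sum>\<gamma>\<in>?G. if \<gamma> \<subseteq># B then rho k \<gamma> * \<phi> B else 0)"
  proof (rule sum.cong[OF refl])
    fix B
    have "ker k A B = (\<Sum>\<gamma>\<in>?G \<inter> {\<gamma>. \<gamma> \<subseteq># B}. rho k \<gamma>)" unfolding ker_def by (intro sum.cong) auto
    also have "\<dots> = (\<Sum>\<gamma>\<in>?G. if \<gamma> \<subseteq># B then rho k \<gamma> else 0)"
      using finG by (subst sum.inter_restrict) auto
    finally show "ker k A B * \<phi> B = (\<Sum>\<gamma>\<in>?G. if \<gamma> \<subseteq># B then rho k \<gamma> * \<phi> B else 0)"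
      by (simp add: sum_distrib_right if_distrib[of "\<lambda>x. x * \<phi> B"] cong: if_cong)
  qed
  also have "\<dots> = (\<Sum>\<gamma>\<in>?G. rho k \<gamma> * (\<Sum>B\<in>mbox k d. if \<gamma> \<subseteq># B then \<phi> B else 0))"
    by (subst sum.swap) (simp add: sum_distrib_left if_distrib cong: if_cong)
  also have "\<dots> = (\<Sum>\<gamma>\<in>?G. rho k \<gamma> * Dsum k \<phi> \<gamma>)"
  proof (rule sum.cong[OF refl])
    fix \<gamma> assume g: "\<gamma> \<in> ?G"
    have "(\<Sum>B\<in>mbox k d. if \<gamma> \<subseteq># B then \<phi> B else 0) = (\<Sum>B\<in>{B\<in>mbox k d. \<gamma> \<subseteq># B}. \<phi> B)"
      by (subst sum.inter_filter) auto
    also have "\<dots> = (\<Sum>B\<in>(\<lambda>i. add_mset i \<gamma>) ` set_mset k. \<phi> B)"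
    proof (rule sum.mono_neutral_left)
      show "{B\<in>mbox k d. \<gamma> \<subseteq># B} \<subseteq> (\<lambda>i. add_mset i \<gamma>) ` set_mset k"
      proof
        fix B assume B: "B \<in> {B\<in>mbox k d. \<gamma> \<subseteq># B}"
        then have "\<gamma> \<in> {\<gamma>. \<gamma> \<subseteq># B \<and> Suc (size \<gamma>) = size B}" using g A by (auto simp: mbox_def)
        then obtain j where j: "j \<in># B" "\<gamma> = B - {#j#}" unfolding one_smaller_subsets by blast
        then have "B = add_mset j \<gamma>" by simp
        moreover have "j \<in># k" using B j by (auto simp: mbox_def dest: mset_subset_eqD)
        ultimately show "B \<in> (\<lambda>i. add_mset i \<gamma>) ` set_mset k" by blast
      qed
      show "\<forall>B\<in>(\<lambda>i. add_mset i \<gamma>) ` set_mset k - {B\<in>mbox k d. \<gamma> \<subseteq># B}. \<phi> B = 0"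
        using supp by (auto simp: subset_mset.less_imp_le)
    qed auto
    also have "\<dots> = Dsum k \<phi> \<gamma>"
      unfolding Dsum_def by (subst sum.reindex) (auto simp: inj_on_def)
    finally show "rho k \<gamma> * (\<Sum>B\<in>mbox k d. if \<gamma> \<subseteq># B then \<phi> B else 0) = rho k \<gamma> * Dsum k \<phi> \<gamma>" by simp
  qed
  also have "\<dots> = (\<Sum>j\<in>set_mset A. rho k (A - {#j#}) * Dsum k \<phi> (A - {#j#}))"
    unfolding one_smaller_subsets
  proof (subst sum.reindex)
    show "inj_on (\<lambda>j. A - {#j#}) (set_mset A)"
    proof (rule inj_onI)
      fix i j assume "i \<in># A" "j \<in># A" "A - {#i#} = A - {#j#}"
      then have "count (A - {#i#}) i = count (A - {#j#}) i" by simp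
      then show "i = j" using count_greater_zero_iff[of A i] \<open>i \<in># A\<close>
        by (cases "i = j") (simp_all del: count_greater_zero_iff)
    qed
  qed simp
  also have "\<dots> = rho k A * gen k \<phi> A"
    unfolding gen_def sum_distrib_left
  proof (rule sum.cong[OF refl])
    fix j assume j: "j \<in># A"
    then have a: "add_mset j (A - {#j#}) = A" by simp
    have c: "real (count (A - {#j#}) j) = real (count A j) - 1" using j by (simp add: of_nat_diff Suc_leI)
    have "add_mset j (A - {#j#}) \<subseteq># k" unfolding a using A by (simp add: mbox_def)
    from rho_add_mset[OF this] have "rho k (A - {#j#})
        = rho k A * real (count A j) * (real (count k j) + 1 - real (count A j))"
      unfolding a c by (simp add: algebra_simps)
    then show "rho k (A - {#j#}) * Dsum k \<phi> (A - {#j#})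
       = rho k A * (real (count A j) * (real (count k j) + 1 - real (count A j)) * Dsum k \<phi> (A - {#j#}))"
      by simp
  qed
  finally show ?thesis .
qed

text \<open>A multiple of the coefficient of \<open>z\<^sup>d\<close> in \<open>\<Prod>(1 + z w\<^sub>i)\<^bsup>\<kappa>\<^sub>i\<^esup>\<close>.\<close>

definition wt :: "nat multiset \<Rightarrow> nat \<Rightarrow> nat multiset \<Rightarrow> real" where
  "wt k d A = (if A \<in> mbox k d then 1 / mfact (k - A) else 0)"

lemma wt_pos: "A \<in> mbox k d \<Longrightarrow> wt k d A > 0" by (simp add: wt_def)

text \<open>Also valid when variable \<open>i\<close> is full: both sides are then 0, the right one
  by truncated subtraction.\<close>

lemma wt_add_mset:
  assumes "A \<subseteq># k" "Suc (size A) = d"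
  shows "wt k d (add_mset i A) = real (count k i - count A i) / mfact (k - A)"
proof (cases "add_mset i A \<subseteq># k")
  case True
  have "count A i < count k i" using True by (metis count_add_mset mset_subset_eq_count Suc_le_lessD)
  then show ?thesis using True assms mfact_diff[OF True] by (simp add: wt_def mbox_def)
next
  case False
  have "\<not> count A i < count k i"
  proof
    assume "count A i < count k i"
    then have "add_mset i A \<subseteq># k" using assms(1) by (auto simp: subseteq_mset_def Suc_leI)
    then show False using False by simp
  qed
  then show ?thesis using False by (simp add: wt_def mbox_def)
qed

text \<open>With A = C + j, \<open>Dsum\<close> at C is the number of free places divided by (k -
  C)!, and the factor \<kappa>_j + 1 - count A j divided by (k - C)! is the weight of A again. So
  each j contributes \<open>count A j\<close> times the same number.\<close>

lemma gen_wt: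
  assumes A: "A \<in> mbox k d"
  shows "gen k (wt k d) A = real d * (real (size k) + 1 - real d) * wt k d A"
proof -
  have "gen k (wt k d) A = (\<Sum>j\<in>set_mset A. real (count A j) * ((real (size k) + 1 - real d) * wt k d A))"
    unfolding gen_def
  proof (rule sum.cong[OF refl])
    fix j assume j: "j \<in># A"
    define C where "C = A - {#j#}"
    have AC: "A = add_mset j C" using j by (simp add: C_def)
    have sub: "add_mset j C \<subseteq># k" "C \<subseteq># k" "Suc (size C) = d" using A unfolding AC mbox_def
      by (auto dest: mset_subset_eq_insertD subset_mset.less_imp_le)
    have "Dsum k (wt k d) C = (\<Sum>i\<in>set_mset k. real (count (k - C) i)) / mfact (k - C)"
      unfolding Dsum_def by (simp add: wt_add_mset[OF sub(2,3)] sum_divide_distrib)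
    also have "(\<Sum>i\<in>set_mset k. real (count (k - C) i)) = real (\<Sum>i\<in>set_mset (k - C). count (k - C) i)"
      unfolding of_nat_sum by (rule sum.mono_neutral_right) (auto simp: not_in_iff dest: in_diffD)
    also have "(\<Sum>i\<in>set_mset (k - C). count (k - C) i) = size k - size C"
      unfolding size_multiset_overloaded_eq[symmetric] by (rule size_Diff_submset[OF sub(2)])
    finally have D: "Dsum k (wt k d) C = real (size k - size C) / mfact (k - C)" .
    have lt: "count C j < count k j" using sub(1)
        by (metis count_add_mset mset_subset_eq_count Suc_le_lessD)
    have sz: "real (size k - size C) = real (size k) + 1 - real d"
      using size_mset_mono[OF sub(1)] sub(3) by simp
    have w: "wt k d A = real (count k j - count C j) / mfact (k - C)"
      unfolding AC using wt_add_mset[OF sub(2,3)] by simp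
    have m: "real (count k j) + 1 - real (count A j) = real (count k j - count C j)"
      unfolding AC using lt by (simp add: of_nat_diff)
    show "real (count A j) * (real (count k j) + 1 - real (count A j)) * Dsum k (wt k d) (A - {#j#})
        = real (count A j) * ((real (size k) + 1 - real d) * wt k d A)"
      unfolding C_def[symmetric] m D sz w by simp
  qed
  also have "\<dots> = real (\<Sum>j\<in>set_mset A. count A j) * ((real (size k) + 1 - real d) * wt k d A)"
    by (simp add: sum_distrib_right)
  also have "(\<Sum>j\<in>set_mset A. count A j) = d" using A
      by (simp add: size_multiset_overloaded_eq[symmetric] mbox_def)
  finally show ?thesis by simp
qed

section \<open>Spectral form of the exclusion flow\<close>

locale flow_box =
  fixes k :: "nat multiset" and d :: nat
  assumes d_le: "d \<le> size k"
begin

abbreviation I :: "nat multiset set" where "I \<equiv> mbox k d"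

definition supported :: "(nat multiset \<Rightarrow> real) \<Rightarrow> bool" where
  "supported \<phi> \<longleftrightarrow> (\<forall>A. A \<notin> I \<longrightarrow> \<phi> A = 0)"

text \<open>The eigenvalue of \<open>gen\<close> on the positive vector \<open>wt\<close>;
  subtracting it makes \<open>wt\<close> stationary.\<close>

definition rate :: real where "rate = real d * (real (size k) + 1 - real d)"

definition symker :: "nat multiset \<Rightarrow> nat multiset \<Rightarrow> real" where
  "symker A B = ker k A B / (sqrt (rho k A) * sqrt (rho k B))"

definition eig :: "(nat \<Rightarrow> nat multiset \<Rightarrow> real) \<times> (nat \<Rightarrow> real)" where
  "eig = (SOME p. orthonormal_eigen I symker (card I) (fst p) (snd p))"

abbreviation "ev \<equiv> fst eig"
abbreviation "el \<equiv> snd eig"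

text \<open>Eigenvectors of \<open>gen\<close> itself, obtained by undoing the conjugation by square
  roots of \<open>rho\<close>; \<open>coef\<close> gives the dual basis.\<close>

definition dir :: "nat \<Rightarrow> nat multiset \<Rightarrow> real" where
  "dir m A = (if A \<in> I then ev m A / sqrt (rho k A) else 0)"

definition coef :: "nat \<Rightarrow> (nat multiset \<Rightarrow> real) \<Rightarrow> real" where
  "coef m \<phi> = (\<Sum>A\<in>I. ev m A * sqrt (rho k A) * \<phi> A)"

text \<open>Defined by its eigenexpansion, which makes the group law, continuity and inversion by
  negative times immediate; the differential equation is recovered in
  \<open>flow_has_derivative\<close>.\<close>

definition flow :: "real \<Rightarrow> (nat multiset \<Rightarrow> real) \<Rightarrow> nat multiset \<Rightarrow> real" where
  "flow t \<phi> A = (\<Sum>m<card I. exp ((el m - rate) * t) * coef m \<phi> * dir m A)"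

lemma sqrt_rho_pos [simp]: "sqrt (rho k A) > 0" "sqrt (rho k A) \<noteq> 0" by simp_all

lemma abs_rho [simp]: "\<bar>rho k A\<bar> = rho k A" by (simp add: less_imp_le)

lemma card_I_pos: "card I > 0"
proof -
  obtain B where "B \<in> I" using mbox_extend[of "{#}" k d] d_le by auto
  then show ?thesis by (auto simp: card_gt_0_iff)
qed

lemma sym_ker: "sym_form I (ker k)"
  unfolding sym_form_def by (auto intro!: ker_commute simp: mbox_def)

lemma orthonormal_eig: "orthonormal_eigen I symker (card I) ev el"
proof -
  have "sym_form I symker" using sym_ker by (auto simp: sym_form_def symker_def)
  then obtain v l where "orthonormal_eigen I symker (card I) v l" using spectral_theorem[OF finite_mbox]
      by blast
  then have "orthonormal_eigen I symker (card I) (fst (v, l)) (snd (v, l))" by simp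
  then show ?thesis unfolding eig_def by (rule someI)
qed

lemma coef_dot: "coef m \<phi> = dot I (\<lambda>A. sqrt (rho k A) * \<phi> A) (ev m)"
  by (simp add: coef_def dot_def algebra_simps)

lemma coef_dir: "m < card I \<Longrightarrow> m' < card I \<Longrightarrow> coef m (dir m') = (if m = m' then 1 else 0)"
proof -
  assume m: "m < card I" "m' < card I"
  have "coef m (dir m') = dot I (ev m') (ev m)"
    unfolding coef_dot dot_def by (intro sum.cong) (auto simp: dir_def)
  then show ?thesis using orthonormal_eig m by (auto simp: orthonormal_eigen_def)
qed

lemma expand:
  assumes "supported \<phi>"
  shows "\<phi> A = (\<Sum>m<card I. coef m \<phi> * dir m A)"
proof (cases "A \<in> I")
  case True
  have "sqrt (rho k A) * \<phi> A = (\<Sum>m<card I. coef m \<phi> * ev m A)"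
    unfolding coef_dot using spectral_expand(2)[OF finite_mbox orthonormal_eig True] .
  then have "\<phi> A = (\<Sum>m<card I. coef m \<phi> * ev m A) / sqrt (rho k A)" by (simp add: field_simps)
  then show ?thesis using True by (simp add: dir_def sum_divide_distrib)
qed (use assms in \<open>simp add: dir_def supported_def\<close>)

lemma coef_sum: "coef m (\<lambda>A. \<Sum>j\<in>J. a j * f j A) = (\<Sum>j\<in>J. a j * coef m (f j))"
  unfolding coef_def by (simp add: sum_distrib_left) (subst sum.swap, simp add: algebra_simps)

lemma coef_add: "coef m (\<lambda>A. \<phi> A + e * \<psi> A) = coef m \<phi> + e * coef m \<psi>"
  unfolding coef_def by (simp add: algebra_simps sum.distrib sum_distrib_left)

lemma coef_combination:
  assumes "m < card I"
  shows "coef m (\<lambda>A. \<Sum>j<card I. a j * dir j A) = a m"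
proof -
  have "coef m (\<lambda>A. \<Sum>j<card I. a j * dir j A) = (\<Sum>j<card I. if j = m then a m else 0)"
    unfolding coef_sum using assms by (intro sum.cong) (auto simp: coef_dir)
  then show ?thesis using assms by simp
qed

lemma coef_flow: "m < card I \<Longrightarrow> coef m (flow t \<phi>) = exp ((el m - rate) * t) * coef m \<phi>"
  using coef_combination[of m "\<lambda>m. exp ((el m - rate) * t) * coef m \<phi>"] by (simp add: flow_def[abs_def])

lemma supported_flow: "supported (flow t \<phi>)" by (simp add: supported_def flow_def dir_def)

lemma flow_0: "supported \<phi> \<Longrightarrow> flow 0 \<phi> = \<phi>"
  using expand[of \<phi>] by (auto simp: flow_def)

lemma flow_flow: "flow s (flow t \<phi>) = flow (s + t) \<phi>"
  unfolding flow_def[of s]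
proof
  fix A
  show "(\<Sum>m<card I. exp ((el m - rate) * s) * coef m (flow t \<phi>) * dir m A) = flow (s + t) \<phi> A"
    unfolding flow_def[of "s + t"] by (intro sum.cong) (auto simp: coef_flow distrib_left exp_add)
qed

lemma flow_add: "flow t (\<lambda>A. \<phi> A + e * \<psi> A) A = flow t \<phi> A + e * flow t \<psi> A"
  unfolding flow_def coef_add by (simp add: algebra_simps sum.distrib sum_distrib_left)

lemma gen_sum: "gen k (\<lambda>A. \<Sum>j\<in>J. a j * f j A) A = (\<Sum>j\<in>J. a j * gen k (f j) A)"
proof -
  have D: "Dsum k (\<lambda>A. \<Sum>j\<in>J. a j * f j A) C = (\<Sum>j\<in>J. a j * Dsum k (f j) C)" for C
    unfolding Dsum_def by (simp add: sum_distrib_left) (rule sum.swap)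
  show ?thesis unfolding gen_def D by (simp add: sum_distrib_left) (subst sum.swap, simp add: algebra_simps)
qed

lemma gen_dir:
  assumes m: "m < card I" and A: "A \<in> I"
  shows "gen k (dir m) A = el m * dir m A"
proof -
  have "rho k A * gen k (dir m) A = (\<Sum>B\<in>I. ker k A B * dir m B)"
    by (rule sum_ker[symmetric, OF A]) (simp add: dir_def)
  also have "\<dots> = sqrt (rho k A) * app I symker (ev m) A"
    unfolding app_def symker_def sum_distrib_left by (intro sum.cong) (auto simp: dir_def)
  also have "app I symker (ev m) A = el m * ev m A"
    using orthonormal_eig m A by (simp add: orthonormal_eigen_def)
  also have "sqrt (rho k A) * (el m * ev m A) = rho k A * (el m * dir m A)"
    using A real_sqrt_mult_self[of "rho k A"] rho_pos[of k A] by (simp add: dir_def field_simps)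
  finally show ?thesis by simp
qed

lemma flow_has_derivative:
  assumes A: "A \<in> I"
  shows "((\<lambda>t. flow t \<phi> A) has_real_derivative (gen k (flow t \<phi>) A - rate * flow t \<phi> A)) (at t)"
proof -
  have "((\<lambda>t. flow t \<phi> A) has_real_derivative
      (\<Sum>m<card I. (el m - rate) * exp ((el m - rate) * t) * coef m \<phi> * dir m A)) (at t)"
    unfolding flow_def by (auto intro!: derivative_eq_intros sum.cong)
  also have "(\<Sum>m<card I. (el m - rate) * exp ((el m - rate) * t) * coef m \<phi> * dir m A)
      = (\<Sum>m<card I. exp ((el m - rate) * t) * coef m \<phi> * gen k (dir m) A) - rate * flow t \<phi> A"
    unfolding flow_def sum_distrib_left sum_subtractf[symmetric]
    by (intro sum.cong) (auto simp: gen_dir A algebra_simps)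
  also have "(\<Sum>m<card I. exp ((el m - rate) * t) * coef m \<phi> * gen k (dir m) A) = gen k (flow t \<phi>) A"
    unfolding gen_sum[symmetric] by (simp add: flow_def[abs_def])
  finally show ?thesis .
qed

lemma continuous_on_flow [continuous_intros]:
  assumes "continuous_on S f" "\<And>A. A \<in> I \<Longrightarrow> continuous_on S (\<lambda>x. g x A)"
  shows "continuous_on S (\<lambda>x. flow (f x) (g x) A)"
  unfolding flow_def coef_def by (intro continuous_intros assms)

section \<open>Perron-Frobenius theory of the generator\<close>

lemma app_ker_wt: "A \<in> I \<Longrightarrow> app I (ker k) (wt k d) A = rho k A * rate * wt k d A"
  unfolding app_def using sum_ker[of A k d "wt k d"] gen_wt[of A k d] by (simp add: wt_def rate_def)

text \<open>The equality case of the Perron bound passes from neighbour to neighbour, and the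
  exchange graph of the box is connected.\<close>

lemma wt_const:
  assumes eq: "bil I (ker k) x x = (\<Sum>A\<in>I. app I (ker k) (wt k d) A / wt k d A * (x A)\<^sup>2)"
  obtains a where "\<And>A. A \<in> I \<Longrightarrow> x A = a * wt k d A"
proof -
  obtain A0 where A0: "A0 \<in> I" using card_I_pos by (auto simp: card_gt_0_iff)
  define a where "a = x A0 / wt k d A0"
  have "x B / wt k d B = a" if B: "B \<in> I" for B
  proof (rule mbox_connected[of A0 k d "\<lambda>B. x B / wt k d B = a", OF A0 _ _ B])
    show "x A0 / wt k d A0 = a" by (simp add: a_def)
    fix C i j assume C: "add_mset i C \<in> I" "add_mset j C \<in> I" "x (add_mset i C) / wt k d (add_mset i C) = a"
    show "x (add_mset j C) / wt k d (add_mset j C) = a"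
    proof (cases "i = j")
      case False
      then show ?thesis
        using perron_bound(2)[where x = x and a
            = "wt k d", OF finite_mbox sym_ker wt_pos ker_nonneg eq C(1,2)] ker_pos[of k i C j] C(3)
        by simp
    qed (use C in simp)
  qed
  then have "x B = a * wt k d B" if "B \<in> I" for B using that wt_pos[OF that] by (force simp: field_simps)
  then show thesis by (rule that)
qed

text \<open>Perron's bound with ground state \<open>wt\<close>: on \<open>dir m\<close>, which has
  norm 1 for the weights \<open>rho\<close>, the left side is \<open>el m\<close> and the right side
  is \<open>rate\<close>.\<close>

lemma eigenvalue_le:
  assumes m: "m < card I"
  shows "el m \<le> rate" and "el m = rate \<Longrightarrow> \<exists>a. \<forall>A\<in>I. dir m A = a * wt k d A"
proof -
  have vv: "dot I (ev m) (ev m) = 1" using orthonormal_eig m by (simp add: orthonormal_eigen_def)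
  have rd: "rho k A * dir m A * dir m A = ev m A * ev m A" if "A \<in> I" for A
    using that real_sqrt_mult_self[of "rho k A"] rho_pos[of k A] by (simp add: dir_def field_simps)
  have 1: "bil I (ker k) (dir m) (dir m) = el m"
  proof -
    have "bil I (ker k) (dir m) (dir m) = (\<Sum>A\<in>I. dir m A * (rho k A * gen k (dir m) A))"
      unfolding bil_eq_dot_app dot_def app_def
      by (intro sum.cong refl arg_cong2[of _ _ _ _ "(*)"] sum_ker) (simp_all add: dir_def)
    also have "\<dots> = (\<Sum>A\<in>I. el m * (ev m A * ev m A))"
      by (intro sum.cong refl) (simp add: gen_dir m rd[symmetric])
    finally show ?thesis using vv by (simp add: dot_def sum_distrib_left[symmetric])
  qed
  have 2: "(\<Sum>A\<in>I. app I (ker k) (wt k d) A / wt k d A * (dir m A)\<^sup>2) = rate"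
  proof -
    have "(\<Sum>A\<in>I. app I (ker k) (wt k d) A / wt k d A * (dir m A)\<^sup>2) = (\<Sum>A\<in>I. rate * (ev m A * ev m A))"
    proof (intro sum.cong refl)
      fix A assume A: "A \<in> I"
      have "app I (ker k) (wt k d) A / wt k d A = rho k A * rate"
        using wt_pos[OF A] by (simp add: app_ker_wt[OF A])
      then show "app I (ker k) (wt k d) A / wt k d A * (dir m A)\<^sup>2 = rate * (ev m A * ev m A)"
        using rd[OF A] by (simp add: power2_eq_square algebra_simps)
    qed
    then show ?thesis using vv by (simp add: dot_def sum_distrib_left[symmetric])
  qed
  show "el m \<le> rate"
    using perron_bound(1)[where x = "dir m" and a = "wt k d", OF finite_mbox sym_ker wt_pos ker_nonneg] 1 2
        by simp
  show "\<exists>a. \<forall>A\<in>I. dir m A = a * wt k d A" if "el m = rate"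
    using wt_const[of "dir m"] 1 2 that by (metis (no_types, lifting))
qed

text \<open>Self-adjointness, evaluated between the eigenvectors \<open>dir m\<close> and
  \<open>wt\<close>.\<close>

lemma coef_wt_eigen:
  assumes m: "m < card I"
  shows "(el m - rate) * coef m (wt k d) = 0"
proof -
  have "el m * coef m (wt k d) = (\<Sum>A\<in>I. rho k A * (el m * dir m A) * wt k d A)"
    unfolding coef_def sum_distrib_left
    using real_sqrt_mult_self rho_pos by (intro sum.cong) (auto simp: dir_def field_simps)
  also have "\<dots> = (\<Sum>A\<in>I. (\<Sum>B\<in>I. ker k A B * dir m B) * wt k d A)"
    by (intro sum.cong refl) (subst sum_ker, auto simp: gen_dir m dir_def)
  also have "\<dots> = bil I (ker k) (wt k d) (dir m)"
    by (simp add: bil_eq_dot_app dot_def app_def mult.commute)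
  also have "\<dots> = bil I (ker k) (dir m) (wt k d)" by (rule bil_commute[OF sym_ker])
  also have "\<dots> = (\<Sum>A\<in>I. dir m A * (rho k A * rate * wt k d A))"
    by (simp add: bil_eq_dot_app dot_def app_ker_wt)
  also have "\<dots> = rate * coef m (wt k d)"
    unfolding coef_def sum_distrib_left
    using real_sqrt_mult_self rho_pos by (intro sum.cong) (auto simp: dir_def field_simps)
  finally show ?thesis by (simp add: algebra_simps)
qed

lemma supported_wt: "supported (wt k d)" by (simp add: supported_def wt_def)

lemma flow_wt: "flow t (wt k d) = wt k d"
proof
  fix A
  have "flow t (wt k d) A = (\<Sum>m<card I. coef m (wt k d) * dir m A)"
    unfolding flow_def using coef_wt_eigen by (intro sum.cong) (auto simp: algebra_simps)
  then show "flow t (wt k d) A = wt k d A" using expand[OF supported_wt] by simp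
qed

lemma top_eigenvalue: "el 0 = rate"
proof -
  have "\<exists>m<card I. coef m (wt k d) \<noteq> 0"
  proof (rule ccontr)
    assume "\<not> ?thesis"
    then have "wt k d A = 0" for A using expand[OF supported_wt, of A] by simp
    then show False using wt_pos card_I_pos by (force simp: card_gt_0_iff)
  qed
  then obtain m where m: "m < card I" "el m = rate" using coef_wt_eigen by auto
  then have "rate \<le> el 0" using orthonormal_eig by (force simp: orthonormal_eigen_def)
  then show ?thesis using eigenvalue_le(1)[OF card_I_pos] by simp
qed

lemma top_direction: obtains a where "a \<noteq> 0" "\<And>A. dir 0 A = a * wt k d A"
proof -
  obtain a where a: "\<forall>A\<in>I. dir 0 A = a * wt k d A" using eigenvalue_le(2)[OF card_I_pos top_eigenvalue]
      by blast
  have all: "dir 0 A = a * wt k d A" for A using a by (cases "A \<in> I") (auto simp: dir_def wt_def)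
  have "a \<noteq> 0"
  proof
    assume "a = 0"
    then have "dir 0 A = 0" for A using all by simp
    then have "coef 0 (dir 0) = 0" by (simp add: coef_def)
    then show False using coef_dir[OF card_I_pos card_I_pos] by simp
  qed
  then show thesis using that all by blast
qed

text \<open>The top eigenvalue is simple, since two eigenvectors for it would both be multiples of
  \<open>wt\<close>, against orthonormality. The spectral gap makes the flow contract on the
  normalising hyperplane.\<close>

lemma eigenvalue_less:
  assumes m: "m < card I" "m > 0"
  shows "el m < rate"
proof (rule ccontr)
  assume "\<not> ?thesis"
  then have "el m = rate" using eigenvalue_le(1)[OF m(1)] by simp
  then obtain b where b: "\<forall>A\<in>I. dir m A = b * wt k d A" using eigenvalue_le(2)[OF m(1)] by blast
  obtain a where a: "a \<noteq> 0" "\<And>A. dir 0 A = a * wt k d A" using top_direction by blast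
  have "dir m A = (b / a) * dir 0 A" if "A \<in> I" for A using a b that by simp
  then have 1: "coef j (dir m) = (b / a) * coef j (dir 0)" for j
    unfolding coef_def sum_distrib_left by (intro sum.cong) auto
  have "b / a = 0" using 1[of 0] coef_dir[OF card_I_pos m(1)] coef_dir[OF card_I_pos card_I_pos] m by simp
  then have "coef m (dir m) = 0" using 1[of m] by (simp only: mult_zero_left)
  then show False using coef_dir[OF m(1) m(1)] by simp
qed

section \<open>Positivity along the flow\<close>

text \<open>The second part propagates zeros: \<open>gen\<close> at \<open>A\<close> combines the
  values of \<phi> with nonnegative coefficients, which are positive at all neighbours of
  \<open>A\<close>.\<close>

lemma gen_nonneg:
  assumes "supported \<phi>" "\<And>A. \<phi> A \<ge> 0" "A \<in> I"
  shows "gen k \<phi> A \<ge> 0" and "gen k \<phi> A = 0 \<Longrightarrow> A = add_mset i C \<Longrightarrow> add_mset j C \<in> I \<Longrightarrow> \<phi> (add_mset j C) = 0"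
proof -
  have e: "(\<Sum>B\<in>I. ker k A B * \<phi> B) = rho k A * gen k \<phi> A"
    using assms by (intro sum_ker) (auto simp: supported_def)
  have nn: "ker k A B * \<phi> B \<ge> 0" for B using assms ker_nonneg by simp
  have "0 \<le> rho k A * gen k \<phi> A" unfolding e[symmetric] by (intro sum_nonneg nn)
  then show "gen k \<phi> A \<ge> 0" using rho_pos[of k A] by (auto simp: zero_le_mult_iff)
  assume g: "gen k \<phi> A = 0" and C: "A = add_mset i C" "add_mset j C \<in> I"
  have "(\<Sum>B\<in>I. ker k A B * \<phi> B) = 0" using e g by simp
  then have "ker k A (add_mset j C) * \<phi> (add_mset j C) = 0"
    using nn C by (subst (asm) sum_nonneg_eq_0_iff) auto
  then show "\<phi> (add_mset j C) = 0" using ker_pos[of k i C j] C by simp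
qed

text \<open>The integrating factor absorbs the term with \<open>rate\<close>, leaving the
  nonnegative \<open>gen\<close> as derivative.\<close>

lemma exp_flow_mono:
  assumes A: "A \<in> I" and st: "s \<le> t" and nn: "\<And>r B. s < r \<Longrightarrow> r < t \<Longrightarrow> flow r \<phi> B \<ge> 0"
  shows "exp (rate * s) * flow s \<phi> A \<le> exp (rate * t) * flow t \<phi> A"
proof (cases "s = t")
  case False
  have "((\<lambda>t. exp (rate * t) * flow t \<phi> A) has_real_derivative exp (rate * r) * gen k (flow r \<phi>) A) (at r)"
      for r
    by (rule derivative_eq_intros flow_has_derivative[OF A] refl | simp add: algebra_simps)+
  moreover have "exp (rate * r) * gen k (flow r \<phi>) A \<ge> 0" if "s < r" "r < t" for r
    using gen_nonneg(1)[OF supported_flow nn[OF that] A] by simp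
  ultimately have "\<And>r. s < r \<Longrightarrow> r < t
      \<Longrightarrow> \<exists>y. ((\<lambda>t. exp (rate * t) * flow t \<phi> A) has_real_derivative y) (at r) \<and> y \<ge> 0"
    by blast
  moreover have "continuous_on {s..t} (\<lambda>t. exp (rate * t) * flow t \<phi> A)" by (intro continuous_intros)
  ultimately show ?thesis using DERIV_nonneg_imp_increasing_open[of s t
      "\<lambda>t. exp (rate * t) * flow t \<phi> A"] st by blast
qed simp

text \<open>Up to the first time at which a coordinate fails to be positive all coordinates are
  nonnegative, so that coordinate, rescaled by the integrating factor, has not dropped below its
  positive initial value.\<close>

lemma flow_pos:
  assumes supp: "supported \<phi>" and pos: "\<And>A. A \<in> I \<Longrightarrow> \<phi> A > 0" and "t \<ge> 0" "A \<in> I"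
  shows "flow t \<phi> A > 0"
proof (rule ccontr)
  assume "\<not> ?thesis"
  define Z where "Z = (\<Union>B\<in>I. {s. 0 \<le> s \<and> flow s \<phi> B \<le> 0})"
  have tZ: "t \<in> Z" using assms \<open>\<not> _\<close> by (auto simp: Z_def not_less)
  have cl: "closed {s. 0 \<le> s \<and> flow s \<phi> B \<le> 0}" for B
    unfolding Collect_conj_eq by (intro closed_Int closed_Collect_le continuous_intros)
  have "closed Z" unfolding Z_def by (intro closed_UN finite_mbox ballI cl)
  moreover have bdd: "bdd_below Z" by (auto simp: Z_def bdd_below_def)
  ultimately have \<tau>: "Inf Z \<in> Z" using tZ by (intro closed_contains_Inf) auto
  define \<tau> where "\<tau> = Inf Z"
  obtain B where B: "B \<in> I" "\<tau> \<ge> 0" "flow \<tau> \<phi> B \<le> 0" using \<tau> by (auto simp: Z_def \<tau>_def)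
  have "flow r \<phi> C \<ge> 0" if "0 < r" "r < \<tau>" for r C
  proof (cases "C \<in> I")
    case True
    have "r \<notin> Z" using that cInf_lower[OF _ bdd, of r] by (auto simp: \<tau>_def)
    then show ?thesis using True that by (auto simp: Z_def)
  qed (simp add: flow_def dir_def)
  from exp_flow_mono[OF B(1,2) this] have "\<phi> B \<le> exp (rate * \<tau>) * flow \<tau> \<phi> B" by (simp add: flow_0[OF supp])
  also have "\<dots> \<le> 0" using B(3) by (simp add: mult_le_0_iff)
  finally show False using pos[OF B(1)] by simp
qed

text \<open>Perturb by e times \<open>wt\<close>, which is positive and stationary, and let e tend
  to 0.\<close>

lemma flow_nonneg:
  assumes supp: "supported \<phi>" and nn: "\<And>A. \<phi> A \<ge> 0" and "t \<ge> 0"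
  shows "flow t \<phi> A \<ge> 0"
proof (cases "A \<in> I")
  case True
  have fe: "flow t \<phi> A + e * wt k d A > 0" if "e > 0" for e
  proof -
    have "flow t (\<lambda>A. \<phi> A + e * wt k d A) A > 0"
    proof (rule flow_pos)
      show "supported (\<lambda>A. \<phi> A + e * wt k d A)" using supp supported_wt by (simp add: supported_def)
      show "\<phi> B + e * wt k d B > 0" if "B \<in> I" for B using nn[of B] wt_pos[OF that] \<open>e > 0\<close>
        by (simp add: add_nonneg_pos)
    qed (use assms True in auto)
    then show ?thesis by (simp add: flow_add flow_wt)
  qed
  then have "- flow t \<phi> A / wt k d A < e" if "e > 0" for e
    using fe[OF that] by (subst pos_divide_less_eq[OF wt_pos[OF True]]) linarith
  then have "- flow t \<phi> A / wt k d A \<le> 0" by (meson dense not_le order_less_asym)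
  then show ?thesis using wt_pos[OF True] by (auto simp: zero_le_divide_iff) 
qed (simp add: flow_def dir_def)

text \<open>By monotonicity a zero at time t forces the coordinate to vanish on (0, t). Then its
  derivative vanishes there, hence so do all its neighbours, and by connectedness all coordinates.
  The flow being invertible, the initial value would be 0.\<close>

lemma flow_strictly_pos:
  assumes supp: "supported \<phi>" and nn: "\<And>A. \<phi> A \<ge> 0" and nz: "\<exists>A. \<phi> A \<noteq> 0" and t: "t > 0" and A: "A \<in> I"
  shows "flow t \<phi> A > 0"
proof (rule ccontr)
  assume "\<not> ?thesis"
  then have z: "flow t \<phi> A = 0" using flow_nonneg[OF supp nn, of t A] t by simp
  define P where "P B \<longleftrightarrow> (\<forall>s. 0 < s \<and> s < t \<longrightarrow> flow s \<phi> B = 0)" for B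
  have PA: "P A"
    unfolding P_def
  proof (intro allI impI)
    fix s assume s: "0 < s \<and> s < t"
    have "exp (rate * s) * flow s \<phi> A \<le> exp (rate * t) * flow t \<phi> A"
      by (rule exp_flow_mono[OF A]) (use s flow_nonneg[OF supp nn] in auto)
    then show "flow s \<phi> A = 0" using z flow_nonneg[OF supp nn, of s A] s by (simp add: mult_le_0_iff)
  qed
  have all: "P B" if B: "B \<in> I" for B
  proof (rule mbox_connected[of A k d P, OF A PA _ B])
    fix C i j assume C: "add_mset i C \<in> I" "add_mset j C \<in> I" "P (add_mset i C)"
    show "P (add_mset j C)"
      unfolding P_def
    proof (intro allI impI)
      fix s assume s: "0 < s \<and> s < t"
      have "eventually (\<lambda>r. flow r \<phi> (add_mset i C) = 0) (nhds s)"
        using C(3) s eventually_nhds_in_open[of "{0<..<t}" s] by (auto simp: P_def elim!: eventually_mono)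
      then have "((\<lambda>r. flow r \<phi> (add_mset i C)) has_real_derivative 0) (at s)"
        using DERIV_cong_ev[of s s "\<lambda>r. flow r \<phi> (add_mset i C)" "\<lambda>_. 0" 0 0] by simp
      then have "gen k (flow s \<phi>) (add_mset i C) - rate * flow s \<phi> (add_mset i C) = 0"
        using DERIV_unique flow_has_derivative[OF C(1)] by blast
      then have "gen k (flow s \<phi>) (add_mset i C) = 0" using C(3) s by (simp add: P_def)
      then show "flow s \<phi> (add_mset j C) = 0"
        using gen_nonneg(2)[OF supported_flow flow_nonneg[OF supp nn] C(1) _ refl C(2)] s by simp
    qed
  qed
  have "flow (t/2) \<phi> = (\<lambda>_. 0)"
    using all t supported_flow[of "t/2" \<phi>] by (force simp: P_def supported_def)
  then have "flow (-(t/2)) (flow (t/2) \<phi>) = (\<lambda>_. 0)" by (auto simp: flow_def coef_def fun_eq_iff)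
  then have "\<phi> = (\<lambda>_. 0)" by (simp add: flow_flow flow_0[OF supp])
  then show False using nz by simp
qed

end

section \<open>Hessians along the flow\<close>

definition hess :: "(nat multiset \<Rightarrow> real) \<Rightarrow> nat multiset \<Rightarrow> nat \<Rightarrow> nat \<Rightarrow> real" where
  "hess \<phi> \<alpha> p q = \<phi> (add_mset p (add_mset q \<alpha>))"

lemma sym_hess: "sym_form J (hess \<phi> \<alpha>)"
  by (simp add: sym_form_def hess_def add_mset_commute)

lemma Lor_iff_gap_nonneg:
  assumes sy: "sym_form I B" and pos: "bil I B ones ones > 0"
  shows "Lor I B \<longleftrightarrow> (\<forall>x. gap I B x \<ge> 0)"
proof
  assume g: "\<forall>x. gap I B x \<ge> 0"
  show "Lor I B"
  proof (rule LorI[OF sy pos])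
    fix x assume "bil I B x ones = 0"
    then show "bil I B x x \<le> 0" using g[rule_format, of x] pos by (simp add: gap_def mult_le_0_iff)
  qed
qed (use gap_nonneg pos in blast)

text \<open>Adding p and q to \<alpha> changes the weight c (\<kappa> + 1 - c) by its first
  differences \<kappa> - 2c, and for p = q also by its second difference -2. This diagonal
  correction supplies the strict negativity in \<open>gen_kernel_negative\<close>.\<close>

lemma gen_add2:
  assumes "\<alpha> \<subseteq># k" "p \<in># k" "q \<in># k"
  shows "gen k \<phi> (add_mset p (add_mset q \<alpha>)) =
    (\<Sum>j\<in>set_mset \<alpha>. real (count \<alpha> j) * (real (count k j) + 1
        - real (count \<alpha> j)) * Dsum k \<phi> (add_mset p (add_mset q (\<alpha> - {#j#}))))
    + (real (count k p) - 2 * real (count \<alpha> p)) * Dsum k \<phi> (add_mset q \<alpha>)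
    + (real (count k q) - 2 * real (count \<alpha> q)) * Dsum k \<phi> (add_mset p \<alpha>)
    - (if p = q then 2 * Dsum k \<phi> (add_mset p \<alpha>) else 0)"
proof -
  let ?b = "add_mset p (add_mset q \<alpha>)"
  define E where "E j = Dsum k \<phi> (?b - {#j#})" for j
  have Ep: "E p = Dsum k \<phi> (add_mset q \<alpha>)" "E q = Dsum k \<phi> (add_mset p \<alpha>)"
    by (auto simp: E_def)
  have sub: "set_mset ?b \<subseteq> set_mset k" using assms by (auto dest: mset_subset_eqD)
  have "gen k \<phi> ?b = (\<Sum>j\<in>set_mset k. real (count ?b j) * (real (count k j) + 1 - real (count ?b j)) * E j)"
    unfolding gen_def E_def by (rule sum.mono_neutral_left) (use sub in \<open>auto simp: not_in_iff\<close>)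
  also have "\<dots> = (\<Sum>j\<in>set_mset k. real (count \<alpha> j) * (real (count k j) + 1 - real (count \<alpha> j)) * E j
      + (if j = p then (real (count k j) - 2 * real (count \<alpha> j)) * E j else 0)
      + (if j = q then (real (count k j) - 2 * real (count \<alpha> j)) * E j else 0)
      - (if j = p then if p = q then 2 * E j else 0 else 0))"
    by (intro sum.cong refl) (auto simp: algebra_simps)
  also have "\<dots> = (\<Sum>j\<in>set_mset k. real (count \<alpha> j) * (real (count k j) + 1 - real (count \<alpha> j)) * E j)
      + (real (count k p) - 2 * real (count \<alpha> p)) * E p
      + (real (count k q) - 2 * real (count \<alpha> q)) * E q
      - (if p = q then 2 * E p else 0)"
    using assms by (simp add: sum.distrib sum_subtractf)
  also have "(\<Sum>j\<in>set_mset k. real (count \<alpha> j) * (real (count k j) + 1 - real (count \<alpha> j)) * E j)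
     = (\<Sum>j\<in>set_mset \<alpha>. real (count \<alpha> j) * (real (count k j) + 1 - real (count \<alpha> j)) * E j)"
    by (rule sum.mono_neutral_right) (use assms in \<open>auto simp: not_in_iff dest: mset_subset_eqD\<close>)
  also have "\<dots> = (\<Sum>j\<in>set_mset \<alpha>. real (count \<alpha> j) * (real (count k j) + 1
      - real (count \<alpha> j)) * Dsum k \<phi> (add_mset p (add_mset q (\<alpha> - {#j#}))))"
    by (intro sum.cong refl) (simp add: E_def)
  finally show ?thesis unfolding Ep(2) using Ep(1) by auto
qed

context flow_box
begin

text \<open>The variables whose cap \<alpha> does not use up. For a supported \<phi> all other rows
  of the Hessian at \<alpha> vanish, so nondegeneracy can be asked only on these.\<close>

abbreviation act :: "nat multiset \<Rightarrow> nat set" where "act \<alpha> \<equiv> set_mset (k - \<alpha>)"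

definition idx :: "nat multiset set" where "idx = {\<alpha>. \<alpha> \<subseteq># k \<and> size \<alpha> + 2 = d}"

text \<open>Full support in the box is included because it makes every Hessian positive at the
  all-ones vector, as the \<open>gap\<close> criterion presupposes.\<close>

definition weak :: "(nat multiset \<Rightarrow> real) \<Rightarrow> bool" where
  "weak \<phi> \<longleftrightarrow> supported \<phi> \<and> (\<forall>A\<in>I. \<phi> A > 0) \<and> (\<forall>\<alpha>\<in>idx. Lor (act \<alpha>) (hess \<phi> \<alpha>))"

definition strict :: "(nat multiset \<Rightarrow> real) \<Rightarrow> bool" where
  "strict \<phi> \<longleftrightarrow> weak \<phi> \<and> (\<forall>\<alpha>\<in>idx. nondeg (act \<alpha>) (hess \<phi> \<alpha>))"

lemma act_subset: "act \<alpha> \<subseteq> set_mset k" by (auto dest: in_diffD)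

lemma supported_hess_outside: "supported \<phi> \<Longrightarrow> p \<notin> act \<alpha> \<Longrightarrow> \<phi> (add_mset p (add_mset q \<alpha>)) = 0"
proof -
  assume s: "supported \<phi>" and p: "p \<notin> act \<alpha>"
  have "\<not> add_mset p (add_mset q \<alpha>) \<subseteq># k"
  proof
    assume sub: "add_mset p (add_mset q \<alpha>) \<subseteq># k"
    have "count (add_mset p (add_mset q \<alpha>)) p \<le> count k p" by (rule mset_subset_eq_count[OF sub])
    then have "count \<alpha> p < count k p" by (auto split: if_splits)
    then have "p \<in># k - \<alpha>" by (simp add: in_diff_count)
    then show False using p by simp
  qed
  then show ?thesis using s by (simp add: supported_def mbox_def)
qed

lemma supported_hess_outside': "supported \<phi> \<Longrightarrow> q \<notin> act \<alpha> \<Longrightarrow> \<phi> (add_mset p (add_mset q \<alpha>)) = 0"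
  using supported_hess_outside[of \<phi> q \<alpha> p] by (simp add: add_mset_commute)

lemma bil_act: "supported \<phi> \<Longrightarrow> bil (act \<alpha>) (hess \<phi> \<alpha>) x y = bil (set_mset k) (hess \<phi> \<alpha>) x y"
proof -
  assume s: "supported \<phi>"
  have 1: "(\<Sum>q\<in>act \<alpha>. hess \<phi> \<alpha> p q * x p * y q) = (\<Sum>q\<in>set_mset k. hess \<phi> \<alpha> p q * x p * y q)" for p
    by (rule sum.mono_neutral_left) (use act_subset supported_hess_outside'[OF s] in \<open>auto simp: hess_def\<close>)
  show ?thesis
    unfolding bil_def 1
    by (rule sum.mono_neutral_left) (use act_subset supported_hess_outside[OF s] in \<open>auto simp: hess_def\<close>)
qed

lemma Lor_act: "supported \<phi> \<Longrightarrow> Lor (act \<alpha>) (hess \<phi> \<alpha>) \<longleftrightarrow> Lor (set_mset k) (hess \<phi> \<alpha>)"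
  unfolding Lor_def by (simp add: bil_act)

lemma idx_extend:
  assumes "A \<subseteq># k" "Suc (size A) = d"
  obtains q where "q \<in># k" "add_mset q A \<in> I"
proof -
  obtain B where B: "B \<in> I" "A \<subseteq># B" using mbox_extend[of A k d] assms d_le by auto
  then have "A \<in> {\<gamma>. \<gamma> \<subseteq># B \<and> Suc (size \<gamma>) = size B}" using assms by (simp add: mbox_def)
  then obtain q where q: "q \<in># B" "A = B - {#q#}" unfolding one_smaller_subsets by blast
  then have "add_mset q A = B" by simp
  moreover have "q \<in># k" using q B by (auto simp: mbox_def dest: mset_subset_eqD)
  ultimately show thesis using that B by blast
qed

lemma add_act: "\<alpha> \<subseteq># k \<Longrightarrow> p \<in> act \<alpha> \<Longrightarrow> add_mset p \<alpha> \<subseteq># k"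
  by (auto simp: subseteq_mset_def in_diff_count Suc_leI)

lemma bil_ones_pos:
  assumes s: "supported \<phi>" and pos: "\<And>A. A \<in> I \<Longrightarrow> \<phi> A > 0" and a: "\<alpha> \<in> idx"
  shows "bil (act \<alpha>) (hess \<phi> \<alpha>) ones ones > 0"
proof -
  have nn: "\<phi> A \<ge> 0" for A using s pos[of A] by (cases "A \<in> I") (auto simp: supported_def)
  obtain B where B: "B \<in> mbox k (d - 1)" "\<alpha> \<subseteq># B" 
    by (rule mbox_extend[of \<alpha> k "d - 1"]) (use a d_le in \<open>auto simp: idx_def\<close>)
  then have "\<alpha> \<in> {\<gamma>. \<gamma> \<subseteq># B \<and> Suc (size \<gamma>) = size B}" using a by (auto simp: mbox_def idx_def)
  then obtain p where p: "p \<in># B" "\<alpha> = B - {#p#}" unfolding one_smaller_subsets by blast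
  have pB: "add_mset p \<alpha> = B" using p by simp
  then obtain q where q: "q \<in># k" "add_mset q (add_mset p \<alpha>) \<in> I"
    using idx_extend[of B] B a by (auto simp: mbox_def idx_def)
  have pk: "p \<in># k" using p B by (auto simp: mbox_def dest: mset_subset_eqD)
  have "0 < hess \<phi> \<alpha> q p * ones q * ones p" using pos[OF q(2)] by (simp add: hess_def)
  also have "\<dots> \<le> (\<Sum>p\<in>set_mset k. hess \<phi> \<alpha> q p * ones q * ones p)"
    by (rule member_le_sum) (use pk nn in \<open>auto simp: hess_def\<close>)
  also have "\<dots> \<le> bil (set_mset k) (hess \<phi> \<alpha>) ones ones"
    unfolding bil_def by (rule member_le_sum) (use q nn in \<open>auto simp: hess_def intro!: sum_nonneg\<close>)
  finally show ?thesis by (simp add: bil_act[OF s])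
qed

text \<open>Nothing flows out of the box: if A exceeds the cap of the removed j by one, the factor
  \<kappa>_j + 1 - count A j is 0; in all other cases outside the box every A - j + i is outside as
  well.\<close>

lemma supported_gen:
  assumes s: "supported \<phi>"
  shows "supported (gen k \<phi>)"
  unfolding supported_def
proof (intro allI impI)
  fix A assume A: "A \<notin> I"
  show "gen k \<phi> A = 0"
    unfolding gen_def
  proof (rule sum.neutral, intro ballI)
    fix j assume j: "j \<in># A"
    have sz: "size (add_mset i (A - {#j#})) = size A" for i using j by (metis insert_DiffM size_add_mset)
    show "real (count A j) * (real (count k j) + 1 - real (count A j)) * Dsum k \<phi> (A - {#j#}) = 0"
    proof (cases "size A = d \<and> A - {#j#} \<subseteq># k")
      case True
      then obtain p where p: "count A p > count k p" using A
          by (auto simp: mbox_def subseteq_mset_def not_le)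
      have "count (A - {#j#}) p \<le> count k p" using True by (intro mset_subset_eq_count) simp
      have pj: "p = j"
      proof (rule ccontr)
        assume "p \<noteq> j"
        then have "count (A - {#j#}) p = count A p" by simp
        then show False using p \<open>count (A - {#j#}) p \<le> count k p\<close> by linarith
      qed
      then have "count A j = Suc (count k j)" using p \<open>count (A - {#j#}) p \<le> count k p\<close> by simp
      then show ?thesis by simp
    next
      case False
      have "\<phi> (add_mset i (A - {#j#})) = 0" for i
      proof -
        have "add_mset i (A - {#j#}) \<notin> I"
        proof
          assume i: "add_mset i (A - {#j#}) \<in> I"
          then have "size A = d" "add_mset i (A - {#j#}) \<subseteq># k" using sz[of i] by (auto simp: mbox_def)
          then show False using False by (meson mset_subset_eq_insertD subset_mset.less_imp_le)
        qed
        then show ?thesis using s by (simp add: supported_def)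
      qed
      then show ?thesis by (simp add: Dsum_def)
    qed
  qed
qed

text \<open>If \<open>y\<close> is a kernel vector of the Hessian at \<open>\<alpha>\<close>, then moving one element \<open>j\<close> of \<open>\<alpha>\<close> to \<open>i\<close>
  gives a Lorentzian form in which \<open>y\<close> is orthogonal to the \<open>j\<close>-th unit vector.\<close>

lemma kernel_neighbour_nonpos:
  assumes w: "weak \<phi>" and a: "\<alpha> \<in> idx" and ker: "\<And>p. p \<in> act \<alpha> \<Longrightarrow> app (act \<alpha>) (hess \<phi> \<alpha>) y p = 0"
    and supp: "\<And>p. p \<notin> act \<alpha> \<Longrightarrow> y p = 0" and j: "j \<in># \<alpha>"
  shows "bil (act \<alpha>) (hess \<phi> (add_mset i (\<alpha> - {#j#}))) y y \<le> 0"
proof -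
  have s: "supported \<phi>" and pos: "\<And>A. A \<in> I \<Longrightarrow> \<phi> A > 0" using w by (auto simp: weak_def)
  have nn: "\<phi> A \<ge> 0" for A using s pos[of A] by (cases "A \<in> I") (auto simp: supported_def)
  define \<gamma> where "\<gamma> = add_mset i (\<alpha> - {#j#})"
  have big: "bil (act \<alpha>) B y z = bil (set_mset k) B y z" if "\<And>p. p \<notin> act \<alpha> \<Longrightarrow> z p = 0" for B z
  proof -
    have 1: "(\<Sum>q\<in>act \<alpha>. B p q * y p * z q) = (\<Sum>q\<in>set_mset k. B p q * y p * z q)" for p
      by (rule sum.mono_neutral_left) (use act_subset that in auto)
    show ?thesis
      unfolding bil_def 1 by (rule sum.mono_neutral_left) (use act_subset supp in auto)
  qed
  have kern: "(\<Sum>q\<in>set_mset k. \<phi> (add_mset p (add_mset q \<alpha>)) * y q) = 0" for p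
  proof (cases "p \<in> act \<alpha>")
    case True
    have "(\<Sum>q\<in>set_mset k. \<phi> (add_mset p (add_mset q \<alpha>)) * y q)
        = (\<Sum>q\<in>act \<alpha>. \<phi> (add_mset p (add_mset q \<alpha>)) * y q)"
      by (rule sum.mono_neutral_right) (use act_subset supp in auto)
    then show ?thesis using ker[OF True] by (simp add: app_def hess_def)
  qed (simp add: supported_hess_outside[OF s])
  show ?thesis
  proof (cases "\<gamma> \<subseteq># k")
    case False
    have "hess \<phi> \<gamma> p q = 0" for p q
    proof -
      have "\<not> add_mset p (add_mset q \<gamma>) \<subseteq># k" using False
        by (meson mset_subset_eq_insertD subset_mset.less_imp_le)
      then show ?thesis using s by (simp add: hess_def supported_def mbox_def)
    qed
    then show ?thesis by (simp add: bil_def \<gamma>_def)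
  next
    case True
    show ?thesis
    proof (cases "i = j")
      case True
      then have "\<gamma> = \<alpha>" using j by (simp add: \<gamma>_def)
      then show ?thesis using app_eq_0_imp_bil_eq_0[of "act \<alpha>" "hess \<phi> \<alpha>" y y] ker by (simp add: \<gamma>_def)
    next
      case False
      have sz: "size \<gamma> = size \<alpha>" using j by (metis \<gamma>_def insert_DiffM size_add_mset)
      have g: "\<gamma> \<in> idx" using True a sz by (simp add: idx_def)
      have L: "Lor (set_mset k) (hess \<phi> \<gamma>)" using w g Lor_act[OF s] by (simp add: weak_def)
      \<comment> \<open>Row j of the neighbouring Hessian is therefore row i of the Hessian at
        \<alpha>, on which y vanishes.\<close>
      have gj: "add_mset j \<gamma> = add_mset i \<alpha>" using j by (simp add: \<gamma>_def add_mset_commute)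
      have ia: "add_mset i \<alpha> \<subseteq># k"
        unfolding subseteq_mset_def
      proof
        fix b
        show "count (add_mset i \<alpha>) b \<le> count k b"
          using mset_subset_eq_count[OF True, of b] mset_subset_eq_count[of \<alpha> k b] a False
          by (cases "b = i") (auto simp: \<gamma>_def idx_def)
      qed
      obtain q where q: "q \<in># k" "add_mset q (add_mset i \<alpha>) \<in> I"
        using idx_extend[OF ia] a by (auto simp: idx_def)
      have jk: "j \<in># k" using j a by (auto simp: idx_def dest: mset_subset_eqD)
      define e where "e = (\<lambda>j p. if p = (j::nat) then 1 else (0::real))"
      have e: "bil (set_mset k) B x (e p) = (\<Sum>q\<in>set_mset k. B q p * x q)" if "p \<in># k" for B x p
        using that by (simp add: bil_def e_def if_distrib cong: if_cong)
      \<comment> \<open>The j-th unit vector may be isotropic, but it is not in the kernel, because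
        its entry at \<open>q\<close> is positive.\<close>
      have "bil (set_mset k) (hess \<phi> \<gamma>) y y \<le> 0"
      proof (rule Lor_null_orthogonal_nonpos[OF sym_hess L])
        show "bil (set_mset k) (hess \<phi> \<gamma>) (e j) (e j) \<ge> 0"
          unfolding e[OF jk] by (intro sum_nonneg) (simp add: hess_def nn e_def)
        have hjq: "hess \<phi> \<gamma> j q = \<phi> (add_mset q (add_mset i \<alpha>))"
          unfolding hess_def add_mset_commute[of j q] gj ..
        have "bil (set_mset k) (hess \<phi> \<gamma>) (e j) (e q) = (\<Sum>p\<in>set_mset k. if p = j then hess \<phi> \<gamma> p q else 0)"
          unfolding e[OF q(1)] by (intro sum.cong) (auto simp: e_def)
        also have "\<dots> = \<phi> (add_mset q (add_mset i \<alpha>))"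
          using jk by (simp add: hjq)
        finally show "bil (set_mset k) (hess \<phi> \<gamma>) (e j) (e q) \<noteq> 0" using pos[OF q(2)] by simp
        have "bil (set_mset k) (hess \<phi> \<gamma>) y (e j) = (\<Sum>q\<in>set_mset k. \<phi> (add_mset i (add_mset q \<alpha>)) * y q)"
          unfolding e[OF jk] hess_def add_mset_commute[of _ j] gj
          by (simp add: add_mset_commute[of i])
        then show "bil (set_mset k) (hess \<phi> \<gamma>) y (e j) = 0" using kern by simp
      qed
      then show ?thesis using big[of y] supp by (simp add: \<gamma>_def)
    qed
  qed
qed

text \<open>In the expansion of \<open>gen_add2\<close> the neighbour terms are nonpositive by
  \<open>kernel_neighbour_nonpos\<close>, the first differences drop out because the products of y_q
  and D_q sum to 0, and the second difference leaves minus the sum of 2 y_p^2 D_p with all D_p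
  positive.\<close>

lemma gen_kernel_negative:
  assumes w: "weak \<phi>" and a: "\<alpha> \<in> idx" and ker: "\<And>p. p \<in> act \<alpha> \<Longrightarrow> app (act \<alpha>) (hess \<phi> \<alpha>) y p = 0"
    and supp: "\<And>p. p \<notin> act \<alpha> \<Longrightarrow> y p = 0" and nz: "\<exists>p\<in>act \<alpha>. y p \<noteq> 0"
  shows "bil (act \<alpha>) (hess (gen k \<phi>) \<alpha>) y y < 0"
proof -
  have s: "supported \<phi>" and pos: "\<And>A. A \<in> I \<Longrightarrow> \<phi> A > 0" using w by (auto simp: weak_def)
  have nn: "\<phi> A \<ge> 0" for A using s pos[of A] by (cases "A \<in> I") (auto simp: supported_def)
  have ak: "\<alpha> \<subseteq># k" using a by (simp add: idx_def)
  have kern: "(\<Sum>q\<in>act \<alpha>. y q * \<phi> (add_mset p (add_mset q \<alpha>))) = 0" for p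
    using ker[of p] supported_hess_outside[OF s, of p \<alpha>]
    by (cases "p \<in> act \<alpha>") (simp_all add: app_def hess_def mult.commute)
  have kernD: "(\<Sum>q\<in>act \<alpha>. y q * Dsum k \<phi> (add_mset q \<alpha>)) = 0"
    unfolding Dsum_def sum_distrib_left by (subst sum.swap) (simp add: kern)
  define b where "b j = real (count \<alpha> j) * (real (count k j) + 1 - real (count \<alpha> j))" for j
  define D where "D p = Dsum k \<phi> (add_mset p \<alpha>)" for p
  define c where "c p = real (count k p) - 2 * real (count \<alpha> p)" for p
  have "bil (act \<alpha>) (hess (gen k \<phi>) \<alpha>) y y = (\<Sum>p\<in>act \<alpha>. \<Sum>q\<in>act \<alpha>.
      (\<Sum>j\<in>set_mset \<alpha>. b j * (y p * y q * Dsum k \<phi> (add_mset p (add_mset q (\<alpha> - {#j#})))))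
      + c p * y p * (y q * D q) + y p * D p * (c q * y q) - (if p = q then 2 * (y p)\<^sup>2 * D p else 0))"
    unfolding bil_def
  proof (intro sum.cong refl)
    fix p q assume "p \<in> act \<alpha>" "q \<in> act \<alpha>"
    then have pq: "p \<in># k" "q \<in># k" using act_subset by auto
    show "hess (gen k \<phi>) \<alpha> p q * y p * y q = (\<Sum>j\<in>set_mset \<alpha>. b j * (y p * y q * Dsum k \<phi> (add_mset p
        (add_mset q (\<alpha> - {#j#})))))
      + c p * y p * (y q * D q) + y p * D p * (c q * y q) - (if p = q then 2 * (y p)\<^sup>2 * D p else 0)"
      unfolding hess_def gen_add2[OF ak pq] b_def[symmetric] c_def[symmetric] D_def[symmetric]
      by (simp add: algebra_simps sum_distrib_left sum_distrib_right power2_eq_square)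
  qed
  also have "\<dots> = (\<Sum>p\<in>act \<alpha>. \<Sum>q\<in>act \<alpha>. \<Sum>j\<in>set_mset \<alpha>. b j * (y p * y q * Dsum k \<phi> (add_mset p (add_mset q (\<alpha>
      - {#j#})))))
      + (\<Sum>p\<in>act \<alpha>. c p * y p) * (\<Sum>q\<in>act \<alpha>. y q * D q) + (\<Sum>p\<in>act \<alpha>. y p * D p) * (\<Sum>q\<in>act \<alpha>. c q * y q)
      - (\<Sum>p\<in>act \<alpha>. 2 * (y p)\<^sup>2 * D p)"
    by (simp only: sum.distrib sum_subtractf sum_product) (simp add: if_distrib cong: if_cong)
  also have "\<dots> = (\<Sum>p\<in>act \<alpha>. \<Sum>q\<in>act \<alpha>. \<Sum>j\<in>set_mset \<alpha>. b j * (y p * y q * Dsum k \<phi> (add_mset p (add_mset q (\<alpha>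
      - {#j#})))))
      - (\<Sum>p\<in>act \<alpha>. 2 * (y p)\<^sup>2 * D p)"
    using kernD by (simp add: D_def)
  also have "(\<Sum>p\<in>act \<alpha>. \<Sum>q\<in>act \<alpha>. \<Sum>j\<in>set_mset \<alpha>. b j * (y p * y q * Dsum k \<phi> (add_mset p (add_mset q (\<alpha>
      - {#j#})))))
      = (\<Sum>j\<in>set_mset \<alpha>. b j * (\<Sum>i\<in>set_mset k. bil (act \<alpha>) (hess \<phi> (add_mset i (\<alpha> - {#j#}))) y y))"
  proof -
    have "(\<Sum>i\<in>set_mset k. bil (act \<alpha>) (hess \<phi> (add_mset i (\<alpha> - {#j#}))) y y)
        = (\<Sum>p\<in>act \<alpha>. \<Sum>q\<in>act \<alpha>. y p * y q * Dsum k \<phi> (add_mset p (add_mset q (\<alpha> - {#j#}))))" for j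
    proof -
      have "(\<Sum>i\<in>set_mset k. bil (act \<alpha>) (hess \<phi> (add_mset i (\<alpha> - {#j#}))) y y)
          = (\<Sum>p\<in>act \<alpha>. \<Sum>q\<in>act \<alpha>. \<Sum>i\<in>set_mset k. hess \<phi> (add_mset i (\<alpha> - {#j#})) p q * y p * y q)"
        unfolding bil_def by (subst sum.swap, rule sum.cong[OF refl], rule sum.swap)
      also have "\<dots> = (\<Sum>p\<in>act \<alpha>. \<Sum>q\<in>act \<alpha>. y p * y q * Dsum k \<phi> (add_mset p (add_mset q (\<alpha> - {#j#}))))"
      proof (intro sum.cong refl)
        fix p q
        show "(\<Sum>i\<in>set_mset k. hess \<phi> (add_mset i (\<alpha> - {#j#})) p q * y p * y q)
            = y p * y q * Dsum k \<phi> (add_mset p (add_mset q (\<alpha> - {#j#})))"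
          unfolding Dsum_def hess_def sum_distrib_left
        proof (intro sum.cong refl)
          fix i
          have "add_mset p (add_mset q (add_mset i (\<alpha> - {#j#})))
              = add_mset i (add_mset p (add_mset q (\<alpha> - {#j#})))"
            by (simp add: add_mset_commute)
          then show "\<phi> (add_mset p (add_mset q (add_mset i (\<alpha> - {#j#})))) * y p * y q
              = y p * y q * \<phi> (add_mset i (add_mset p (add_mset q (\<alpha> - {#j#}))))"
            by (simp only: mult.commute mult.left_commute)
        qed
      qed
      finally show ?thesis .
    qed
    then have "(\<Sum>j\<in>set_mset \<alpha>. b j * (\<Sum>i\<in>set_mset k. bil (act \<alpha>) (hess \<phi> (add_mset i (\<alpha> - {#j#}))) y y))
       = (\<Sum>j\<in>set_mset \<alpha>. \<Sum>p\<in>act \<alpha>. \<Sum>q\<in>act \<alpha>. b j * (y p * y q * Dsum k \<phi> (add_mset p (add_mset q (\<alpha>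
           - {#j#})))))"
      by (simp only: sum_distrib_left)
    also have "\<dots> = (\<Sum>p\<in>act \<alpha>. \<Sum>j\<in>set_mset \<alpha>. \<Sum>q\<in>act \<alpha>. b j * (y p * y q * Dsum k \<phi> (add_mset p (add_mset q
        (\<alpha> - {#j#})))))"
      by (rule sum.swap)
    also have "\<dots> = (\<Sum>p\<in>act \<alpha>. \<Sum>q\<in>act \<alpha>. \<Sum>j\<in>set_mset \<alpha>. b j * (y p * y q * Dsum k \<phi> (add_mset p (add_mset q
        (\<alpha> - {#j#})))))"
      by (rule sum.cong[OF refl], rule sum.swap)
    finally show ?thesis by simp
  qed
  finally have eq: "bil (act \<alpha>) (hess (gen k \<phi>) \<alpha>) y y =
      (\<Sum>j\<in>set_mset \<alpha>. b j * (\<Sum>i\<in>set_mset k. bil (act \<alpha>) (hess \<phi> (add_mset i (\<alpha> - {#j#}))) y y))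
      - (\<Sum>p\<in>act \<alpha>. 2 * (y p)\<^sup>2 * D p)" .
  have 1: "(\<Sum>j\<in>set_mset \<alpha>. b j * (\<Sum>i\<in>set_mset k. bil (act \<alpha>) (hess \<phi> (add_mset i (\<alpha> - {#j#}))) y y)) \<le> 0"
  proof (rule sum_nonpos)
    fix j assume j: "j \<in># \<alpha>"
    have "b j \<ge> 0" using mset_subset_eq_count[OF ak, of j] by (simp add: b_def)
    moreover have "(\<Sum>i\<in>set_mset k. bil (act \<alpha>) (hess \<phi> (add_mset i (\<alpha> - {#j#}))) y y) \<le> 0"
      by (intro sum_nonpos kernel_neighbour_nonpos[OF w a ker supp j])
    ultimately show "b j * (\<Sum>i\<in>set_mset k. bil (act \<alpha>) (hess \<phi> (add_mset i (\<alpha> - {#j#}))) y y) \<le> 0"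
      by (rule mult_nonneg_nonpos)
  qed
  have Dpos: "D p > 0" if p: "p \<in> act \<alpha>" for p
  proof -
    obtain q where q: "q \<in># k" "add_mset q (add_mset p \<alpha>) \<in> I"
      using idx_extend[OF add_act[OF ak p]] a by (auto simp: idx_def)
    have "0 < \<phi> (add_mset q (add_mset p \<alpha>))" by (rule pos[OF q(2)])
    also have "\<dots> \<le> D p" unfolding D_def Dsum_def by (rule member_le_sum) (use q nn in auto)
    finally show ?thesis .
  qed
  obtain p where p: "p \<in> act \<alpha>" "y p \<noteq> 0" using nz by blast
  have "(\<Sum>p\<in>act \<alpha>. 2 * (y p)\<^sup>2 * D p) > 0"
    by (rule sum_pos2[of _ p]) (use p Dpos in \<open>auto simp: less_imp_le\<close>)
  then show ?thesis using eq 1 by simp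
qed

end

section \<open>First-order behaviour of the gap along the flow\<close>

definition gap_deriv :: "'a set \<Rightarrow> ('a \<Rightarrow> 'a \<Rightarrow> real) \<Rightarrow> ('a \<Rightarrow> 'a \<Rightarrow> real) \<Rightarrow> ('a \<Rightarrow> real) \<Rightarrow> real" where
  "gap_deriv J B B' x = 2 * bil J B x ones * bil J B' x ones - bil J B' x x * bil J B ones ones
      - bil J B x x * bil J B' ones ones"

lemma bil_has_derivative:
  assumes "\<And>p q. ((\<lambda>t. B t p q) has_real_derivative B' p q) (at t)"
  shows "((\<lambda>t. bil J (B t) x y) has_real_derivative bil J B' x y) (at t)"
  unfolding bil_def by (auto intro!: derivative_eq_intros assms sum.cong)

lemma gap_has_derivative:
  assumes "\<And>p q. ((\<lambda>t. B t p q) has_real_derivative B' p q) (at t)"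
  shows "((\<lambda>t. gap J (B t) x) has_real_derivative gap_deriv J (B t) B' x) (at t)"
  unfolding gap_def gap_deriv_def
  by (auto intro!: derivative_eq_intros bil_has_derivative assms simp: algebra_simps)

context flow_box
begin

definition dflow :: "real \<Rightarrow> (nat multiset \<Rightarrow> real) \<Rightarrow> nat multiset \<Rightarrow> real" where
  "dflow t \<phi> A = gen k (flow t \<phi>) A - rate * flow t \<phi> A"

lemma flow_deriv: "((\<lambda>t. flow t \<phi> A) has_real_derivative dflow t \<phi> A) (at t)"
proof (cases "A \<in> I")
  case True
  then show ?thesis using flow_has_derivative by (simp add: dflow_def)
next
  case False
  then have "flow t \<phi> A = 0" "gen k (flow t \<phi>) A = 0" for t
    using supported_flow supported_gen[OF supported_flow] by (auto simp: supported_def)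
  then show ?thesis by (simp add: dflow_def)
qed

lemma hess_flow_deriv: "((\<lambda>t. hess (flow t \<phi>) \<alpha> p q) has_real_derivative hess (dflow t \<phi>) \<alpha> p q) (at t)"
  unfolding hess_def by (rule flow_deriv)

lemma continuous_on_dflow [continuous_intros]:
  assumes "continuous_on S f"
  shows "continuous_on S (\<lambda>x. dflow (f x) \<phi> A)"
  unfolding dflow_def gen_def Dsum_def
  by (intro continuous_on_diff continuous_on_sum continuous_on_mult continuous_on_const continuous_on_flow
      assms)

lemma continuous_on_hess [continuous_intros]:
  "(\<And>A. continuous_on S (\<lambda>x. g x A)) \<Longrightarrow> continuous_on S (\<lambda>x. hess (g x) \<alpha> p q)"
  unfolding hess_def .

lemma continuous_on_snd_coord: "continuous_on S (\<lambda>z. (snd z :: 'b \<Rightarrow> real) p)"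
  by (rule continuous_on_product_then_coordinatewise[OF continuous_on_snd[OF continuous_on_id]])

text \<open>At a zero of the gap, x may be replaced by a kernel vector y for all times at once. The
  terms in which the undifferentiated form meets y vanish, and so does the contribution of
  \<open>rate\<close>; what remains is minus the negative number of
  \<open>gen_kernel_negative\<close> times a positive one.\<close>

lemma gap_deriv_pos:
  assumes w: "weak \<phi>" and a: "\<alpha> \<in> idx" and x: "x \<in> sphere0 (act \<alpha>)" and g: "gap (act \<alpha>) (hess \<phi> \<alpha>) x = 0"
  shows "gap_deriv (act \<alpha>) (hess (flow 0 \<phi>) \<alpha>) (hess (dflow 0 \<phi>) \<alpha>) x > 0"
proof -
  have s: "supported \<phi>" and pos: "\<And>A. A \<in> I \<Longrightarrow> \<phi> A > 0" and L: "Lor (act \<alpha>) (hess \<phi> \<alpha>)"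
    using w a by (auto simp: weak_def)
  have f0: "flow 0 \<phi> = \<phi>" by (rule flow_0[OF s])
  have bp: "bil (act \<alpha>) (hess \<phi> \<alpha>) ones ones > 0" by (rule bil_ones_pos[OF s pos a])
  obtain y where y: "\<And>p. p \<in> act \<alpha> \<Longrightarrow> app (act \<alpha>) (hess \<phi> \<alpha>) y p = 0" "\<exists>p\<in>act \<alpha>. y p \<noteq> 0"
    "\<And>p. p \<notin> act \<alpha> \<Longrightarrow> y p = 0" "\<And>B'. sym_form (act \<alpha>) B' \<Longrightarrow> gap (act \<alpha>) B' x = gap (act \<alpha>) B' y"
    using gap_0_kernel[OF sym_hess L bp x g] finite_set_mset by metis
  have "((\<lambda>t. gap (act \<alpha>) (hess (flow t \<phi>) \<alpha>) z) has_real_derivative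
      gap_deriv (act \<alpha>) (hess (flow 0 \<phi>) \<alpha>) (hess (dflow 0 \<phi>) \<alpha>) z) (at 0)" for z
    by (rule gap_has_derivative[OF hess_flow_deriv])
  moreover have "gap (act \<alpha>) (hess (flow t \<phi>) \<alpha>) x = gap (act \<alpha>) (hess (flow t \<phi>) \<alpha>) y" for t
    by (rule y(4)[OF sym_hess])
  ultimately have "((\<lambda>t. gap (act \<alpha>) (hess (flow t \<phi>) \<alpha>) x) has_real_derivative
      gap_deriv (act \<alpha>) (hess (flow 0 \<phi>) \<alpha>) (hess (dflow 0 \<phi>) \<alpha>) y) (at 0)" by simp
  then have "gap_deriv (act \<alpha>) (hess (flow 0 \<phi>) \<alpha>) (hess (dflow 0 \<phi>) \<alpha>) x
      = gap_deriv (act \<alpha>) (hess (flow 0 \<phi>) \<alpha>) (hess (dflow 0 \<phi>) \<alpha>) y"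
    by (rule DERIV_unique[OF gap_has_derivative[OF hess_flow_deriv]])
  also have "\<dots> = - bil (act \<alpha>) (hess (dflow 0 \<phi>) \<alpha>) y y * bil (act \<alpha>) (hess \<phi> \<alpha>) ones ones"
  proof -
    have "bil (act \<alpha>) (hess \<phi> \<alpha>) z y = 0" for z by (rule app_eq_0_imp_bil_eq_0) (rule y(1))
    then have "bil (act \<alpha>) (hess \<phi> \<alpha>) y y = 0" "bil (act \<alpha>) (hess \<phi> \<alpha>) y ones = 0"
      using bil_commute[OF sym_hess] by metis+
    then show ?thesis by (simp add: gap_deriv_def f0)
  qed
  also have "bil (act \<alpha>) (hess (dflow 0 \<phi>) \<alpha>) y y
      = bil (act \<alpha>) (hess (gen k \<phi>) \<alpha>) y y - rate * bil (act \<alpha>) (hess \<phi> \<alpha>) y y"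
    by (simp add: bil_def hess_def dflow_def f0 algebra_simps sum_subtractf sum_distrib_left)
  also have "bil (act \<alpha>) (hess \<phi> \<alpha>) y y = 0" by (rule app_eq_0_imp_bil_eq_0) (rule y(1))
  finally show ?thesis using gen_kernel_negative[OF w a y(1) y(3) y(2)] bp by (simp add: mult_neg_pos)
qed

text \<open>Near a point with positive gap continuity suffices. Near a zero the time derivative is
  positive throughout a neighbourhood in time and space, so by the mean value theorem the gap rises
  above its nonnegative initial value. Compactness makes the time uniform.\<close>

lemma eventually_gap_pos:
  assumes w: "weak \<phi>" and a: "\<alpha> \<in> idx"
  shows "eventually (\<lambda>t. \<forall>x\<in>sphere0 (act \<alpha>). gap (act \<alpha>) (hess (flow t \<phi>) \<alpha>) x > 0) (at_right 0)"
proof (rule compact_eventually[OF compact_sphere0])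
  have s: "supported \<phi>" and pos: "\<And>A. A \<in> I \<Longrightarrow> \<phi> A > 0" and L: "Lor (act \<alpha>) (hess \<phi> \<alpha>)"
    using w a by (auto simp: weak_def)
  have f0: "flow 0 \<phi> = \<phi>" by (rule flow_0[OF s])
  have bp: "bil (act \<alpha>) (hess \<phi> \<alpha>) ones ones > 0" by (rule bil_ones_pos[OF s pos a])
  define R where "R = (\<lambda>z. gap (act \<alpha>) (hess (flow (fst z) \<phi>) \<alpha>) (snd z))"
  define R' where "R' = (\<lambda>z. gap_deriv (act \<alpha>) (hess (flow (fst z) \<phi>) \<alpha>) (hess (dflow (fst z) \<phi>) \<alpha>) (snd
      z))"
  have nhds_pos: "eventually (\<lambda>z. h z > 0) (nhds (0, x))" if "continuous_on UNIV h" "h (0, x) > 0"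
    for h :: "real \<times> (nat \<Rightarrow> real) \<Rightarrow> real" and x
  proof -
    have "open {z. 0 < h z}" using that(1) by (intro open_Collect_less continuous_intros)
    then show ?thesis using that(2) unfolding eventually_nhds by blast
  qed
  have cR: "continuous_on UNIV R" "continuous_on UNIV R'"
    unfolding R_def R'_def gap_def gap_deriv_def
    by (intro continuous_on_diff continuous_on_mult continuous_on_power continuous_on_const
        continuous_on_bil
      continuous_on_hess continuous_on_flow continuous_on_dflow continuous_on_fst continuous_on_id
          continuous_on_snd_coord)+
  fix x assume x: "x \<in> sphere0 (act \<alpha>)"
  have "R (0, x) \<ge> 0" using gap_nonneg[OF L bp] by (simp add: R_def f0)
  then consider "R (0, x) > 0" | "R (0, x) = 0" by linarith
  then show "eventually (\<lambda>(t, w). w \<in> sphere0 (act \<alpha>) \<longrightarrow> 0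
      < gap (act \<alpha>) (hess (flow t \<phi>) \<alpha>) w) (at_right 0 \<times>\<^sub>F nhds x)"
  proof cases
    case 1
    have "eventually (\<lambda>z. R z > 0) (nhds 0 \<times>\<^sub>F nhds x)"
      using nhds_pos[OF cR(1) 1] by (simp add: nhds_prod)
    then have "eventually (\<lambda>z. R z > 0) (at_right 0 \<times>\<^sub>F nhds x)"
      by (rule filter_leD[rotated]) (intro prod_filter_mono at_within_le_nhds order_refl)
    then show ?thesis by eventually_elim (auto simp: R_def)
  next
    case 2
    then have "R' (0, x) > 0" using gap_deriv_pos[OF w a x] by (simp add: R'_def R_def f0)
    then have "eventually (\<lambda>z. R' z > 0) (nhds 0 \<times>\<^sub>F nhds x)"
      using nhds_pos[OF cR(2)] by (simp add: nhds_prod)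
    then obtain P Q where PQ: "eventually P (nhds (0::real))" "eventually Q (nhds x)" "\<And>t w. P t \<Longrightarrow> Q w
        \<Longrightarrow> R' (t, w) > 0"
      by (auto simp: eventually_prod_filter)
    obtain e where e: "e > 0" "\<And>t. \<bar>t\<bar> < e \<Longrightarrow> P t"
      using PQ(1) by (auto simp: eventually_nhds_metric dist_real_def)
    have ev: "eventually (\<lambda>t. 0 < t \<and> t < e) (at_right 0)"
      using e(1) eventually_at_right_less[of 0] eventually_at_right[of 0 e]
      by (auto simp: eventually_at_right_field intro!: exI[of _ e])
    have "0 < R (t, w)" if t: "0 < t" "t < e" and w: "Q w" "w \<in> sphere0 (act \<alpha>)" for t w
    proof -
      have "((\<lambda>t. R (t, w)) has_real_derivative R' (r, w)) (at r)" for r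
        unfolding R_def R'_def using gap_has_derivative[OF hess_flow_deriv] by simp
      then obtain r where r: "0 < r" "r < t" "R (t, w) - R (0, w) = (t - 0) * R' (r, w)"
        using MVT2[of 0 t "\<lambda>t. R (t, w)" "\<lambda>r. R' (r, w)"] t by auto
      have "R' (r, w) > 0" using PQ(3) e(2)[of r] r t w by simp
      moreover have "R (0, w) \<ge> 0" using gap_nonneg[OF L bp] by (simp add: R_def f0)
      ultimately show ?thesis using r t by (simp add: add_nonneg_pos algebra_simps)
    qed
    then show ?thesis
      unfolding eventually_prod_filter
      by (intro exI[of _ "\<lambda>t. 0 < t \<and> t < e"] exI[of _ Q]) (use ev PQ(2) in \<open>auto simp: R_def\<close>)
  qed
qed simp

lemma finite_idx [simp]: "finite idx"
  by (rule finite_subset[OF _ finite_subsets_mset[of k]]) (auto simp: idx_def)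

lemma weak_iff_gap:
  assumes "supported \<phi>" "\<And>A. A \<in> I \<Longrightarrow> \<phi> A > 0"
  shows "weak \<phi> \<longleftrightarrow> (\<forall>\<alpha>\<in>idx. \<forall>x. gap (act \<alpha>) (hess \<phi> \<alpha>) x \<ge> 0)"
  using Lor_iff_gap_nonneg[OF sym_hess bil_ones_pos] assms by (auto simp: weak_def)

lemma strict_iff_gap:
  assumes "supported \<phi>" "\<And>A. A \<in> I \<Longrightarrow> \<phi> A > 0"
  shows "strict \<phi> \<longleftrightarrow> (\<forall>\<alpha>\<in>idx. \<forall>x\<in>sphere0 (act \<alpha>). gap (act \<alpha>) (hess \<phi> \<alpha>) x > 0)"
proof
  assume "strict \<phi>"
  then show "\<forall>\<alpha>\<in>idx. \<forall>x\<in>sphere0 (act \<alpha>). gap (act \<alpha>) (hess \<phi> \<alpha>) x > 0"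
    using strict_imp_gap_pos[OF sym_hess _ _ bil_ones_pos[OF assms]] by (auto simp: strict_def weak_def)
next
  assume "\<forall>\<alpha>\<in>idx. \<forall>x\<in>sphere0 (act \<alpha>). gap (act \<alpha>) (hess \<phi> \<alpha>) x > 0"
  then show "strict \<phi>"
    using gap_pos_imp_strict[OF sym_hess _ bil_ones_pos[OF assms]] assms by (auto simp: strict_def weak_def)
qed

text \<open>Continuation in time: the good times form a closed set, and by
  \<open>eventually_gap_pos\<close> each good time is followed by an interval of good times, so the
  bad times cannot have an infimum.\<close>

lemma weak_flow:
  assumes w: "weak \<phi>" and t: "t \<ge> 0"
  shows "weak (flow t \<phi>)"
proof (rule ccontr)
  assume bad: "\<not> weak (flow t \<phi>)"
  have s: "supported \<phi>" and pos: "\<And>A. A \<in> I \<Longrightarrow> \<phi> A > 0" using w by (auto simp: weak_def)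
  have wi: "weak (flow r \<phi>) \<longleftrightarrow> (\<forall>\<alpha>\<in>idx. \<forall>x. gap (act \<alpha>) (hess (flow r \<phi>) \<alpha>) x \<ge> 0)" if "r \<ge> 0" for r
    by (rule weak_iff_gap[OF supported_flow flow_pos[OF s pos that]])
  define T where "T = {r. 0 \<le> r} \<inter> (\<Inter>\<alpha>\<in>idx. \<Inter>x. {r. 0 \<le> gap (act \<alpha>) (hess (flow r \<phi>) \<alpha>) x})"
  have T: "r \<in> T \<longleftrightarrow> 0 \<le> r \<and> weak (flow r \<phi>)" for r using wi by (auto simp: T_def)
  have "closed T"
    unfolding T_def gap_def by (intro closed_Int closed_INT ballI closed_Collect_le continuous_intros)
  define U where "U = {r. 0 \<le> r \<and> r \<notin> T}"
  have tU: "t \<in> U" using bad t T by (simp add: U_def)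
  have bdd: "bdd_below U" by (auto simp: U_def bdd_below_def)
  define \<tau> where "\<tau> = Inf U"
  have t0: "\<tau> \<ge> 0" unfolding \<tau>_def by (rule cInf_greatest) (use tU in \<open>auto simp: U_def\<close>)
  have below: "r \<in> T" if "0 \<le> r" "r < \<tau>" for r
    using that cInf_lower[OF _ bdd, of r] by (auto simp: U_def \<tau>_def)
  have \<tau>T: "\<tau> \<in> T"
  proof (cases "\<tau> = 0")
    case True
    then show ?thesis using w T by (simp add: flow_0[OF s])
  next
    case False
    then have "eventually (\<lambda>r. r \<in> T) (at_left \<tau>)"
      using t0 below eventually_at_left[of 0 \<tau>] by (auto intro!: exI[of _ 0])
    then show ?thesis
      using Lim_in_closed_set[OF \<open>closed T\<close> _ trivial_limit_at_left_real tendsto_ident_at] by blast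
  qed
  define \<psi> where "\<psi> = flow \<tau> \<phi>"
  have w\<psi>: "weak \<psi>" using \<tau>T T by (simp add: \<psi>_def)
  have "eventually (\<lambda>r. \<forall>\<alpha>\<in>idx. \<forall>x\<in>sphere0 (act \<alpha>). gap (act \<alpha>) (hess (flow r \<psi>) \<alpha>) x > 0) (at_right 0)"
    using eventually_gap_pos[OF w\<psi>] by (simp add: eventually_ball_finite_distrib)
  then obtain e where e: "e > 0" "\<And>r. 0 < r \<Longrightarrow> r < e
      \<Longrightarrow> \<forall>\<alpha>\<in>idx. \<forall>x\<in>sphere0 (act \<alpha>). gap (act \<alpha>) (hess (flow r \<psi>) \<alpha>) x > 0"
    by (auto simp: eventually_at_right_field)
  have "\<tau> + e \<le> \<tau>"
    unfolding \<tau>_def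
  proof (rule cInf_greatest)
    show "U \<noteq> {}" using tU by blast
    fix r assume r: "r \<in> U"
    have r1: "r \<ge> \<tau>" unfolding \<tau>_def by (rule cInf_lower[OF r bdd])
    have "r \<noteq> \<tau>" using r \<tau>T by (auto simp: U_def)
    show "Inf U + e \<le> r"
    proof (rule ccontr)
      assume "\<not> ?thesis"
      then have r2: "r - \<tau> < e" by (simp add: \<tau>_def)
      have "flow (r - \<tau>) \<psi> = flow r \<phi>" by (simp add: \<psi>_def flow_flow)
      then have "\<forall>\<alpha>\<in>idx. \<forall>x\<in>sphere0 (act \<alpha>). gap (act \<alpha>) (hess (flow r \<phi>) \<alpha>) x > 0"
        using e(2)[OF _ r2] r1 \<open>r \<noteq> \<tau>\<close> by simp
      then have "strict (flow r \<phi>)"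
        using strict_iff_gap[OF supported_flow flow_pos[OF s pos]] r1 t0 by simp
      then show False using r T r1 t0 by (simp add: U_def strict_def)
    qed
  qed
  then show False using e by simp
qed

text \<open>The gap is nonnegative at all nonnegative times, so a zero at the positive time t is a
  two-sided local minimum with derivative 0, which \<open>gap_deriv_pos\<close> excludes.\<close>

lemma strict_flow:
  assumes w: "weak \<phi>" and t: "t > 0"
  shows "strict (flow t \<phi>)"
proof -
  have s: "supported \<phi>" and pos: "\<And>A. A \<in> I \<Longrightarrow> \<phi> A > 0" using w by (auto simp: weak_def)
  have p: "flow t \<phi> A > 0" if "A \<in> I" for A using flow_pos[OF s pos] t that by simp
  define \<psi> where "\<psi> = flow t \<phi>"
  have w\<psi>: "weak \<psi>" using weak_flow[OF w] t by (simp add: \<psi>_def)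
  have "gap (act \<alpha>) (hess (flow t \<phi>) \<alpha>) x > 0" if a: "\<alpha> \<in> idx" and x: "x \<in> sphere0 (act \<alpha>)" for \<alpha> x
  proof (rule ccontr)
    assume n: "\<not> ?thesis"
    have L: "gap (act \<alpha>) (hess (flow r \<phi>) \<alpha>) x \<ge> 0" if "r \<ge> 0" for r
      using weak_flow[OF w that] weak_iff_gap[OF supported_flow flow_pos[OF s pos that]] a by blast
    have g0: "gap (act \<alpha>) (hess \<psi> \<alpha>) x = 0" using n L[of t] t by (simp add: \<psi>_def)
    have sf: "flow r \<psi> = flow (r + t) \<phi>" for r by (simp add: \<psi>_def flow_flow)
    have "gap_deriv (act \<alpha>) (hess (flow 0 \<psi>) \<alpha>) (hess (dflow 0 \<psi>) \<alpha>) x = 0"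
    proof (rule DERIV_local_min[where x=0 and d=t and f="\<lambda>r. gap (act \<alpha>) (hess (flow r \<psi>) \<alpha>) x"])
      show "((\<lambda>r. gap (act \<alpha>) (hess (flow r \<psi>) \<alpha>) x) has_real_derivative
        gap_deriv (act \<alpha>) (hess (flow 0 \<psi>) \<alpha>) (hess (dflow 0 \<psi>) \<alpha>) x) (at 0)"
        by (rule gap_has_derivative[OF hess_flow_deriv])
      show "\<forall>y. \<bar>0 - y\<bar> < t \<longrightarrow> gap (act \<alpha>) (hess (flow 0 \<psi>) \<alpha>) x \<le> gap (act \<alpha>) (hess (flow y \<psi>) \<alpha>) x"
      proof (intro allI impI)
        fix y :: real
        assume "\<bar>0 - y\<bar> < t"
        then have "gap (act \<alpha>) (hess (flow y \<psi>) \<alpha>) x \<ge> 0" unfolding sf by (intro L) simp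
        moreover have "flow 0 \<psi> = \<psi>" using flow_0 w\<psi> by (simp add: weak_def)
        ultimately show "gap (act \<alpha>) (hess (flow 0 \<psi>) \<alpha>) x \<le> gap (act \<alpha>) (hess (flow y \<psi>) \<alpha>) x"
          using g0 by simp
      qed
    qed (rule t)
    then show False using gap_deriv_pos[OF w\<psi> a x g0] by simp
  qed
  then show ?thesis using strict_iff_gap[OF supported_flow p] by blast
qed

text \<open>Up to the factor \<open>m\<close> the Hessian at \<alpha> is the rank one matrix u u^T
  minus the diagonal matrix of u, where u counts the places left in each variable.\<close>

lemma weak_wt: "weak (wt k d)"
  unfolding weak_def
proof (intro conjI ballI supported_wt)
  fix \<alpha> assume a: "\<alpha> \<in> idx"
  define u where "u p = real (count k p - count \<alpha> p)" for p
  define m where "m = 1 / mfact (k - \<alpha>)"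
  have m: "m > 0" by (simp add: m_def)
  have ak: "\<alpha> \<subseteq># k" using a by (simp add: idx_def)
  have up: "u p > 0" if "p \<in> act \<alpha>" for p using that by (simp add: u_def in_diff_count)
  have h: "hess (wt k d) \<alpha> p q = m * (u p * u q - (if p
      = q then u p else 0))" if pq: "p \<in> act \<alpha>" "q \<in> act \<alpha>" for p q
  proof -
    have qk: "add_mset q \<alpha> \<subseteq># k" by (rule add_act[OF ak pq(2)])
    have "hess (wt k d) \<alpha> p q = real (count k p - count (add_mset q \<alpha>) p) * (1 / mfact (k - add_mset q \<alpha>))"
      unfolding hess_def using wt_add_mset[OF qk, of d p] a by (simp add: idx_def)
    moreover have "1 / mfact (k - add_mset q \<alpha>) = u q * m"
      using up[OF pq(2)] mfact_diff[OF qk] by (simp add: m_def u_def)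
    moreover have "real (count k p - count (add_mset q \<alpha>) p) = u p - (if p = q then 1 else 0)"
      using up[OF pq(1)] by (auto simp: u_def)
    ultimately have "hess (wt k d) \<alpha> p q = (u p - (if p = q then 1 else 0)) * (u q * m)" by simp
    then show ?thesis by (auto simp: algebra_simps)
  qed
  have form: "bil (act \<alpha>) (hess (wt k d) \<alpha>) x y
      = m * (dot (act \<alpha>) u x * dot (act \<alpha>) u y - (\<Sum>p\<in>act \<alpha>. u p * x p * y p))" for x y
  proof -
    have "bil (act \<alpha>) (hess (wt k d) \<alpha>) x y = (\<Sum>p\<in>act \<alpha>. \<Sum>q\<in>act \<alpha>. m * ((u p * x p) * (u q * y q)) - (if p
        = q then m * (u p * x p * y p) else 0))"
      unfolding bil_def by (intro sum.cong refl) (auto simp: h algebra_simps)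
    also have "\<dots> = m * (dot (act \<alpha>) u x * dot (act \<alpha>) u y) - m * (\<Sum>p\<in>act \<alpha>. u p * x p * y p)"
    proof -
      have "(\<Sum>p\<in>act \<alpha>. \<Sum>q\<in>act \<alpha>. m * ((u p * x p) * (u q * y q))) = m * (dot (act \<alpha>) u x * dot (act \<alpha>) u y)"
        by (simp only: dot_def sum_product) (simp only: sum_distrib_left)
      moreover have "(\<Sum>p\<in>act \<alpha>. \<Sum>q\<in>act \<alpha>. if p = q then m * (u p * x p * y p) else 0)
          = m * (\<Sum>p\<in>act \<alpha>. u p * x p * y p)"
        by (simp add: sum_distrib_left)
      ultimately show ?thesis by (simp only: sum_subtractf)
    qed
    finally show ?thesis by (simp add: algebra_simps)
  qed
  \<comment> \<open>The rank one part is a form on a one-point index set, pulled back along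
    \<open>dot (act \<alpha>) u\<close>.\<close>
  define B :: "unit \<Rightarrow> unit \<Rightarrow> real" where "B = (\<lambda>_ _. m)"
  have bB: "bil UNIV B x y = m * x () * y ()" for x y by (simp add: bil_def B_def UNIV_unit)
  show "Lor (act \<alpha>) (hess (wt k d) \<alpha>)"
  proof (rule Lor_pullback[where J = UNIV and B = B and f = "\<lambda>x _. dot (act \<alpha>) u x"])
    show "sym_form UNIV B" by (simp add: sym_form_def B_def)
    show "Lor UNIV B" by (simp add: Lor_def bB power2_eq_square algebra_simps)
    show "sym_form (act \<alpha>) (hess (wt k d) \<alpha>)" by (rule sym_hess)
    show "(\<lambda>_. dot (act \<alpha>) u (\<lambda>p. x p - c * y p))
        = (\<lambda>p. dot (act \<alpha>) u x - c * dot (act \<alpha>) u y)" for x y :: "nat \<Rightarrow> real" and c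
      by (simp add: dot_def algebra_simps sum_subtractf sum_distrib_left)
    fix x :: "nat \<Rightarrow> real"
    have "m * (\<Sum>p\<in>act \<alpha>. u p * x p * x p) \<ge> 0"
    proof (intro mult_nonneg_nonneg[OF less_imp_le[OF m]] sum_nonneg)
      fix p assume "p \<in> act \<alpha>"
      then show "u p * x p * x p \<ge> 0"
        using mult_nonneg_nonneg[OF less_imp_le[OF up] zero_le_square, of p "x p"] by (simp add: mult.assoc)
    qed
    then show "bil (act \<alpha>) (hess (wt k d) \<alpha>) x x \<le> bil UNIV B (\<lambda>_. dot (act \<alpha>) u x) (\<lambda>_. dot (act \<alpha>) u x)"
      unfolding form bB right_diff_distrib mult.assoc by simp
  qed
qed (rule wt_pos)

text \<open>A stationary point is its own image under the flow, and the image is strict.\<close>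

lemma strict_wt: "strict (wt k d)"
  using strict_flow[OF weak_wt, of 1] by (simp add: flow_wt)

end

section \<open>Mixed directional derivatives\<close>

definition Dv :: "nat set \<Rightarrow> (nat \<Rightarrow> real) \<Rightarrow> (nat multiset \<Rightarrow> real) \<Rightarrow> nat multiset \<Rightarrow> real" where
  "Dv N a \<phi> A = (\<Sum>i\<in>N. a i * \<phi> (add_mset i A))"

definition shift :: "nat \<Rightarrow> (nat multiset \<Rightarrow> real) \<Rightarrow> nat multiset \<Rightarrow> real" where
  "shift i \<phi> A = \<phi> (add_mset i A)"

lemma Dv_commute: "Dv N a (Dv N b \<phi>) = Dv N b (Dv N a \<phi>)"
proof
  fix A
  have "Dv N a (Dv N b \<phi>) A = (\<Sum>i\<in>N. \<Sum>j\<in>N. a i * b j * \<phi> (add_mset j (add_mset i A)))"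
    by (simp add: Dv_def sum_distrib_left mult.assoc)
  also have "\<dots> = (\<Sum>j\<in>N. \<Sum>i\<in>N. a i * b j * \<phi> (add_mset j (add_mset i A)))" by (rule sum.swap)
  also have "\<dots> = Dv N b (Dv N a \<phi>) A"
    by (simp add: Dv_def sum_distrib_left add_mset_commute mult.assoc mult.left_commute)
  finally show "Dv N a (Dv N b \<phi>) A = Dv N b (Dv N a \<phi>) A" .
qed

lemma foldr_Dv_shift: "foldr (Dv N) as (shift i \<phi>) = shift i (foldr (Dv N) as \<phi>)"
  by (induction as) (auto simp: Dv_def shift_def fun_eq_iff add_mset_commute)

lemma foldr_Dv_outside:
  assumes "\<And>B. \<not> B \<subseteq># k \<Longrightarrow> \<phi> B = 0" "\<not> A \<subseteq># k"
  shows "foldr (Dv N) as \<phi> A = 0"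
  using assms(2)
proof (induction as arbitrary: A)
  case (Cons a as)
  have "\<not> add_mset i A \<subseteq># k" for i
    using Cons.prems by (meson mset_subset_eq_insertD subset_mset.less_imp_le)
  then show ?case using Cons.IH by (simp add: Dv_def)
qed (use assms in simp)

lemma foldr_Dv_nonneg:
  assumes "\<And>B. \<phi> B \<ge> 0" "\<And>a i. a \<in> set as \<Longrightarrow> i \<in> N \<Longrightarrow> a i \<ge> 0"
  shows "foldr (Dv N) as \<phi> A \<ge> 0"
  using assms(2)
proof (induction as arbitrary: A)
  case (Cons a as)
  then show ?case by (auto simp: Dv_def intro!: sum_nonneg mult_nonneg_nonneg)
qed (use assms in simp)

lemma foldr_Dv_pos:
  assumes fin: "finite N" "set_mset k \<subseteq> N" and nn: "\<And>B. \<phi> B \<ge> 0" and pos: "\<And>B. B \<in> mbox k d \<Longrightarrow> \<phi> B > 0"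
    and a: "\<And>a i. a \<in> set as \<Longrightarrow> i \<in> N \<Longrightarrow> a i > 0" and d: "d \<le> size k"
    and A: "A \<subseteq># k" "size A + length as = d"
  shows "foldr (Dv N) as \<phi> A > 0"
  using a A
proof (induction as arbitrary: A)
  case Nil
  then show ?case using pos by (simp add: mbox_def)
next
  case (Cons a as)
  obtain B where B: "B \<in> mbox k (Suc (size A))" "A \<subseteq># B"
    by (rule mbox_extend[of A k "Suc (size A)"]) (use Cons.prems d in auto)
  then have "A \<in> {\<gamma>. \<gamma> \<subseteq># B \<and> Suc (size \<gamma>) = size B}" by (simp add: mbox_def)
  then obtain q where q: "q \<in># B" "A = B - {#q#}" unfolding one_smaller_subsets by blast
  have qB: "add_mset q A = B" using q by simp
  have qN: "q \<in> N" using q B fin by (auto simp: mbox_def dest: mset_subset_eqD)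
  have "foldr (Dv N) as \<phi> (add_mset q A) > 0"
    by (rule Cons.IH) (use Cons.prems B qB in \<open>auto simp: mbox_def\<close>)
  then have p: "a q * foldr (Dv N) as \<phi> (add_mset q A) > 0" using Cons.prems(1)[of a q] qN by simp
  have le: "0 \<le> a i" if "a \<in> set as" "i \<in> N" for a i using Cons.prems(1)[of a i] that
      by (simp add: less_imp_le)
  have nn': "a i * foldr (Dv N) as \<phi> (add_mset i A) \<ge> 0" if "i \<in> N" for i
    using Cons.prems(1)[of a i] that le foldr_Dv_nonneg[where N = N and as = as and \<phi> = \<phi> and A
        = "add_mset i A", OF nn]
    by (intro mult_nonneg_nonneg) (auto simp: less_imp_le)
  have "(\<Sum>i\<in>N. a i * foldr (Dv N) as \<phi> (add_mset i A)) > 0"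
    using sum_pos2[where f = "\<lambda>i. a i * foldr (Dv N) as \<phi> (add_mset i A)", OF fin(1) qN p nn'] by simp
  then show ?case by (simp only: foldr.simps comp_apply Dv_def[of N a])
qed

lemma bil_extend:
  assumes fin: "finite J" and sub: "I \<subseteq> J" and z: "\<And>p q. p \<in> J \<Longrightarrow> q \<in> J \<Longrightarrow> p \<notin> I \<or> q \<notin> I \<Longrightarrow> B p q = 0"
  shows "bil I B x y = bil J B x y"
proof -
  have 1: "(\<Sum>q\<in>I. B p q * x p * y q) = (\<Sum>q\<in>J. B p q * x p * y q)" if "p \<in> J" for p
    by (rule sum.mono_neutral_left) (use fin sub z that in auto)
  have "bil I B x y = (\<Sum>p\<in>I. \<Sum>q\<in>J. B p q * x p * y q)"
    unfolding bil_def by (rule sum.cong[OF refl], rule 1) (use sub in blast)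
  also have "\<dots> = bil J B x y"
    unfolding bil_def by (rule sum.mono_neutral_left) (use fin sub z in auto)
  finally show ?thesis .
qed

text \<open>\<open>strict\<close> with box and degree as parameters: differentiation lowers both,
  and the induction of \<open>directional_strict\<close> runs through the smaller boxes.\<close>

definition strict_box :: "nat multiset \<Rightarrow> nat \<Rightarrow> (nat multiset \<Rightarrow> real) \<Rightarrow> bool" where
  "strict_box k d \<phi> \<longleftrightarrow> (\<forall>A. A \<notin> mbox k d \<longrightarrow> \<phi> A = 0) \<and> (\<forall>A\<in>mbox k d. \<phi> A > 0) \<and>
    (\<forall>\<alpha>. \<alpha> \<subseteq># k \<longrightarrow> size \<alpha> + 2 = d \<longrightarrow> Lor (set_mset (k - \<alpha>)) (hess \<phi> \<alpha>) \<and> nondeg (set_mset (k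
        - \<alpha>)) (hess \<phi> \<alpha>))"

lemma (in flow_box) strict_iff_strict_box: "strict \<phi> \<longleftrightarrow> strict_box k d \<phi>"
  by (auto simp: strict_def weak_def strict_box_def supported_def idx_def)

text \<open>Differentiating by w_i removes one i from the box, and the sets of free variables match
  because k - i - \<alpha> is k - (\<alpha> + i). The alternative d = 0 guards the truncated
  \<open>d - 1\<close>.\<close>

lemma strict_box_shift:
  assumes s: "strict_box k d \<phi>" and i: "i \<in># k"
  shows "strict_box (k - {#i#}) (d - 1) (shift i \<phi>) \<or> d = 0"
proof (cases "d = 0")
  case False
  obtain k' where k': "k = add_mset i k'" using i by (metis insert_DiffM)
  have box: "A \<in> mbox k' (d - 1) \<longleftrightarrow> add_mset i A \<in> mbox k d" for A
    using False by (auto simp: mbox_def k')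
  have "strict_box k' (d - 1) (shift i \<phi>)"
    unfolding strict_box_def
  proof (intro conjI allI impI ballI)
    show "shift i \<phi> A = 0" if "A \<notin> mbox k' (d - 1)" for A
      using s that box by (auto simp: strict_box_def shift_def)
    show "shift i \<phi> A > 0" if "A \<in> mbox k' (d - 1)" for A
      using s that box by (auto simp: strict_box_def shift_def)
    fix \<alpha> assume a: "\<alpha> \<subseteq># k'" "size \<alpha> + 2 = d - 1"
    have "k' - \<alpha> = k - add_mset i \<alpha>" by (simp add: k')
    moreover have "hess (shift i \<phi>) \<alpha> = hess \<phi> (add_mset i \<alpha>)"
      by (auto simp: hess_def shift_def fun_eq_iff add_mset_commute)
    moreover have "add_mset i \<alpha> \<subseteq># k" "size (add_mset i \<alpha>) + 2 = d" using a by (auto simp: k')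
    ultimately show "Lor (set_mset (k' - \<alpha>)) (hess (shift i \<phi>) \<alpha>)" "nondeg (set_mset (k'
        - \<alpha>)) (hess (shift i \<phi>) \<alpha>)"
      using s unfolding strict_box_def by metis+
  qed
  then show ?thesis by (simp add: k')
qed simp

lemma subset_pair:
  assumes "i \<in># k"
  shows "p \<in># k - {#i#} \<longleftrightarrow> {#i, p#} \<subseteq># k"
proof -
  obtain k' where k': "k = add_mset i k'" using assms by (metis insert_DiffM)
  have "{#i, p#} \<subseteq># k \<longleftrightarrow> {#p#} \<subseteq># k'" unfolding k' by (rule mset_subset_eq_add_mset_cancel)
  moreover have "k - {#i#} = k'" unfolding k' by (rule add_mset_remove_trivial)
  ultimately show ?thesis by (simp only: single_subset_iff)
qed

text \<open>The cubic case. With \<open>Q = \<Sum>a\<^sub>i Q\<^sub>i\<close>, Euler's identity \<open>Q\<^sub>i a = Q e\<^sub>i\<close> turns the reverse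
  Cauchy--Schwarz inequalities for the \<open>Q\<^sub>i\<close> against \<open>a\<close> into the hypothesis of \<open>bochner_Lor\<close>.\<close>

lemma cubic_Lor:
  fixes c :: "nat multiset \<Rightarrow> real"
  assumes a: "\<And>i. i \<in> N \<Longrightarrow> a i > 0" and fin: "finite N" and kN: "set_mset k \<subseteq> N"
    and out: "\<And>B. \<not> B \<subseteq># k \<Longrightarrow> c B = 0" and sz: "size k \<ge> 3"
    and L: "\<And>i. i \<in># k \<Longrightarrow> Lor (set_mset (k - {#i#})) (hess c {#i#})"
    and nd: "\<And>i. i \<in># k \<Longrightarrow> nondeg (set_mset (k - {#i#})) (hess c {#i#})"
    and off: "\<And>p q. {#p, q#} \<subseteq># k \<Longrightarrow> Dv N a c {#p, q#} > 0"
    and app: "\<And>p. p \<in># k \<Longrightarrow> Dv N a (Dv N a c) {#p#} > 0"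
  shows "Lor (set_mset k) (hess (Dv N a c) {#}) \<and> nondeg (set_mset k) (hess (Dv N a c) {#})"
proof -
  let ?K = "set_mset k"
  define Q where "Q = hess (Dv N a c) {#}"
  define Qi where "Qi i = hess c {#i#}" for i
  have sum_K: "(\<Sum>i\<in>N. a i * c (add_mset i B)) = (\<Sum>i\<in>?K. a i * c (add_mset i B))" for B
  proof (rule sum.mono_neutral_right)
    show "\<forall>i\<in>N - ?K. a i * c (add_mset i B) = 0"
    proof
      fix i assume "i \<in> N - ?K"
      then have "\<not> add_mset i B \<subseteq># k" by (auto dest: mset_subset_eqD)
      then show "a i * c (add_mset i B) = 0" by (simp add: out)
    qed
  qed (use fin kN in auto)
  have Q: "Q p q = (\<Sum>i\<in>?K. a i * Qi i p q)" for p q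
    by (simp add: Q_def Qi_def hess_def Dv_def sum_K add_mset_commute)
  have perm: "Qi j i q = Qi i q j" for i j q
    by (auto simp: Qi_def hess_def add_mset_commute)
  have symQ: "sym_form J Q" "sym_form J (Qi i)" for J i by (simp_all add: Q_def Qi_def sym_hess)
  have zero: "Qi i p q = 0" if "i \<in># k" "p \<notin># k - {#i#} \<or> q \<notin># k - {#i#}" for i p q
  proof -
    have "\<not> {#p, q, i#} \<subseteq># k"
    proof
      assume sub: "{#p, q, i#} \<subseteq># k"
      have "{#i, p#} \<subseteq># {#p, q, i#}" "{#i, q#} \<subseteq># {#p, q, i#}" by (auto simp: subseteq_mset_def)
      then have "{#i, p#} \<subseteq># k" "{#i, q#} \<subseteq># k" using sub subset_mset.order_trans by blast+
      then show False using that(2) subset_pair[OF that(1)] by simp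
    qed
    then show ?thesis by (simp add: Qi_def hess_def out)
  qed
  have bilQi: "bil (set_mset (k - {#i#})) (Qi i) x y = bil ?K (Qi i) x y" if "i \<in># k" for i x y
    by (rule bil_extend) (use zero[OF that] in \<open>auto dest: in_diffD\<close>)
  have LK: "Lor ?K (Qi i)" if "i \<in># k" for i
    using L[OF that] bilQi[OF that] by (simp add: Lor_def Qi_def)
  have bilQ: "bil ?K Q x y = (\<Sum>i\<in>?K. a i * bil ?K (Qi i) x y)" for x y
  proof -
    have "bil ?K Q x y = (\<Sum>p\<in>?K. \<Sum>q\<in>?K. \<Sum>i\<in>?K. a i * (Qi i p q * x p * y q))"
      unfolding bil_def Q by (simp add: sum_distrib_right mult.assoc)
    also have "\<dots> = (\<Sum>p\<in>?K. \<Sum>i\<in>?K. \<Sum>q\<in>?K. a i * (Qi i p q * x p * y q))"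
      by (rule sum.cong[OF refl], rule sum.swap)
    also have "\<dots> = (\<Sum>i\<in>?K. \<Sum>p\<in>?K. \<Sum>q\<in>?K. a i * (Qi i p q * x p * y q))" by (rule sum.swap)
    finally show ?thesis by (simp add: bil_def sum_distrib_left)
  qed
  have euler: "app ?K Q x i = bil ?K (Qi i) x a" for x i
  proof -
    have "app ?K Q x i = (\<Sum>q\<in>?K. \<Sum>j\<in>?K. Qi i q j * x q * a j)"
      unfolding app_def Q sum_distrib_right by (intro sum.cong refl) (simp add: perm[of _ i])
    then show ?thesis by (simp add: bil_def)
  qed
  have appa: "app ?K Q a p > 0" if "p \<in># k" for p
  proof -
    have "Dv N a (Dv N a c) {#p#} = (\<Sum>j\<in>N. a j * (\<Sum>i\<in>?K. a i * c {#i, j, p#}))"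
      by (simp add: Dv_def sum_K)
    also have "\<dots> = (\<Sum>j\<in>N. a j * Q p j)"
      by (intro sum.cong refl) (simp add: Q Qi_def hess_def add_mset_commute)
    also have "\<dots> = (\<Sum>j\<in>?K. a j * Q p j)"
    proof (rule sum.mono_neutral_right)
      show "\<forall>j\<in>N - ?K. a j * Q p j = 0"
      proof
        fix j assume "j \<in> N - ?K"
        then have "Qi i p j = 0" if "i \<in># k" for i using zero[OF that, of p j] by (auto dest: in_diffD)
        then show "a j * Q p j = 0" by (simp add: Q)
      qed
    qed (use fin kN in auto)
    finally show ?thesis using app[OF that] by (simp add: app_def mult.commute)
  qed
  have LQ: "Lor ?K Q"
  proof (rule bochner_Lor[where a = a])
    show "a p > 0" if "p \<in># k" for p using a kN that by blast
    show "Q p q > 0" if "p \<in># k" "q \<in># k" "p \<noteq> q" for p q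
    proof -
      have "{#p, q#} \<subseteq># k" 
        using that subset_pair[OF that(1), of q] by (simp add: in_diff_count)
      then show ?thesis using off by (simp add: Q_def hess_def)
    qed
    show "app ?K Q a p > 0" if "p \<in># k" for p by (rule appa[OF that])
    show "bil ?K Q x x \<le> (\<Sum>p\<in>?K. a p / app ?K Q a p * (app ?K Q x p)\<^sup>2)" for x
      unfolding bilQ
    proof (rule sum_mono)
      fix i assume i: "i \<in># k"
      have "bil ?K (Qi i) a a > 0" using appa[OF i] by (simp add: euler)
      from LorD[OF LK[OF i] this, of x] have "bil ?K (Qi i) x x * app ?K Q a i \<le> (app ?K Q x i)\<^sup>2"
        by (simp add: euler)
      then have "bil ?K (Qi i) x x \<le> (app ?K Q x i)\<^sup>2 / app ?K Q a i"
        using appa[OF i] by (simp add: pos_le_divide_eq)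
      then have "a i * bil ?K (Qi i) x x \<le> a i * ((app ?K Q x i)\<^sup>2 / app ?K Q a i)"
        using a kN i by (intro mult_left_mono) (auto simp: less_imp_le)
      then show "a i * bil ?K (Qi i) x x \<le> a i / app ?K Q a i * (app ?K Q x i)\<^sup>2" by simp
    qed
  qed (simp_all add: symQ)
  \<comment> \<open>For a kernel vector x of Q, each Q_i has x orthogonal to a, so Q_i(x, x) is
    nonpositive. Their weighted sum is 0, so all of them vanish and x lies in the kernel of every
    Q_i. Nondegeneracy of a single Q_i in which p is free then gives x p = 0.\<close>
  moreover have "nondeg ?K Q"
    unfolding nondeg_def
  proof (intro allI impI ballI)
    fix x p assume x: "\<forall>p\<in>?K. app ?K Q x p = 0" and p: "p \<in># k"
    have "bil ?K Q x x = 0" using x app_eq_0_imp_bil_eq_0 by metis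
    then have s0: "(\<Sum>i\<in>?K. a i * bil ?K (Qi i) x x) = 0" by (simp add: bilQ)
    have xa: "bil ?K (Qi i) x a = 0" if "i \<in># k" for i using x that by (simp add: euler[symmetric])
    have aa: "bil ?K (Qi i) a a > 0" if "i \<in># k" for i using appa[OF that] by (simp add: euler)
    have le: "a i * bil ?K (Qi i) x x \<le> 0" if "i \<in># k" for i
      using Lor_orthogonal_nonpos[OF LK[OF that] aa[OF that] xa[OF that]] a kN that
      by (auto intro!: mult_nonneg_nonpos simp: less_imp_le)
    have "(\<Sum>i\<in>?K. - (a i * bil ?K (Qi i) x x)) = 0" using s0 by (simp add: sum_negf)
    then have z: "bil ?K (Qi i) x x = 0" if "i \<in># k" for i
      using le that a[of i] kN by (subst (asm) sum_nonneg_eq_0_iff) fastforce+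
    have "size (k - {#p#}) > 0" using sz p by (simp add: size_Diff_singleton)
    then obtain i where i: "i \<in># k - {#p#}" by (metis size_empty less_irrefl multiset_nonemptyE)
    then have ik: "i \<in># k" by (rule in_diffD)
    have pi: "p \<in># k - {#i#}" using i subset_pair[OF p] subset_pair[OF ik] by (simp add: add_mset_commute)
    have "bil ?K (Qi i) z' x = 0" for z'
      using Lor_null_imp_kernel[OF symQ(2) LK[OF ik] aa[OF ik] xa[OF ik] z[OF ik]] bil_commute[OF symQ(2)]
          by metis
    then have "\<forall>q\<in>set_mset (k - {#i#}). app (set_mset (k - {#i#})) (Qi i) x q = 0"
      using bil_eq_0_imp_app_eq_0[of "set_mset (k - {#i#})" "Qi i" x] bilQi[OF ik] by simp
    then show "x p = 0" using nd[OF ik] pi unfolding nondeg_def Qi_def by blast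
  qed
  ultimately show ?thesis by (simp add: Q_def)
qed

text \<open>Induction on the number of directions: the partial derivatives live in smaller boxes,
  where the claim for the remaining directions is known, and \<open>cubic_Lor\<close> combines them
  along the next direction.\<close>

lemma directional_strict:
  assumes "strict_box k d \<phi>" "d \<le> size k" "finite N" "set_mset k \<subseteq> N" "length as + 2 = d"
    and "\<And>a i. a \<in> set as \<Longrightarrow> i \<in> N \<Longrightarrow> a i > 0"
  shows "Lor (set_mset k) (hess (foldr (Dv N) as \<phi>) {#})
      \<and> nondeg (set_mset k) (hess (foldr (Dv N) as \<phi>) {#})"
  using assms
proof (induction as arbitrary: k d \<phi>)
  case Nil
  then show ?case unfolding strict_box_def
      by (metis add_0 diff_empty empty_le foldr.simps(1) id_apply list.size(3) size_empty)
next
  case (Cons a as)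
  have nn: "\<phi> B \<ge> 0" and pos: "B \<in> mbox k d \<Longrightarrow> \<phi> B > 0" for B
    using Cons.prems(1) by (cases "B \<in> mbox k d"; auto simp: strict_box_def less_imp_le)+
  have out: "\<phi> B = 0" if "\<not> B \<subseteq># k" for B using Cons.prems(1) that by (auto simp: strict_box_def mbox_def)
  define c where "c = foldr (Dv N) as \<phi>"
  have IH: "Lor (set_mset (k - {#i#})) (hess c {#i#}) \<and> nondeg (set_mset (k
      - {#i#})) (hess c {#i#})" if i: "i \<in># k" for i
  proof -
    have "Lor (set_mset (k - {#i#})) (hess (foldr (Dv N) as (shift i \<phi>)) {#})
        \<and> nondeg (set_mset (k - {#i#})) (hess (foldr (Dv N) as (shift i \<phi>)) {#})"
    proof (rule Cons.IH)
      show "strict_box (k - {#i#}) (d - 1) (shift i \<phi>)"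
          using strict_box_shift[OF Cons.prems(1) i] Cons.prems(5) by auto
    qed (use Cons.prems i in \<open>auto simp: size_Diff_singleton dest: in_diffD\<close>)
    moreover have "hess (foldr (Dv N) as (shift i \<phi>)) {#} = hess c {#i#}"
      unfolding foldr_Dv_shift by (auto simp: hess_def shift_def c_def fun_eq_iff add_mset_commute)
    ultimately show ?thesis by simp
  qed
  have "Lor (set_mset k) (hess (Dv N a c) {#}) \<and> nondeg (set_mset k) (hess (Dv N a c) {#})"
  proof (rule cubic_Lor)
    show "c B = 0" if "\<not> B \<subseteq># k" for B unfolding c_def by (rule foldr_Dv_outside[OF out that])
    show "Dv N a c {#p, q#} > 0" if "{#p, q#} \<subseteq># k" for p q
      using foldr_Dv_pos[of N k \<phi> d "a # as" "{#p, q#}", OF Cons.prems(3,4) nn pos] Cons.prems that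
          by (simp add: c_def)
    show "Dv N a (Dv N a c) {#p#} > 0" if "p \<in># k" for p
      using foldr_Dv_pos[of N k \<phi> d "a # a # as" "{#p#}", OF Cons.prems(3,4) nn pos] Cons.prems that
          by (simp add: c_def)
    show "size k \<ge> 3" using Cons.prems by simp
  qed (use Cons.prems IH in auto)
  then show ?case by (simp add: c_def)
qed

section \<open>Strictly Lorentzian approximants by linear substitution\<close>

definition full :: "nat \<Rightarrow> nat \<Rightarrow> (nat multiset \<Rightarrow> real) \<Rightarrow> bool" where
  "full n d \<phi> \<longleftrightarrow> (\<forall>A. set_mset A \<subseteq> {..<n} \<longrightarrow> size A = d \<longrightarrow> \<phi> A > 0) \<and>
    (\<forall>\<alpha>. set_mset \<alpha> \<subseteq> {..<n} \<longrightarrow> size \<alpha> + 2 = d \<longrightarrow> Lor {..<n} (hess \<phi> \<alpha>) \<and> nondeg {..<n} (hess \<phi> \<alpha>))"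

lemma bil_pull_left:
  "bil N (\<lambda>p q. \<Sum>i\<in>N. M p i * B i q) x y = bil N B (\<lambda>i. \<Sum>p\<in>N. M p i * x p) y"
proof -
  have "bil N (\<lambda>p q. \<Sum>i\<in>N. M p i * B i q) x y = (\<Sum>p\<in>N. \<Sum>q\<in>N. \<Sum>i\<in>N. B i q * (M p i * x p) * y q)"
    unfolding bil_def sum_distrib_right by (intro sum.cong refl) (simp add: algebra_simps)
  also have "\<dots> = (\<Sum>q\<in>N. \<Sum>p\<in>N. \<Sum>i\<in>N. B i q * (M p i * x p) * y q)" by (rule sum.swap)
  also have "\<dots> = (\<Sum>q\<in>N. \<Sum>i\<in>N. \<Sum>p\<in>N. B i q * (M p i * x p) * y q)" by (rule sum.cong[OF refl], rule sum.swap)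
  also have "\<dots> = (\<Sum>i\<in>N. \<Sum>q\<in>N. \<Sum>p\<in>N. B i q * (M p i * x p) * y q)" by (rule sum.swap)
  finally show ?thesis by (simp add: bil_def sum_distrib_left sum_distrib_right)
qed

lemma bil_transpose: "bil N B x y = bil N (\<lambda>p q. B q p) y x"
  unfolding bil_def by (subst sum.swap) (simp add: algebra_simps)

lemma bil_pull:
  "bil N (\<lambda>p q. \<Sum>i\<in>N. M p i * (\<Sum>j\<in>N. M q j * B i j)) x y
   = bil N B (\<lambda>i. \<Sum>p\<in>N. M p i * x p) (\<lambda>j. \<Sum>q\<in>N. M q j * y q)"
  by (simp only: bil_pull_left) (subst (1 2) bil_transpose, simp only: bil_pull_left)

text \<open>Injectivity of the identity plus e times the all-ones matrix: summing the equations
  shows that the entries of z have sum 0.\<close>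

lemma add_sum_eq_0:
  fixes z :: "'a \<Rightarrow> real"
  assumes "finite N" "e > 0" "\<And>p. p \<in> N \<Longrightarrow> z p + e * (\<Sum>i\<in>N. z i) = 0" "p \<in> N"
  shows "z p = 0"
proof -
  have "0 = (\<Sum>p\<in>N. z p + e * (\<Sum>i\<in>N. z i))" using assms(3) by simp
  also have "\<dots> = (1 + e * real (card N)) * (\<Sum>i\<in>N. z i)" by (simp add: sum.distrib algebra_simps)
  finally have "(\<Sum>i\<in>N. z i) = 0" using assms(2) by (simp add: add_pos_nonneg less_imp_neq[symmetric])
  then show ?thesis using assms(3)[OF assms(4)] by simp
qed

text \<open>The i-th unit vector with e added in every entry. Differentiating by w_i after the
  substitution amounts to differentiating along this direction before it.\<close>

definition cv :: "real \<Rightarrow> nat \<Rightarrow> nat \<Rightarrow> real" where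
  "cv e i j = (if j = i then 1 else 0) + e"

text \<open>The derivative along all directions \<open>cv e i\<close> with i in \<open>A\<close>;
  folding over a multiset makes sense because directional derivatives commute. Its value at
  \<open>{#}\<close> is the number \<partial>^A of the substituted polynomial.\<close>

definition subst_lin :: "nat set \<Rightarrow> real \<Rightarrow> (nat multiset \<Rightarrow> real) \<Rightarrow> nat multiset \<Rightarrow> nat multiset \<Rightarrow> real" where
  "subst_lin N e \<phi> A = fold_mset (\<lambda>i. Dv N (cv e i)) \<phi> A"

lemma subst_lin_add: "subst_lin N e \<phi> (add_mset i A) = Dv N (cv e i) (subst_lin N e \<phi> A)"
proof -
  interpret comp_fun_commute "\<lambda>i. Dv N (cv e i)"
    by unfold_locales (auto simp: fun_eq_iff Dv_commute[of N "cv e _" "cv e _"])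
  show ?thesis by (simp add: subst_lin_def)
qed

lemma subst_lin_mset: "subst_lin N e \<phi> (mset xs) = foldr (Dv N) (map (cv e) xs) \<phi>"
  by (induction xs) (simp_all add: subst_lin_add, simp add: subst_lin_def)

lemma continuous_foldr_Dv: "continuous_on UNIV (\<lambda>e. foldr (Dv N) (map (cv e) xs) \<phi> A)"
proof (induction xs arbitrary: A)
  case (Cons i xs)
  then show ?case by (auto simp: Dv_def cv_def intro!: continuous_intros)
qed simp

lemma foldr_Dv_0:
  assumes "finite N" "set xs \<subseteq> N"
  shows "foldr (Dv N) (map (cv 0) xs) \<phi> A = \<phi> (mset xs + A)"
  using assms(2)
proof (induction xs arbitrary: A)
  case (Cons i xs)
  have "Dv N (cv 0 i) \<psi> A = \<psi> (add_mset i A)" for \<psi>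
  proof -
    have "Dv N (cv 0 i) \<psi> A = (\<Sum>j\<in>N. if j = i then \<psi> (add_mset j A) else 0)"
      unfolding Dv_def by (intro sum.cong) (auto simp: cv_def)
    then show ?thesis using Cons.prems assms(1) by simp
  qed
  then show ?case using Cons by simp
qed simp

lemma hess_subst_lin:
  "hess (\<lambda>A. subst_lin N e \<phi> A {#}) \<alpha> p q = (\<Sum>i\<in>N. cv e p i * (\<Sum>j\<in>N. cv e q j * hess (subst_lin N e \<phi> \<alpha>) {#}
      i j))"
  by (simp add: hess_def subst_lin_add Dv_def add_mset_commute)

lemma cv_sum: "finite N \<Longrightarrow> i \<in> N \<Longrightarrow> (\<Sum>p\<in>N. cv e p i * x p) = x i + e * (\<Sum>p\<in>N. x p)"
  by (simp add: cv_def distrib_right sum.distrib sum_distrib_left if_distrib[of "\<lambda>c. c * _"] cong: if_cong)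

text \<open>All directions \<open>cv e i\<close> are positive, so \<open>foldr_Dv_pos\<close> and
  \<open>directional_strict\<close> apply. The Hessian in the new variables is congruent to that of
  the mixed derivative through the invertible matrix of the substitution.\<close>

lemma full_subst_lin:
  assumes s: "strict_box k d \<phi>" and d: "d \<le> size k" and k: "set_mset k = {..<n}" and e: "e > 0"
  shows "full n d (\<lambda>A. subst_lin {..<n} e \<phi> A {#})"
  unfolding full_def
proof (intro conjI allI impI)
  let ?N = "{..<n}"
  have nn: "\<phi> B \<ge> 0" and pos: "B \<in> mbox k d \<Longrightarrow> \<phi> B > 0" for B
    using s by (cases "B \<in> mbox k d"; auto simp: strict_box_def less_imp_le)+
  have cpos: "cv e i j > 0" for i j using e by (simp add: cv_def)
  fix A :: "nat multiset" assume A: "size A = d"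
  obtain xs where xs: "mset xs = A" using ex_mset by blast
  have "foldr (Dv ?N) (map (cv e) xs) \<phi> {#} > 0"
    by (rule foldr_Dv_pos[of ?N k \<phi> d, OF _ _ nn pos]) (use k d xs A cpos in auto)
  then show "subst_lin ?N e \<phi> A {#} > 0" using subst_lin_mset[of ?N e \<phi> xs] xs by simp
next
  let ?N = "{..<n}"
  have cpos: "cv e i j > 0" for i j using e by (simp add: cv_def)
  fix \<alpha> :: "nat multiset" assume a: "set_mset \<alpha> \<subseteq> ?N" "size \<alpha> + 2 = d"
  obtain xs where xs: "mset xs = \<alpha>" using ex_mset by blast
  define B where "B = hess (subst_lin ?N e \<phi> \<alpha>) {#}"
  define B' where "B' = hess (\<lambda>A. subst_lin ?N e \<phi> A {#}) \<alpha>"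
  define f where "f x i = (\<Sum>p\<in>?N. cv e p i * x p)" for x :: "nat \<Rightarrow> real" and i
  have "Lor (set_mset k) (hess (foldr (Dv ?N) (map (cv e) xs) \<phi>) {#})
      \<and> nondeg (set_mset k) (hess (foldr (Dv ?N) (map (cv e) xs) \<phi>) {#})"
    by (rule directional_strict[OF s d]) (use k xs a cpos in auto)
  then have LB: "Lor ?N B" and NB: "nondeg ?N B"
    using subst_lin_mset[of ?N e \<phi> xs] xs k by (simp_all add: B_def)
  have B': "B' = (\<lambda>p q. \<Sum>i\<in>?N. cv e p i * (\<Sum>j\<in>?N. cv e q j * B i j))"
    unfolding B'_def B_def by (intro ext) (rule hess_subst_lin)
  have pull: "bil ?N B' x y = bil ?N B (f x) (f y)" for x y
    unfolding B' f_def by (rule bil_pull)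
  show "Lor ?N (hess (\<lambda>A. subst_lin ?N e \<phi> A {#}) \<alpha>)"
    unfolding B'_def[symmetric]
  proof (rule Lor_pullback[OF _ LB, where f = f])
    show "sym_form ?N B" "sym_form ?N B'" by (simp_all add: B_def B'_def sym_hess)
    show "f (\<lambda>p. x p - c * y p) = (\<lambda>p. f x p - c * f y p)" for x y c
      by (simp add: f_def fun_eq_iff algebra_simps sum_subtractf sum_distrib_left)
    show "bil ?N B' x x \<le> bil ?N B (f x) (f x)" for x by (simp add: pull)
  qed
  show "nondeg ?N (hess (\<lambda>A. subst_lin ?N e \<phi> A {#}) \<alpha>)"
    unfolding B'_def[symmetric] nondeg_def
  proof (intro allI impI)
    fix x assume x: "\<forall>p\<in>?N. app ?N B' x p = 0"
    \<comment> \<open>The substitution matrix is cancelled on the left here, and in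
      \<open>f x\<close> further below.\<close>
    have "app ?N B (f x) i = 0" if "i \<in> ?N" for i
    proof (rule add_sum_eq_0[where N = ?N and e = e])
      fix p assume p: "p \<in> ?N"
      have "0 = app ?N B' x p" using x p by simp
      also have "\<dots> = (\<Sum>q\<in>?N. \<Sum>i\<in>?N. cv e p i * (\<Sum>j\<in>?N. B i j * (cv e q j * x q)))"
        unfolding app_def B' sum_distrib_right sum_distrib_left
            by (intro sum.cong refl) (simp add: algebra_simps)
      also have "\<dots> = (\<Sum>i\<in>?N. \<Sum>q\<in>?N. cv e p i * (\<Sum>j\<in>?N. B i j * (cv e q j * x q)))" by (rule sum.swap)
      also have "\<dots> = (\<Sum>i\<in>?N. cv e p i * app ?N B (f x) i)"
        unfolding app_def f_def sum_distrib_left by (rule sum.cong[OF refl], rule sum.swap)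
      also have "\<dots> = (\<Sum>i\<in>?N. cv e i p * app ?N B (f x) i)" by (intro sum.cong) (auto simp: cv_def)
      also have "\<dots> = app ?N B (f x) p + e * (\<Sum>i\<in>?N. app ?N B (f x) i)" using p by (intro cv_sum) auto
      finally show "app ?N B (f x) p + e * (\<Sum>i\<in>?N. app ?N B (f x) i) = 0" by simp
    qed (use e that in auto)
    then have fx: "f x i = 0" if "i \<in> ?N" for i using NB that unfolding nondeg_def by blast
    show "\<forall>p\<in>?N. x p = 0"
    proof
      fix p assume "p \<in> ?N"
      then show "x p = 0"
        by (rule add_sum_eq_0[where N = ?N and e = e, rotated -1])
            (use e fx cv_sum[of ?N] in \<open>auto simp: f_def\<close>)
    qed
  qed
qed

lemma strict_box_approx:
  assumes s: "strict_box k d \<phi>" and d: "d \<le> size k" and k: "set_mset k = {..<n}"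
  obtains \<Phi> where "\<And>m. full n d (\<Phi> m)"
    "\<And>A. set_mset A \<subseteq> {..<n} \<Longrightarrow> (\<lambda>m. \<Phi> m A) \<longlonglongrightarrow> \<phi> A"
proof -
  define \<Phi> where "\<Phi> m A = subst_lin {..<n} (inverse (real (Suc m))) \<phi> A {#}" for m A
  have "full n d (\<Phi> m)" for m
    unfolding \<Phi>_def by (rule full_subst_lin[OF s d k]) simp
  moreover have "(\<lambda>m. \<Phi> m A) \<longlonglongrightarrow> \<phi> A" if A: "set_mset A \<subseteq> {..<n}" for A
  proof -
    obtain xs where xs: "mset xs = A" using ex_mset by blast
    have "(\<lambda>m. foldr (Dv {..<n}) (map (cv (inverse (real (Suc m)))) xs) \<phi> {#})
        \<longlonglongrightarrow> foldr (Dv {..<n}) (map (cv 0) xs) \<phi> {#}"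
      by (rule continuous_on_tendsto_compose[OF continuous_foldr_Dv LIMSEQ_inverse_real_of_nat]) auto
    moreover have "foldr (Dv {..<n}) (map (cv 0) xs) \<phi> {#} = \<phi> A"
      using foldr_Dv_0[of "{..<n}" xs \<phi> "{#}"] A xs by auto
    ultimately show ?thesis using subst_lin_mset[of "{..<n}" _ \<phi> xs] xs by (simp add: \<Phi>_def)
  qed
  ultimately show thesis by (rule that)
qed

section \<open>Polynomials\<close>

definition pm :: "nat multiset \<Rightarrow> (nat \<Rightarrow>\<^sub>0 nat)" where
  "pm A = Abs_poly_mapping (count A)"

definition mp :: "(nat \<Rightarrow>\<^sub>0 nat) \<Rightarrow> nat multiset" where
  "mp m = Abs_multiset (Poly_Mapping.lookup m)"

lemma lookup_pm [simp]: "Poly_Mapping.lookup (pm A) = count A"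
proof -
  have "{x. count A x \<noteq> 0} = set_mset A" by (auto simp: count_eq_zero_iff)
  then show ?thesis by (simp add: pm_def)
qed

lemma count_mp [simp]: "count (mp m) = Poly_Mapping.lookup m"
proof -
  have "{x. 0 < Poly_Mapping.lookup m x} = Poly_Mapping.keys m" by (auto simp: in_keys_iff)
  then show ?thesis by (simp add: mp_def)
qed

lemma pm_mp [simp]: "pm (mp m) = m"
  by (rule poly_mapping_eqI) simp

lemma mp_pm [simp]: "mp (pm A) = A"
  by (rule multiset_eqI) simp

lemma inj_pm: "inj pm" by (metis injI mp_pm)

lemma keys_pm: "Poly_Mapping.keys (pm A) = set_mset A"
  by (auto simp: in_keys_iff count_eq_zero_iff)

lemma pm_add_mset: "pm (add_mset i A) = pm A + Poly_Mapping.single i 1"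
  by (rule poly_mapping_eqI) (simp add: lookup_add lookup_single when_def)

definition msets :: "nat \<Rightarrow> nat \<Rightarrow> nat multiset set" where
  "msets n d = {A. set_mset A \<subseteq> {..<n} \<and> size A = d}"

lemma size_eq_sum_count: "set_mset (A :: nat multiset) \<subseteq> {..<n} \<Longrightarrow> size A = (\<Sum>i<n. count A i)"
  unfolding size_multiset_overloaded_eq by (rule sum.mono_neutral_left) (auto simp: not_in_iff)

lemma pm_in_monomials: "pm A \<in> monomials n d \<longleftrightarrow> A \<in> msets n d"
  using size_eq_sum_count[of A n] by (auto simp: monomials_def msets_def keys_pm)

lemma mp_in_msets: "mp m \<in> msets n d \<longleftrightarrow> m \<in> monomials n d"
  using pm_in_monomials[of "mp m"] by simp

lemma monomials_eq: "monomials n d = pm ` msets n d"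
proof (intro equalityI subsetI)
  fix m assume "m \<in> monomials n d"
  then have "mp m \<in> msets n d" by (simp only: mp_in_msets)
  then show "m \<in> pm ` msets n d" by (intro image_eqI[of _ _ "mp m"]) (simp only: pm_mp)
qed (auto simp: pm_in_monomials)

lemma finite_msets [simp]: "finite (msets n d)"
proof -
  have "msets n d \<subseteq> {A. A \<subseteq># (\<Sum>i<n. replicate_mset d i)}"
  proof
    fix A assume A: "A \<in> msets n d"
    have "count A i \<le> count (\<Sum>i<n. replicate_mset d i) i" for i
    proof (cases "i \<in># A")
      case True
      then have "i < n" using A by (auto simp: msets_def)
      then show ?thesis using count_le_size[of A i] A by (simp add: msets_def count_sum)
    next
      case False
      then show ?thesis by (simp add: not_in_iff)
    qed
    then show "A \<in> {A. A \<subseteq># (\<Sum>i<n. replicate_mset d i)}" by (simp add: subseteq_mset_def)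
  qed
  then show ?thesis using finite_subsets_mset finite_subset by blast
qed

lemma finite_monomials [simp]: "finite (monomials n d)"
  by (simp add: monomials_eq)

text \<open>The coefficients of \<open>\<partial>\<^sup>A f\<close> for \<open>|A| = deg f\<close>: passing to a partial derivative then only shifts the
    index.\<close>

definition tens :: "rpoly \<Rightarrow> nat multiset \<Rightarrow> real" where
  "tens f A = mfact A * Poly_Mapping.lookup f (pm A)"

lemma lookup_partial_deriv:
  "Poly_Mapping.lookup (partial_deriv i f) m
   = (real (Poly_Mapping.lookup m i) + 1) * Poly_Mapping.lookup f (m + Poly_Mapping.single i 1)"
proof -
  let ?e = "Poly_Mapping.single i (1::nat)"
  let ?g = "\<lambda>m'. real (Poly_Mapping.lookup m' i) * Poly_Mapping.lookup f m'"
  have "Poly_Mapping.lookup (partial_deriv i f) m = (\<Sum>m'\<in>Poly_Mapping.keys f. ?g m' when m' - ?e = m)"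
    by (simp add: partial_deriv_def lookup_sum lookup_single)
  also have "\<dots> = (\<Sum>m'\<in>Poly_Mapping.keys f. if m' = m + ?e then ?g m' else 0)"
  proof (rule sum.cong[OF refl])
    fix m'
    show "(?g m' when m' - ?e = m) = (if m' = m + ?e then ?g m' else 0)"
    proof (cases "Poly_Mapping.lookup m' i = 0")
      \<comment> \<open>The truncated difference is then m' itself, which may equal m, but the
        coefficient is 0.\<close>
      case True
      then show ?thesis by (auto simp: when_def)
    next
      case False
      have "m' - ?e = m \<longleftrightarrow> m' = m + ?e"
      proof
        assume m: "m' - ?e = m"
        show "m' = m + ?e"
        proof (rule poly_mapping_eqI)
          fix j
          show "Poly_Mapping.lookup m' j = Poly_Mapping.lookup (m + ?e) j"
            using False unfolding m[symmetric]
            by (cases "j = i") (simp_all add: lookup_add lookup_minus lookup_single when_def)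
        qed
      qed simp
      then show ?thesis by (simp add: when_def)
    qed
  qed
  also have "\<dots> = ?g (m + ?e)"
    by (simp add: in_keys_iff)
  finally show ?thesis by (simp add: lookup_add)
qed

lemma tens_partial_deriv: "tens (partial_deriv i f) A = tens f (add_mset i A)"
  by (simp add: tens_def lookup_partial_deriv pm_add_mset mfact_add_mset)

lemma tens_foldr_partial_deriv: "tens (foldr partial_deriv is f) A = tens f (mset is + A)"
  by (induction "is" arbitrary: A) (simp_all add: tens_partial_deriv)

lemma homogeneous_iff: "f \<in> homogeneous_polys n d \<longleftrightarrow> (\<forall>A. A \<notin> msets n d \<longrightarrow> tens f A = 0)"
proof
  assume f: "f \<in> homogeneous_polys n d"
  show "\<forall>A. A \<notin> msets n d \<longrightarrow> tens f A = 0"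
  proof (intro allI impI)
    fix A assume "A \<notin> msets n d"
    then have "pm A \<notin> Poly_Mapping.keys f" using f pm_in_monomials by (auto simp: homogeneous_polys_def)
    then show "tens f A = 0" by (simp add: tens_def in_keys_iff)
  qed
next
  assume t: "\<forall>A. A \<notin> msets n d \<longrightarrow> tens f A = 0"
  show "f \<in> homogeneous_polys n d"
    unfolding homogeneous_polys_def
  proof (intro CollectI subsetI)
    fix m assume m: "m \<in> Poly_Mapping.keys f"
    then have "tens f (mp m) \<noteq> 0" by (simp add: tens_def in_keys_iff)
    then show "m \<in> monomials n d" using t mp_in_msets by blast
  qed
qed

lemma foldr_partial_deriv_homogeneous:
  assumes "f \<in> homogeneous_polys n d" "length is + e = d"
  shows "foldr partial_deriv is f \<in> homogeneous_polys n e"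
  unfolding homogeneous_iff tens_foldr_partial_deriv
proof (intro allI impI)
  fix A assume A: "A \<notin> msets n e"
  have "mset is + A \<notin> msets n d" using A assms(2) by (auto simp: msets_def)
  then show "tens f (mset is + A) = 0" using assms(1) by (simp add: homogeneous_iff)
qed

section \<open>Quadratic forms and their signature\<close>

definition mono_eval :: "(nat \<Rightarrow> real) \<Rightarrow> nat multiset \<Rightarrow> real" where
  "mono_eval x A = (\<Prod>i\<in>set_mset A. x i ^ count A i)"

lemma poly_eval_msets:
  assumes "f \<in> homogeneous_polys n d"
  shows "poly_eval f x = (\<Sum>A\<in>msets n d. tens f A / mfact A * mono_eval x A)"
proof -
  have "poly_eval f x = (\<Sum>m\<in>monomials n d. Poly_Mapping.lookup f m * (\<Prod>i\<in>Poly_Mapping.keys m. x i ^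
      Poly_Mapping.lookup m i))"
    unfolding poly_eval_def
    by (rule sum.mono_neutral_left) (use assms in \<open>auto simp: homogeneous_polys_def in_keys_iff\<close>)
  also have "\<dots> = (\<Sum>A\<in>msets n d. Poly_Mapping.lookup f (pm A) * mono_eval x A)"
    unfolding monomials_eq by (subst sum.reindex)
        (use inj_pm in \<open>auto simp: inj_on_def keys_pm mono_eval_def inj_def\<close>)
  finally show ?thesis by (simp add: tens_def)
qed

lemma mono_eval_pair: "mono_eval x {#p, q#} = x p * x q"
  by (cases "p = q") (simp_all add: mono_eval_def power2_eq_square)

lemma poly_eval_quadratic:
  assumes "f \<in> homogeneous_polys n 2"
  shows "2 * poly_eval f x = bil {..<n} (hess (tens f) {#}) x x"
proof -
  let ?h = "\<lambda>A. tens f A * mono_eval x A"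
  let ?S = "{..<n} \<times> {..<n}"
  let ?g = "\<lambda>(p, q). {#p, q#}"
  have "bil {..<n} (hess (tens f) {#}) x x = (\<Sum>z\<in>?S. ?h (?g z))"
    unfolding bil_def sum.cartesian_product
    by (intro sum.cong refl) (auto simp: hess_def mono_eval_pair)
  also have "\<dots> = (\<Sum>A\<in>msets n 2. \<Sum>z\<in>{z\<in>?S. ?g z = A}. ?h (?g z))"
    by (rule sum.group[OF _ finite_msets, symmetric]) (auto simp: msets_def)
  \<comment> \<open>A multiset of two variables comes from 2/A! ordered pairs: two if the variables
    differ, one if they agree.\<close>
  also have "\<dots> = (\<Sum>A\<in>msets n 2. 2 / mfact A * ?h A)"
  proof (rule sum.cong[OF refl])
    fix A assume A: "A \<in> msets n 2"
    then have "size A = Suc (Suc 0)" by (simp add: msets_def)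
    then obtain a C where C: "A = add_mset a C" using size_eq_Suc_imp_eq_union by blast
    then have "size C = 1" using \<open>size A = Suc (Suc 0)\<close> by simp
    then obtain b where ab: "A = {#a, b#}" using size_1_singleton_mset C by blast
    have n: "a < n" "b < n" using A ab by (auto simp: msets_def)
    have "{z\<in>?S. ?g z = A} = {(a, b), (b, a)}"
      using n by (auto simp: ab add_eq_conv_ex add_mset_eq_single)
    moreover have "mfact A = (if a = b then 2 else 1)"
      by (simp add: ab mfact_add_mset) (simp add: mfact_def)
    ultimately show "(\<Sum>z\<in>{z\<in>?S. ?g z = A}. ?h (?g z)) = 2 / mfact A * ?h A"
      by (cases "a = b") (simp_all add: ab add_mset_commute[of b a])
  qed
  also have "\<dots> = 2 * poly_eval f x"
    unfolding poly_eval_msets[OF assms] sum_distrib_left by (intro sum.cong refl) simp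
  finally show ?thesis by simp
qed

text \<open>The image \<open>a\<close> of the first unit vector is positive, and for x orthogonal to
  it the first new coordinate vanishes, so only negative squares remain.\<close>

lemma has_signature_imp_Lor:
  assumes "has_signature n 1 (n - 1) q" "n \<ge> 1"
  shows "Lor {..<n} (hess (tens q) {#})"
proof -
  let ?N = "{..<n}" and ?B = "hess (tens q) {#}"
  obtain A where q: "q \<in> homogeneous_polys n 2" and A: "A \<in> carrier_mat n n" and inv: "invertible_mat A"
    and ev: "\<And>y. y \<in> carrier_vec n \<Longrightarrow> poly_eval q (vec_index (A *\<^sub>v y)) =
      (\<Sum>j\<in>{..<1}. (vec_index y j)\<^sup>2) - (\<Sum>j\<in>{1..<n}. (vec_index y j)\<^sup>2)"
    using assms by (auto simp: has_signature_def)
  obtain A' where A': "inverts_mat A A'" "inverts_mat A' A" using inv by (auto simp: invertible_mat_def)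
  have A'c: "A' \<in> carrier_mat n n"
    using A' A unfolding inverts_mat_def
    by (metis carrier_matD(1) carrier_matD(2) carrier_matI index_mult_mat(2) index_mult_mat(3)
        index_one_mat(2) index_one_mat(3))
  have AA': "A * A' = 1\<^sub>m n" using A' A by (simp add: inverts_mat_def)
  define e where "e = (unit_vec n 0 :: real Matrix.vec)"
  define a where "a = vec_index (A *\<^sub>v e)"
  have bil_ev: "bil ?N ?B x x = 2 * ((vec_index y 0)\<^sup>2 - (\<Sum>j\<in>{1..<n}. (vec_index y j)\<^sup>2))"
    if "y \<in> carrier_vec n" "\<And>i. i < n \<Longrightarrow> x i = vec_index (A *\<^sub>v y) i" for x y
  proof -
    have "bil ?N ?B x x = bil ?N ?B (vec_index (A *\<^sub>v y)) (vec_index (A *\<^sub>v y))" by (intro bil_cong)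
        (use that in auto)
    also have "\<dots> = 2 * poly_eval q (vec_index (A *\<^sub>v y))" by (simp add: poly_eval_quadratic[OF q])
    finally show ?thesis using ev[OF that(1)] by (simp add: lessThan_Suc)
  qed
  have ec: "e \<in> carrier_vec n" by (simp add: e_def)
  have e0: "(\<Sum>j\<in>{1..<n}. (vec_index e j)\<^sup>2) = 0" "vec_index e 0 = 1"
    using assms(2) by (auto simp: e_def)
  have aa: "bil ?N ?B a a = 2" using bil_ev[OF ec, of a] e0 by (simp add: a_def)
  show ?thesis
  proof (rule LorI[where a = a])
    show "sym_form ?N ?B" by (rule sym_hess)
    show "bil ?N ?B a a > 0" using aa by simp
    fix x assume xa: "bil ?N ?B x a = 0"
    define y where "y = A' *\<^sub>v vec n x"
    have yc: "y \<in> carrier_vec n" using A'c by (simp add: y_def)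
    have "A *\<^sub>v y = vec n x"
      unfolding y_def using A A'c AA' by (simp add: assoc_mult_mat_vec[symmetric])
    then have xi: "x i = vec_index (A *\<^sub>v y) i" if "i < n" for i using that by simp
    have xx: "bil ?N ?B x x = 2 * ((vec_index y 0)\<^sup>2 - (\<Sum>j\<in>{1..<n}. (vec_index y j)\<^sup>2))"
      by (rule bil_ev[OF yc xi])
    \<comment> \<open>The signature is given through values of the form only, so orthogonality is
      brought in by polarization, comparing the values at x + a, x and a.\<close>
    have "bil ?N ?B (\<lambda>p. x p + 1 * a p) (\<lambda>p. x p + 1 * a p)
        = 2 * ((vec_index (y + e) 0)\<^sup>2 - (\<Sum>j\<in>{1..<n}. (vec_index (y + e) j)\<^sup>2))"
    proof (rule bil_ev)
      show "y + e \<in> carrier_vec n" using yc ec by simp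
      show "x i + 1 * a i = vec_index (A *\<^sub>v (y + e)) i" if "i < n" for i
        using that xi[OF that] A by (simp add: mult_add_distrib_mat_vec[OF A yc ec] a_def)
    qed
    also have "(\<Sum>j\<in>{1..<n}. (vec_index (y + e) j)\<^sup>2) = (\<Sum>j\<in>{1..<n}. (vec_index y j)\<^sup>2)"
      using yc ec by (intro sum.cong refl) (auto simp: e_def)
    also have "vec_index (y + e) 0 = vec_index y 0 + 1" using ec yc assms(2) e0
        by (subst index_add_vec) auto
    finally have "2 * (vec_index y 0 + 1)\<^sup>2 = 2 * (vec_index y 0)\<^sup>2 + 2"
      unfolding bil_add_scaled_self[OF sym_hess] using xx aa xa by simp
    then have "vec_index y 0 = 0" by (simp add: power2_eq_square algebra_simps)
    then show "bil ?N ?B x x \<le> 0" unfolding xx by (simp add: sum_nonneg)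
  qed
qed

text \<open>Nondegeneracy excludes the eigenvalue 0, positivity at \<open>a\<close> makes the
  largest eigenvalue positive, and reverse Cauchy-Schwarz between its eigenvector and any other
  makes the remaining ones negative.\<close>

lemma strict_imp_has_signature:
  assumes q: "q \<in> homogeneous_polys n 2" and n: "n \<ge> 1" and L: "Lor {..<n} (hess (tens q) {#})"
    and nd: "nondeg {..<n} (hess (tens q) {#})" and pos: "bil {..<n} (hess (tens q) {#}) a a > 0"
  shows "has_signature n 1 (n - 1) q"
proof -
  let ?N = "{..<n}" and ?B = "hess (tens q) {#}"
  obtain v l where oe: "orthonormal_eigen ?N ?B n v l"
    using spectral_theorem[OF _ sym_hess, of ?N "tens q" "{#}"] by auto
  have on: "dot ?N (v i) (v j) = (if i = j then 1 else 0)" if "i < n" "j < n" for i j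
    using oe that by (auto simp: orthonormal_eigen_def)
  have eigv: "app ?N ?B (v i) p = l i * v i p" if "i < n" "p < n" for i p
    using oe that by (auto simp: orthonormal_eigen_def)
  have complete: "(\<Sum>i<n. v i p * v i q) = (if p = q then 1 else 0)" if "p < n" "q < n" for p q
    using orthonormal_complete[of ?N v p q] on that by simp
  have expand: "bil ?N ?B x y = (\<Sum>k<n. l k * dot ?N x (v k) * dot ?N y (v k))" for x y
    using spectral_expand(1)[of ?N ?B v l] oe by simp
  have lnz: "l i \<noteq> 0" if i: "i < n" for i
  proof
    assume "l i = 0"
    then have "\<forall>p\<in>?N. app ?N ?B (v i) p = 0" using eigv i by simp
    then have "\<forall>p\<in>?N. v i p = 0" using nd unfolding nondeg_def by blast
    then have "dot ?N (v i) (v i) = 0" by (simp add: dot_def)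
    then show False using on[OF i i] by simp
  qed
  have bv: "bil ?N ?B (v i) (v j) = (if i = j then l i else 0)" if "i < n" "j < n" for i j
  proof -
    have "bil ?N ?B (v i) (v j) = (\<Sum>k<n. if k = i then (if i = j then l i else 0) else 0)"
      unfolding expand by (intro sum.cong refl) (use on that in auto)
    then show ?thesis using that by simp
  qed
  have l0: "l 0 > 0"
  proof (rule ccontr)
    assume "\<not> ?thesis"
    then have "l k \<le> 0" if "k < n" for k using oe that n by (force simp: orthonormal_eigen_def)
    then have "bil ?N ?B a a \<le> 0"
      unfolding expand by (intro sum_nonpos) (auto simp: mult.assoc intro!: mult_nonpos_nonneg)
    then show False using pos by simp
  qed
  have lneg: "l k < 0" if k: "k < n" "k \<ge> 1" for k
  proof (rule ccontr)
    assume "\<not> ?thesis"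
    then have "l k > 0" using lnz[OF k(1)] by simp
    have n0: "0 < n" using n by simp
    have "l k * l 0 \<le> 0"
      using LorD[OF L, of "v 0" "v k"] bv[OF n0 n0] bv[OF k(1) k(1)] bv[OF k(1) n0] l0 k by simp
    then show False using \<open>l k > 0\<close> l0 by (simp add: mult_le_0_iff)
  qed
  \<comment> \<open>The 2 accounts for the Hessian being twice the quadratic form.\<close>
  define s where "s k = sqrt (2 / \<bar>l k\<bar>)" for k
  have s: "s k > 0" "s k * s k = 2 / \<bar>l k\<bar>" if "k < n" for k using lnz[OF that] by (auto simp: s_def)
  define A where "A = mat n n (\<lambda>(i, k). v k i * s k)"
  define A' where "A' = mat n n (\<lambda>(k, i). v k i / s k)"
  have Ac: "A \<in> carrier_mat n n" "A' \<in> carrier_mat n n" by (simp_all add: A_def A'_def)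
  have "A * A' = 1\<^sub>m n"
  proof (rule eq_matI)
    fix i j assume "i < dim_row (1\<^sub>m n :: real mat)" "j < dim_col (1\<^sub>m n :: real mat)"
    then have ij: "i < n" "j < n" by auto
    have "(A * A') $$ (i, j) = (\<Sum>k<n. v k i * v k j)"
      using ij s by (simp add: A_def A'_def scalar_prod_def atLeast0LessThan) (intro sum.cong refl, force)
    then show "(A * A') $$ (i, j) = 1\<^sub>m n $$ (i, j)" using complete[OF ij] ij by simp
  qed (auto simp: A_def A'_def)
  moreover have "A' * A = 1\<^sub>m n"
  proof (rule eq_matI)
    fix i j assume "i < dim_row (1\<^sub>m n :: real mat)" "j < dim_col (1\<^sub>m n :: real mat)"
    then have ij: "i < n" "j < n" by auto
    have "(A' * A) $$ (i, j) = (\<Sum>p<n. v i p / s i * (v j p * s j))"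
      using ij by (simp add: A_def A'_def scalar_prod_def atLeast0LessThan)
    also have "\<dots> = dot ?N (v i) (v j) * (s j / s i)"
      unfolding dot_def sum_distrib_right by (intro sum.cong refl) simp
    finally have "(A' * A) $$ (i, j) = dot ?N (v i) (v j) * (s j / s i)" .
    then show "(A' * A) $$ (i, j) = 1\<^sub>m n $$ (i, j)" using on[OF ij] ij s(1)[OF ij(1)]
        by (cases "i = j") auto
  qed (auto simp: A_def A'_def)
  ultimately have inv: "invertible_mat A"
    unfolding invertible_mat_def inverts_mat_def using Ac by (intro conjI exI[of _ A']) auto
  have "poly_eval q (vec_index (A *\<^sub>v y)) = (\<Sum>j\<in>{..<1}. (vec_index y j)\<^sup>2) - (\<Sum>j\<in>{1..<1 + (n
      - 1)}. (vec_index y j)\<^sup>2)"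
    if y: "y \<in> carrier_vec n" for y
  proof -
    define x where "x = vec_index (A *\<^sub>v y)"
    have x: "x p = (\<Sum>k<n. v k p * s k * vec_index y k)" if "p < n" for p
      using that y by (simp add: x_def A_def scalar_prod_def atLeast0LessThan)
    have xv: "dot ?N x (v k) = s k * vec_index y k" if k: "k < n" for k
    proof -
      have "dot ?N x (v k) = dot ?N (\<lambda>p. \<Sum>j<n. (s j * vec_index y j) * v j p) (v k)"
        unfolding dot_def using x by (intro sum.cong) (auto simp: algebra_simps)
      also have "\<dots> = (\<Sum>j<n. (s j * vec_index y j) * dot ?N (v j) (v k))"
        by (simp only: dot_sum_left dot_scale_left)
      also have "\<dots> = (\<Sum>j<n. if j = k then s k * vec_index y k else 0)"
        using on k by (intro sum.cong refl) auto
      finally show ?thesis using k by simp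
    qed
    have "2 * poly_eval q x = (\<Sum>k<n. l k * (s k * vec_index y k) * (s k * vec_index y k))"
      unfolding poly_eval_quadratic[OF q] expand by (intro sum.cong refl) (use xv in auto)
    also have "\<dots> = (\<Sum>k<n. 2 * (if k = 0 then (vec_index y k)\<^sup>2 else - (vec_index y k)\<^sup>2))"
    proof (intro sum.cong refl)
      fix k assume k: "k \<in> {..<n}"
      have "l k * (s k * vec_index y k) * (s k * vec_index y k) = l k * (s k * s k) * (vec_index y k)\<^sup>2"
        by (simp add: power2_eq_square)
      also have "l k * (s k * s k) = (if k = 0 then 2 else - 2)"
        using k s(2)[of k] l0 lneg[of k] lnz[of k] by (cases "k = 0") (auto simp: abs_if)
      finally show "l k * (s k * vec_index y k) * (s k * vec_index y k) = 2 * (if k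
          = 0 then (vec_index y k)\<^sup>2 else - (vec_index y k)\<^sup>2)"
        by auto
    qed
    also have "\<dots> = 2 * ((vec_index y 0)\<^sup>2 - (\<Sum>k\<in>{1..<n}. (vec_index y k)\<^sup>2))"
    proof -
      have "{..<n} = insert 0 {1..<n}" using n by auto
      then have "(\<Sum>k<n. 2 * (if k = 0 then (vec_index y k)\<^sup>2 else - (vec_index y k)\<^sup>2))
          = 2 * (vec_index y 0)\<^sup>2 + (\<Sum>k\<in>{1..<n}. 2 * (- (vec_index y k)\<^sup>2))" by simp
      then show ?thesis by (simp add: sum_distrib_left[symmetric] sum_negf)
    qed
    finally show ?thesis using n by (simp add: x_def lessThan_Suc)
  qed
  then show ?thesis
    unfolding has_signature_def using q n inv Ac by auto
qed

definition poly_of :: "nat \<Rightarrow> nat \<Rightarrow> (nat multiset \<Rightarrow> real) \<Rightarrow> rpoly" where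
  "poly_of n d \<phi> = Abs_poly_mapping (\<lambda>m. if m \<in> monomials n d then \<phi> (mp m) / mfact (mp m) else 0)"

lemma lookup_poly_of: "Poly_Mapping.lookup (poly_of n d \<phi>) m
    = (if m \<in> monomials n d then \<phi> (mp m) / mfact (mp m) else 0)"
proof -
  have "finite {m. (if m \<in> monomials n d then \<phi> (mp m) / mfact (mp m) else 0) \<noteq> 0}"
    by (rule finite_subset[OF _ finite_monomials[of n d]]) auto
  then show ?thesis by (simp add: poly_of_def)
qed

lemma tens_poly_of: "tens (poly_of n d \<phi>) A = (if A \<in> msets n d then \<phi> A else 0)"
  by (simp add: tens_def lookup_poly_of pm_in_monomials)

lemma poly_of_homogeneous: "poly_of n d \<phi> \<in> homogeneous_polys n d"
  by (simp add: homogeneous_iff tens_poly_of)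

lemma full_imp_strictly_Lorentzian:
  assumes f: "full n d \<phi>" and n: "n \<ge> 1"
  shows "strictly_Lorentzian n d (poly_of n d \<phi>)"
  unfolding strictly_Lorentzian_def
proof (intro conjI ballI impI allI)
  show "poly_of n d \<phi> \<in> homogeneous_polys n d" by (rule poly_of_homogeneous)
  show "Poly_Mapping.lookup (poly_of n d \<phi>) m > 0" if "m \<in> monomials n d" for m
    using f that mp_in_msets[of m n d] by (simp add: lookup_poly_of full_def msets_def)
  fix "is" assume d: "2 \<le> d" and il: "length is = d - 2 \<and> set is \<subseteq> {..<n}"
  let ?q = "foldr partial_deriv is (poly_of n d \<phi>)"
  have h: "hess (tens ?q) {#} p q = hess \<phi> (mset is) p q" if "p < n" "q < n" for p q
    using that il d by (simp add: hess_def tens_foldr_partial_deriv tens_poly_of msets_def)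
  have bil: "bil {..<n} (hess (tens ?q) {#}) x y = bil {..<n} (hess \<phi> (mset is)) x y" for x y
    by (intro bil_cong) (use h in auto)
  have app: "app {..<n} (hess (tens ?q) {#}) x p = app {..<n} (hess \<phi> (mset is)) x p" if "p < n" for x p
    unfolding app_def by (intro sum.cong) (use h that in auto)
  have Ln: "Lor {..<n} (hess \<phi> (mset is))" "nondeg {..<n} (hess \<phi> (mset is))"
    using f il d by (auto simp: full_def)
  have e: "hess \<phi> (mset is) p q > 0" if "p < n" "q < n" for p q
    using f il d that by (auto simp: full_def hess_def)
  show "has_signature n 1 (n - 1) ?q"
  proof (rule strict_imp_has_signature)
    show "?q \<in> homogeneous_polys n 2"
      by (rule foldr_partial_deriv_homogeneous[OF poly_of_homogeneous]) (use il d in auto)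
    show "Lor {..<n} (hess (tens ?q) {#})" using Ln(1) by (simp add: Lor_def bil)
    show "nondeg {..<n} (hess (tens ?q) {#})" using Ln(2) by (simp add: nondeg_def app)
    show "bil {..<n} (hess (tens ?q) {#}) ones ones > 0"
      unfolding bil unfolding bil_def using e n by (intro sum_pos) (auto simp: lessThan_empty_iff)
  qed (rule n)
qed

lemma strictly_Lorentzian_imp_Lor:
  assumes f: "strictly_Lorentzian n d f" and n: "n \<ge> 1" and a: "set_mset \<alpha> \<subseteq> {..<n}" "size \<alpha> + 2 = d"
  shows "Lor {..<n} (hess (tens f) \<alpha>)"
proof -
  obtain xs where xs: "mset xs = \<alpha>" using ex_mset by blast
  have "has_signature n 1 (n - 1) (foldr partial_deriv xs f)"
    using f a xs unfolding strictly_Lorentzian_def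
        by (metis add_diff_cancel_right' le_add2 set_mset_mset size_mset)
  from has_signature_imp_Lor[OF this n] have "Lor {..<n} (hess (tens (foldr partial_deriv xs f)) {#})" .
  moreover have "hess (tens (foldr partial_deriv xs f)) {#} = hess (tens f) \<alpha>"
    by (auto simp: hess_def fun_eq_iff tens_foldr_partial_deriv xs)
  ultimately show ?thesis by simp
qed

lemma strictly_Lorentzian_pos:
  assumes "strictly_Lorentzian n d f" "A \<in> msets n d"
  shows "tens f A > 0"
  using assms pm_in_monomials[of A n d] by (auto simp: strictly_Lorentzian_def tens_def)

section \<open>The homeomorphism\<close>

text \<open>As there are finitely many monomials, one tolerance replaces the sequence; closedness
  then follows from a triangle inequality.\<close>

lemma Lorentzian_iff_approx:
  "Lorentzian n d f \<longleftrightarrow> f \<in> homogeneous_polys n d \<and>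
     (\<forall>e>0. \<exists>F. strictly_Lorentzian n d F \<and> (\<forall>m\<in>monomials n d. \<bar>Poly_Mapping.lookup F m
         - Poly_Mapping.lookup f m\<bar> < e))"
proof
  assume L: "Lorentzian n d f"
  then obtain F where F: "\<And>k. strictly_Lorentzian n d (F k)"
    "\<And>m. (\<lambda>k. Poly_Mapping.lookup (F k) m) \<longlonglongrightarrow> Poly_Mapping.lookup f m" by (auto simp: Lorentzian_def)
  have "\<exists>F. strictly_Lorentzian n d F \<and> (\<forall>m\<in>monomials n d. \<bar>Poly_Mapping.lookup F m
      - Poly_Mapping.lookup f m\<bar> < e)"
    if "e > 0" for e
  proof -
    have "eventually (\<lambda>k. \<forall>m\<in>monomials n d. \<bar>Poly_Mapping.lookup (F k) m - Poly_Mapping.lookup f m\<bar>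
        < e) sequentially"
      using tendstoD[OF F(2) that] by (simp add: eventually_ball_finite_distrib dist_real_def)
    then obtain k where "\<forall>m\<in>monomials n d. \<bar>Poly_Mapping.lookup (F k) m - Poly_Mapping.lookup f m\<bar> < e"
      by (auto simp: eventually_sequentially)
    then show ?thesis using F(1) by blast
  qed
  then show "f \<in> homogeneous_polys n d \<and> (\<forall>e>0. \<exists>F. strictly_Lorentzian n d F
      \<and> (\<forall>m\<in>monomials n d. \<bar>Poly_Mapping.lookup F m - Poly_Mapping.lookup f m\<bar> < e))"
    using L by (simp add: Lorentzian_def)
next
  assume r: "f \<in> homogeneous_polys n d \<and> (\<forall>e>0. \<exists>F. strictly_Lorentzian n d F
      \<and> (\<forall>m\<in>monomials n d. \<bar>Poly_Mapping.lookup F m - Poly_Mapping.lookup f m\<bar> < e))"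
  then have "\<forall>k. \<exists>F. strictly_Lorentzian n d F \<and> (\<forall>m\<in>monomials n d. \<bar>Poly_Mapping.lookup F m
      - Poly_Mapping.lookup f m\<bar> < inverse (real (Suc k)))"
    by simp
  then obtain F where F: "\<And>k. strictly_Lorentzian n d (F k)"
    "\<And>k m. m \<in> monomials n d \<Longrightarrow> \<bar>Poly_Mapping.lookup (F k) m - Poly_Mapping.lookup f m\<bar>
        < inverse (real (Suc k))"
    by metis
  have "(\<lambda>k. Poly_Mapping.lookup (F k) m) \<longlonglongrightarrow> Poly_Mapping.lookup f m" for m
  proof (cases "m \<in> monomials n d")
    case True
    have "(\<lambda>k. Poly_Mapping.lookup (F k) m - Poly_Mapping.lookup f m) \<longlonglongrightarrow> 0"
      by (rule Lim_null_comparison[OF _ LIMSEQ_inverse_real_of_nat])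
          (use F(2)[OF True] in \<open>simp add: less_imp_le\<close>)
    then show ?thesis by (rule LIM_zero_cancel)
  next
    case False
    have "Poly_Mapping.lookup g m = 0" if "g \<in> homogeneous_polys n d" for g
      using that False by (auto simp: homogeneous_polys_def in_keys_iff)
    then show ?thesis using r F(1) by (simp add: strictly_Lorentzian_def)
  qed
  then show "Lorentzian n d f" using r F(1) by (auto simp: Lorentzian_def)
qed

lemma degree_in_le_iff: "degree_in i f \<le> c \<longleftrightarrow> (\<forall>m\<in>Poly_Mapping.keys f. Poly_Mapping.lookup m i \<le> c)"
  by (simp add: degree_in_def)

lemma open_if_eventually_nhds:
  assumes "\<And>x. P x \<Longrightarrow> eventually P (nhds x)"
  shows "open {x. P x}"
proof (subst open_subopen, intro ballI)
  fix x assume "x \<in> {x. P x}"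
  then show "\<exists>T. open T \<and> x \<in> T \<and> T \<subseteq> {x. P x}"
    using assms[of x] by (auto simp: eventually_nhds)
qed

lemma homeomorphism_imp_homeomorphic_space:
  assumes "homeomorphism K L f g"
  shows "top_of_set K homeomorphic_space top_of_set L"
proof -
  have "homeomorphic_maps (top_of_set K) (top_of_set L) f g"
    using assms unfolding homeomorphic_maps_def homeomorphism_def
    by (auto simp: continuous_map_in_subtopology)
  then show ?thesis by (auto simp: homeomorphic_space_def)
qed

lemma closed_ball_topology_eq: "closed_ball_topology k = top_of_set {x \<in> Esp k. (\<Sum>i<k. (x i)\<^sup>2) \<le> 1}"
  unfolding closed_ball_topology_def Euclidean_space_def euclidean_product_topology subtopology_subtopology
  by (rule arg_cong[where f = top_of_set]) (auto simp: Esp_def)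

section \<open>Coordinates on the normalising hyperplane\<close>

locale lorentzian_box =
  fixes n d :: nat and \<kappa> :: "nat \<Rightarrow> nat"
  assumes n: "n \<ge> 1" and kappa_pos: "\<And>i. i < n \<Longrightarrow> \<kappa> i > 0" and d_kappa: "d \<le> (\<Sum>i<n. \<kappa> i)"
begin

definition kap :: "nat multiset" where "kap = (\<Sum>i<n. replicate_mset (\<kappa> i) i)"

lemma count_kap: "count kap i = (if i < n then \<kappa> i else 0)"
proof -
  have "count kap i = (\<Sum>j<n. if j = i then \<kappa> i else 0)"
    unfolding kap_def count_sum by (intro sum.cong) auto
  then show ?thesis by simp
qed

lemma set_kap: "set_mset kap = {..<n}"
proof -
  have "i \<in># kap \<longleftrightarrow> i < n" for i
    using kappa_pos[of i] by (subst count_greater_zero_iff[symmetric]) (simp add: count_kap del: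
        count_greater_zero_iff)
  then show ?thesis by auto
qed

sublocale flow_box kap d
proof
  show "d \<le> size kap" using d_kappa by (simp add: kap_def size_multiset_sum)
qed

lemma mem_I: "A \<in> I \<longleftrightarrow> A \<in> msets n d \<and> (\<forall>i<n. count A i \<le> \<kappa> i)"
proof -
  have "A \<subseteq># kap \<longleftrightarrow> set_mset A \<subseteq> {..<n} \<and> (\<forall>i<n. count A i \<le> \<kappa> i)"
  proof
    assume A: "A \<subseteq># kap"
    have "set_mset A \<subseteq> {..<n}" using set_mset_mono[OF A] set_kap by simp
    moreover have "count A i \<le> \<kappa> i" if "i < n" for i using mset_subset_eq_count[OF A, of i] that
        by (simp add: count_kap)
    ultimately show "set_mset A \<subseteq> {..<n} \<and> (\<forall>i<n. count A i \<le> \<kappa> i)" by simp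
  next
    assume A: "set_mset A \<subseteq> {..<n} \<and> (\<forall>i<n. count A i \<le> \<kappa> i)"
    show "A \<subseteq># kap"
      unfolding subseteq_mset_def
    proof
      fix i
      have "count A i = 0" if "\<not> i < n"
        by (rule not_in_iff[THEN iffD1]) (use A that in auto)
      then show "count A i \<le> count kap i" using A by (cases "i < n") (auto simp: count_kap)
    qed
  qed
  then show ?thesis by (auto simp: mbox_def msets_def)
qed

lemma I_subset: "A \<in> I \<Longrightarrow> A \<in> msets n d" by (simp add: mem_I)

definition total :: "(nat multiset \<Rightarrow> real) \<Rightarrow> real" where
  "total \<phi> = (\<Sum>A\<in>I. \<phi> A / mfact A)"

lemma degree_iff_supported:
  assumes "f \<in> homogeneous_polys n d"
  shows "(\<forall>i<n. degree_in i f \<le> \<kappa> i) \<longleftrightarrow> supported (tens f)"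
proof
  assume deg: "\<forall>i<n. degree_in i f \<le> \<kappa> i"
  show "supported (tens f)"
    unfolding supported_def
  proof (intro allI impI, rule ccontr)
    fix A assume A: "A \<notin> I" "tens f A \<noteq> 0"
    then have "pm A \<in> Poly_Mapping.keys f" by (simp add: tens_def in_keys_iff)
    then have "\<forall>i<n. count A i \<le> \<kappa> i" using deg unfolding degree_in_le_iff by (metis lookup_pm)
    moreover have "A \<in> msets n d" using A(2) assms by (auto simp: homogeneous_iff)
    ultimately show False using A(1) by (simp add: mem_I)
  qed
next
  assume s: "supported (tens f)"
  show "\<forall>i<n. degree_in i f \<le> \<kappa> i"
    unfolding degree_in_le_iff
  proof (intro allI impI ballI)
    fix i m assume i: "i < n" and m: "m \<in> Poly_Mapping.keys f"
    then have "tens f (mp m) \<noteq> 0" by (simp add: tens_def in_keys_iff)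
    then have "mp m \<in> I" using s by (auto simp: supported_def)
    then show "Poly_Mapping.lookup m i \<le> \<kappa> i" using i by (simp add: mem_I)
  qed
qed

lemma poly_eval_ones:
  assumes "f \<in> homogeneous_polys n d" "supported (tens f)"
  shows "poly_eval f ones = total (tens f)"
proof -
  have "poly_eval f ones = (\<Sum>A\<in>msets n d. tens f A / mfact A)"
    unfolding poly_eval_msets[OF assms(1)] by (simp add: mono_eval_def)
  also have "\<dots> = total (tens f)"
    unfolding total_def by (rule sum.mono_neutral_right)
        (use assms(2) I_subset in \<open>auto simp: supported_def\<close>)
  finally show ?thesis .
qed

definition top_coef :: real where "top_coef = (SOME a. a \<noteq> 0 \<and> (\<forall>A. dir 0 A = a * wt kap d A))"

lemma top_coef: "top_coef \<noteq> 0" "dir 0 A = top_coef * wt kap d A"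
proof -
  have "\<exists>a. a \<noteq> 0 \<and> (\<forall>A. dir 0 A = a * wt kap d A)" using top_direction by metis
  from someI_ex[OF this] show "top_coef \<noteq> 0" "dir 0 A = top_coef * wt kap d A"
    unfolding top_coef_def[symmetric] by auto
qed

text \<open>\<open>wt\<close> times \<open>rho\<close> is 1/A!, so pairing with the stationary
  direction is evaluation at (1, ..., 1) up to a factor. The normalisation thus fixes the coordinate
  on which the flow acts trivially.\<close>

lemma coef_0: "coef 0 \<phi> = top_coef * total \<phi>"
  unfolding coef_def total_def sum_distrib_left
proof (rule sum.cong[OF refl])
  fix A assume A: "A \<in> I"
  have "ev 0 A = top_coef * wt kap d A * sqrt (rho kap A)" using top_coef(2)[of A] A
      by (simp add: dir_def field_simps)
  then have "ev 0 A * sqrt (rho kap A) = top_coef * wt kap d A * rho kap A" by simp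
  moreover have "wt kap d A * rho kap A = 1 / mfact A" using A by (simp add: wt_def rho_def)
  ultimately show "ev 0 A * sqrt (rho kap A) * \<phi> A = top_coef * (\<phi> A / mfact A)"
    by (simp add: mult.assoc)
qed

definition ndim :: nat where "ndim = card I - 1"

lemma card_I: "card I = Suc ndim" using card_I_pos by (simp add: ndim_def)

text \<open>Coordinate 0 is frozen at \<open>top_coef\<close>, its value on the hyperplane;
  \<open>x i\<close> belongs to the eigenvector with index i + 1.\<close>

definition point :: "(nat \<Rightarrow> real) \<Rightarrow> nat multiset \<Rightarrow> real" where
  "point x A = (\<Sum>m<card I. (case m of 0 \<Rightarrow> top_coef | Suc i \<Rightarrow> x i) * dir m A)"

definition coords :: "(nat multiset \<Rightarrow> real) \<Rightarrow> nat \<Rightarrow> real" where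
  "coords \<phi> i = (if i < ndim then coef (Suc i) \<phi> else 0)"

lemma supported_point: "supported (point x)" by (simp add: supported_def point_def dir_def)

lemma coef_point: "m < card I \<Longrightarrow> coef m (point x) = (case m of 0 \<Rightarrow> top_coef | Suc i \<Rightarrow> x i)"
  using coef_combination[of m "\<lambda>m. case m of 0 \<Rightarrow> top_coef | Suc i \<Rightarrow> x i"] by (simp add: point_def[abs_def])

lemma total_point: "total (point x) = 1"
  using coef_0[of "point x"] coef_point[OF card_I_pos, of x] top_coef(1) by simp

lemma coords_point: "x \<in> Esp ndim \<Longrightarrow> coords (point x) = x"
  using coef_point[of "Suc _" x] by (auto simp: coords_def Esp_def card_I fun_eq_iff not_less)

lemma point_coords:
  assumes "supported \<phi>" "total \<phi> = 1"
  shows "point (coords \<phi>) = \<phi>"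
proof
  fix A
  have "point (coords \<phi>) A = (\<Sum>m<card I. coef m \<phi> * dir m A)"
    unfolding point_def using assms(2) coef_0[of \<phi>]
    by (intro sum.cong refl) (auto simp: coords_def card_I split: nat.split)
  then show "point (coords \<phi>) A = \<phi> A" using expand[OF assms(1)] by simp
qed

definition decay :: "nat \<Rightarrow> real" where "decay i = rate - el (Suc i)"

lemma decay_pos: "i < ndim \<Longrightarrow> decay i > 0"
  using eigenvalue_less[of "Suc i"] by (simp add: decay_def card_I)

lemma point_contraction: "point (contraction decay t x) = flow t (point x)"
proof
  fix A
  show "point (contraction decay t x) A = flow t (point x) A"
    unfolding point_def[of "contraction decay t x"] flow_def
    by (intro sum.cong refl)
      (auto simp: coef_point contraction_def decay_def top_eigenvalue algebra_simps split: nat.split)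
qed

lemma continuous_on_point [continuous_intros]:
  assumes "\<And>i. continuous_on S (\<lambda>z. g z i)"
  shows "continuous_on S (\<lambda>z. point (g z) A)"
proof -
  have "continuous_on S (\<lambda>z. case m of 0 \<Rightarrow> top_coef | Suc i \<Rightarrow> g z i)" for m
    using assms by (cases m) auto
  then show ?thesis unfolding point_def by (intro continuous_on_sum continuous_on_mult continuous_on_const)
qed

text \<open>Truncation restricts each Hessian and subtracts a nonnegative diagonal form from it.\<close>

lemma truncation_weak:
  assumes F: "strictly_Lorentzian n d F"
  shows "weak (\<lambda>A. if A \<in> I then tens F A else 0)" (is "weak ?\<phi>")
  unfolding weak_def
proof (intro conjI ballI)
  show s: "supported ?\<phi>" by (simp add: supported_def)
  show "?\<phi> A > 0" if "A \<in> I" for A using strictly_Lorentzian_pos[OF F I_subset[OF that]] that by simp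
  fix \<alpha> assume a: "\<alpha> \<in> idx"
  have ak: "\<alpha> \<subseteq># kap" using a by (simp add: idx_def)
  have an: "set_mset \<alpha> \<subseteq> {..<n}" using set_mset_mono[OF ak] set_kap by simp
  have LF: "Lor {..<n} (hess (tens F) \<alpha>)"
    by (rule strictly_Lorentzian_imp_Lor[OF F n an]) (use a in \<open>simp add: idx_def\<close>)
  have nn: "tens F A \<ge> 0" for A
    using strictly_Lorentzian_pos[OF F, of A] F homogeneous_iff[of F n d]
    by (cases "A \<in> msets n d") (auto simp: strictly_Lorentzian_def less_imp_le)
  define r where "r x p = (if p \<in> act \<alpha> then x p else (0::real))" for x p
  show "Lor (act \<alpha>) (hess ?\<phi> \<alpha>)"
  proof (rule Lor_pullback[OF sym_hess LF sym_hess, where f = r])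
    show "r (\<lambda>p. x p - c * y p) = (\<lambda>p. r x p - c * r y p)" for x y c by (auto simp: r_def)
    fix x
    have "bil (act \<alpha>) (hess ?\<phi> \<alpha>) x x \<le> bil (act \<alpha>) (hess (tens F) \<alpha>) x x"
      unfolding bil_def
    proof (intro sum_mono)
      fix p q assume pq: "p \<in> act \<alpha>" "q \<in> act \<alpha>"
      show "hess ?\<phi> \<alpha> p q * x p * x q \<le> hess (tens F) \<alpha> p q * x p * x q"
      proof (cases "p = q")
        case True
        have "hess ?\<phi> \<alpha> p p \<le> hess (tens F) \<alpha> p p" using nn by (simp add: hess_def)
        then have "hess ?\<phi> \<alpha> p p * (x p * x p) \<le> hess (tens F) \<alpha> p p * (x p * x p)"
          by (intro mult_right_mono) auto
        then show ?thesis using True by (simp add: mult.assoc)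
      next
        \<comment> \<open>Distinct free variables p and q fit together, that is, \<alpha> + p + q is
          in the box; so only diagonal entries are changed by the truncation.\<close>
        case False
        have "add_mset q \<alpha> \<subseteq># kap" by (rule add_act[OF ak pq(2)])
        moreover have "p \<in> act (add_mset q \<alpha>)" using pq(1) False by (simp add: in_diff_count)
        ultimately have "add_mset p (add_mset q \<alpha>) \<subseteq># kap" by (rule add_act)
        then have "add_mset p (add_mset q \<alpha>) \<in> I" using a by (simp add: mbox_def idx_def)
        then show ?thesis by (simp add: hess_def)
      qed
    qed
    also have "\<dots> = bil {..<n} (hess (tens F) \<alpha>) (r x) (r x)"
    proof -
      have "bil (act \<alpha>) (hess (tens F) \<alpha>) x x
          = bil (act \<alpha>) (\<lambda>p q. if p \<in> act \<alpha> \<and> q \<in> act \<alpha> then hess (tens F) \<alpha> p q else 0) x x"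
        by (rule bil_cong) auto
      also have "\<dots> = bil {..<n} (\<lambda>p q. if p \<in> act \<alpha> \<and> q \<in> act \<alpha> then hess (tens F) \<alpha> p q else 0) x x"
        by (rule bil_extend) (use act_subset set_kap in auto)
      also have "\<dots> = bil {..<n} (hess (tens F) \<alpha>) (r x) (r x)"
        unfolding bil_def by (intro sum.cong refl) (simp add: r_def)
      finally show ?thesis .
    qed
    finally show "bil (act \<alpha>) (hess ?\<phi> \<alpha>) x x \<le> bil {..<n} (hess (tens F) \<alpha>) (r x) (r x)" .
  qed
qed

text \<open>A Lorentzian polynomial may have zero coefficients in the box and then is not
  \<open>weak\<close>. Its truncated approximants are; their flows converge and the nonstrict gap
  inequalities survive the limit, while positive coefficients come from
  \<open>flow_strictly_pos\<close>.\<close>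

lemma flow_Lorentzian_strict:
  assumes L: "Lorentzian n d f" and s: "supported (tens f)" and nz: "\<exists>A. tens f A \<noteq> 0" and t: "t > 0"
  shows "strict (flow t (tens f))"
proof -
  obtain F where F: "\<And>k. strictly_Lorentzian n d (F k)"
    "\<And>m. (\<lambda>k. Poly_Mapping.lookup (F k) m) \<longlonglongrightarrow> Poly_Mapping.lookup f m" using L by (auto simp: Lorentzian_def)
  define \<phi> where "\<phi> j A = (if A \<in> I then tens (F j) A else 0)" for j A
  have w: "weak (\<phi> j)" for j using truncation_weak[OF F(1)] by (simp add: \<phi>_def[abs_def])
  have lim: "(\<lambda>j. \<phi> j A) \<longlonglongrightarrow> tens f A" for A
  proof (cases "A \<in> I")
    case True
    then show ?thesis using tendsto_mult_left[OF F(2)] by (simp add: \<phi>_def tens_def)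
  next
    case False
    then show ?thesis using s by (simp add: \<phi>_def supported_def)
  qed
  have pos: "\<phi> j A > 0" if "A \<in> I" for j A using w that by (auto simp: weak_def)
  have nn: "tens f A \<ge> 0" for A
  proof (rule LIMSEQ_le_const[OF lim], intro exI allI impI)
    show "0 \<le> \<phi> j A" for j using pos[of A j] by (cases "A \<in> I") (auto simp: \<phi>_def)
  qed
  have fpos: "flow r (tens f) A > 0" if "r > 0" "A \<in> I" for r A
    by (rule flow_strictly_pos[OF s nn nz that])
  \<comment> \<open>The first half of the time yields full support, hence \<open>weak\<close>; the
    second half yields nondegeneracy.\<close>
  define r where "r = t / 2"
  have r: "r > 0" using t by (simp add: r_def)
  have limf: "(\<lambda>j. flow r (\<phi> j) A) \<longlonglongrightarrow> flow r (tens f) A" for A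
    unfolding flow_def coef_def by (intro tendsto_intros lim)
  have "\<forall>\<alpha>\<in>idx. \<forall>x. gap (act \<alpha>) (hess (flow r (tens f)) \<alpha>) x \<ge> 0"
  proof (intro ballI allI)
    fix \<alpha> x assume a: "\<alpha> \<in> idx"
    have "(\<lambda>j. gap (act \<alpha>) (hess (flow r (\<phi> j)) \<alpha>) x) \<longlonglongrightarrow> gap (act \<alpha>) (hess (flow r (tens f)) \<alpha>) x"
      unfolding gap_def bil_def hess_def by (intro tendsto_intros limf)
    moreover have "gap (act \<alpha>) (hess (flow r (\<phi> j)) \<alpha>) x \<ge> 0" for j
      using weak_flow[OF w, of r j] r weak_iff_gap[OF supported_flow flow_pos[of "\<phi> j" r]] w a
      by (auto simp: weak_def)
    ultimately show "gap (act \<alpha>) (hess (flow r (tens f)) \<alpha>) x \<ge> 0"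
      by (intro LIMSEQ_le_const) auto
  qed
  then have "weak (flow r (tens f))"
    using weak_iff_gap[OF supported_flow fpos[OF r]] by blast
  from strict_flow[OF this r] show ?thesis by (simp add: flow_flow r_def)
qed

section \<open>The Lorentzian points as an absorbing set\<close>

definition poly_at :: "(nat \<Rightarrow> real) \<Rightarrow> rpoly" where "poly_at x = poly_of n d (point x)"

lemma tens_poly_at: "tens (poly_at x) = point x"
proof
  fix A
  show "tens (poly_at x) A = point x A"
    using supported_point[of x] I_subset[of A] by (auto simp: poly_at_def tens_poly_of supported_def)
qed

lemma poly_at_PL_iff: "poly_at x \<in> PL n d \<kappa> \<longleftrightarrow> Lorentzian n d (poly_at x)"
proof -
  have h: "poly_at x \<in> homogeneous_polys n d" by (simp add: poly_at_def poly_of_homogeneous)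
  have "poly_eval (poly_at x) ones = 1" "\<forall>i<n. degree_in i (poly_at x) \<le> \<kappa> i"
    using poly_eval_ones[OF h] degree_iff_supported[OF h]
        by (simp_all add: tens_poly_at supported_point total_point)
  then show ?thesis by (simp add: PL_def)
qed

lemma PL_eq_poly_at:
  assumes "f \<in> PL n d \<kappa>"
  shows "poly_at (coords (tens f)) = f" "coords (tens f) \<in> Esp ndim"
proof -
  have h: "f \<in> homogeneous_polys n d" using assms by (simp add: PL_def Lorentzian_def)
  have s: "supported (tens f)" using assms degree_iff_supported[OF h] by (simp add: PL_def)
  have "total (tens f) = 1" using assms poly_eval_ones[OF h s] by (simp add: PL_def)
  then have "tens (poly_at (coords (tens f))) = tens f" using point_coords[OF s] by (simp add: tens_poly_at)
  then have eq: "Poly_Mapping.lookup (poly_at (coords (tens f))) (pm A)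
      = Poly_Mapping.lookup f (pm A)" for A
    by (auto simp: tens_def fun_eq_iff)
  show "poly_at (coords (tens f)) = f"
  proof (rule poly_mapping_eqI)
    fix m show "Poly_Mapping.lookup (poly_at (coords (tens f))) m = Poly_Mapping.lookup f m"
      using eq[of "mp m"] by simp
  qed
  show "coords (tens f) \<in> Esp ndim" by (simp add: coords_def Esp_def)
qed

lemma strict_imp_Lorentzian:
  assumes "strict (point x)"
  shows "Lorentzian n d (poly_at x)"
proof -
  obtain \<Phi> where \<Phi>: "\<And>m. full n d (\<Phi> m)" "\<And>A. set_mset A \<subseteq> {..<n} \<Longrightarrow> (\<lambda>m. \<Phi> m A) \<longlonglongrightarrow> point x A"
    using strict_box_approx[of kap d "point x" n] assms d_le set_kap strict_iff_strict_box by blast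
  have "(\<lambda>k. Poly_Mapping.lookup (poly_of n d (\<Phi> k)) m) \<longlonglongrightarrow> Poly_Mapping.lookup (poly_at x) m" for m
  proof (cases "m \<in> monomials n d")
    case True
    then have "set_mset (mp m) \<subseteq> {..<n}" using mp_in_msets[of m n d] by (simp add: msets_def)
    then show ?thesis using tendsto_divide[OF \<Phi>(2) tendsto_const] True
        by (simp add: lookup_poly_of poly_at_def)
  qed (simp add: lookup_poly_of poly_at_def)
  moreover have "strictly_Lorentzian n d (poly_of n d (\<Phi> k))" for k
    by (rule full_imp_strictly_Lorentzian[OF \<Phi>(1) n])
  ultimately show ?thesis 
    unfolding Lorentzian_def by (intro conjI exI[of _
        "\<lambda>k. poly_of n d (\<Phi> k)"] allI) (simp_all add: poly_at_def poly_of_homogeneous)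
qed

lemma gap_scale: "gap J (hess (\<lambda>A. c * \<phi> A) \<alpha>) x = c\<^sup>2 * gap J (hess \<phi> \<alpha>) x"
proof -
  have "bil J (hess (\<lambda>A. c * \<phi> A) \<alpha>) x y = c * bil J (hess \<phi> \<alpha>) x y" for x y :: "nat \<Rightarrow> real"
    by (simp add: bil_def hess_def sum_distrib_left mult.assoc)
  then show ?thesis by (simp add: gap_def power2_eq_square algebra_simps)
qed

text \<open>The origin is the normalised stationary polynomial; one factor \<open>top_coef\<close>
  is its frozen coordinate, the other comes from \<open>dir 0\<close>.\<close>

lemma strict_point_0: "strict (point (\<lambda>_. 0))"
proof -
  have "point (\<lambda>_. 0) A = top_coef\<^sup>2 * wt kap d A" for A
  proof -
    have "point (\<lambda>_. 0) A = (\<Sum>m<card I. if m = 0 then top_coef * dir 0 A else 0)"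
      unfolding point_def by (intro sum.cong refl) (auto split: nat.split)
    then show ?thesis using card_I_pos by (simp add: top_coef(2) power2_eq_square)
  qed
  then have p: "point (\<lambda>_. 0) = (\<lambda>A. top_coef\<^sup>2 * wt kap d A)" by auto
  have c: "top_coef\<^sup>2 > 0" using top_coef(1) by simp
  have "\<forall>\<alpha>\<in>idx. \<forall>x\<in>sphere0 (act \<alpha>). gap (act \<alpha>) (hess (wt kap d) \<alpha>) x > 0"
    using strict_wt strict_iff_gap[OF supported_wt wt_pos] by blast
  then have "\<forall>\<alpha>\<in>idx. \<forall>x\<in>sphere0 (act \<alpha>). gap (act \<alpha>) (hess (point (\<lambda>_. 0)) \<alpha>) x > 0"
    using c by (simp add: p gap_scale)
  moreover have "point (\<lambda>_. 0) A > 0" if "A \<in> I" for A using c wt_pos[OF that] by (simp add: p)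
  ultimately show ?thesis using strict_iff_gap[OF supported_point] by blast
qed

text \<open>Strictness consists of finitely many positivity conditions, those on \<open>gap\<close>
  being uniform over compact spheres.\<close>

lemma open_strict: "open {x. strict (point x)}"
proof (rule open_if_eventually_nhds)
  fix x assume st: "strict (point x)"
  have pos: "point x A > 0" if "A \<in> I" for A using st that by (auto simp: strict_def weak_def)
  have e1: "eventually (\<lambda>y. \<forall>A\<in>I. point y A > 0) (nhds x)"
  proof -
    have "eventually (\<lambda>y. point y A > 0) (nhds x)" if "A \<in> I" for A
    proof -
      have "open {y. 0 < point y A}"
          by (intro open_Collect_less continuous_on_const continuous_on_point continuous_on_coord)
      then show ?thesis using pos[OF that] by (auto simp: eventually_nhds)
    qed
    then show ?thesis by (simp add: eventually_ball_finite_distrib)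
  qed
  have "eventually (\<lambda>y. \<forall>z\<in>sphere0 (act \<alpha>). gap (act \<alpha>) (hess (point y) \<alpha>) z > 0) (nhds x)" if a:
      "\<alpha> \<in> idx" for \<alpha>
  proof (rule compact_eventually[OF compact_sphere0])
    define R where "R z = gap (act \<alpha>) (hess (point (fst z)) \<alpha>) (snd z)" for z
    have fst_coord: "continuous_on UNIV (\<lambda>z. (fst z :: nat \<Rightarrow> real) i)" for i
      by (rule continuous_on_product_then_coordinatewise[OF continuous_on_fst[OF continuous_on_id]])
    have "continuous_on UNIV R"
      unfolding R_def gap_def
      by (intro continuous_on_diff continuous_on_mult continuous_on_power continuous_on_const
          continuous_on_bil
        continuous_on_hess continuous_on_point fst_coord continuous_on_snd_coord)
    then have op: "open {z. 0 < R z}" by (intro open_Collect_less continuous_on_const)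
    fix z assume z: "z \<in> sphere0 (act \<alpha>)"
    have "gap (act \<alpha>) (hess (point x) \<alpha>) z > 0"
      using st strict_iff_gap[OF supported_point pos] a z by blast
    then have "(x, z) \<in> {z. 0 < R z}" by (simp add: R_def)
    with op have "eventually (\<lambda>w. 0 < R w) (nhds (x, z))" by (auto simp: eventually_nhds)
    then have "eventually (\<lambda>w. 0 < R w) (nhds x \<times>\<^sub>F nhds z)" by (simp add: nhds_prod)
    then show "eventually (\<lambda>(y, w). w \<in> sphere0 (act \<alpha>) \<longrightarrow> 0
        < gap (act \<alpha>) (hess (point y) \<alpha>) w) (nhds x \<times>\<^sub>F nhds z)"
      by eventually_elim (auto simp: R_def)
  qed simp
  then have "eventually (\<lambda>y. \<forall>\<alpha>\<in>idx. \<forall>z\<in>sphere0 (act \<alpha>). gap (act \<alpha>) (hess (point y) \<alpha>) z > 0) (nhds x)"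
    by (simp add: eventually_ball_finite_distrib)
  with e1 show "eventually (\<lambda>y. strict (point y)) (nhds x)"
    by eventually_elim (use strict_iff_gap[OF supported_point] in blast)
qed

definition region :: "(nat \<Rightarrow> real) set" where
  "region = {x \<in> Esp ndim. Lorentzian n d (poly_at x)}"

lemma closed_Lorentzian: "closed {x. Lorentzian n d (poly_at x)}"
  unfolding closed_def Compl_eq Collect_mem_eq
proof -
  have "open {x. \<not> Lorentzian n d (poly_at x)}"
  proof (rule open_if_eventually_nhds)
    fix x assume "\<not> Lorentzian n d (poly_at x)"
    then obtain e where e: "e > 0" "\<And>F. strictly_Lorentzian n d F \<Longrightarrow>
        \<exists>m\<in>monomials n d. \<not> \<bar>Poly_Mapping.lookup F m - Poly_Mapping.lookup (poly_at x) m\<bar> < e"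
      unfolding Lorentzian_iff_approx by (auto simp: poly_at_def poly_of_homogeneous)
    \<comment> \<open>Half the tolerance, so that an approximant of a nearby point would approximate
      \<open>poly_at x\<close> within \<open>e\<close>.\<close>
    have "eventually (\<lambda>y. \<bar>Poly_Mapping.lookup (poly_at y) m - Poly_Mapping.lookup (poly_at x) m\<bar>
        < e / 2) (nhds x)"
      if "m \<in> monomials n d" for m
    proof -
      have "continuous_on UNIV (\<lambda>y. \<bar>Poly_Mapping.lookup (poly_at y) m
          - Poly_Mapping.lookup (poly_at x) m\<bar>)"
        unfolding poly_at_def lookup_poly_of using that
        by (simp add: divide_inverse) (intro continuous_on_rabs continuous_on_diff continuous_on_mult
            continuous_on_const
          continuous_on_point continuous_on_coord)
      then have "open {y. \<bar>Poly_Mapping.lookup (poly_at y) m - Poly_Mapping.lookup (poly_at x) m\<bar> < e / 2}"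
        by (intro open_Collect_less continuous_on_const)
      then show ?thesis using e(1) by (auto simp: eventually_nhds intro!: exI[of _
          "{y. \<bar>Poly_Mapping.lookup (poly_at y) m - Poly_Mapping.lookup (poly_at x) m\<bar> < e / 2}"])
    qed
    then have "eventually (\<lambda>y. \<forall>m\<in>monomials n d. \<bar>Poly_Mapping.lookup (poly_at y) m
        - Poly_Mapping.lookup (poly_at x) m\<bar> < e / 2) (nhds x)"
      by (simp add: eventually_ball_finite_distrib)
    then show "eventually (\<lambda>y. \<not> Lorentzian n d (poly_at y)) (nhds x)"
    proof eventually_elim
      case (elim y)
      show ?case
      proof
        assume "Lorentzian n d (poly_at y)"
        then obtain F where F: "strictly_Lorentzian n d F"
          "\<And>m. m \<in> monomials n d \<Longrightarrow> \<bar>Poly_Mapping.lookup F m - Poly_Mapping.lookup (poly_at y) m\<bar> < e / 2"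
          unfolding Lorentzian_iff_approx using e(1) by (metis half_gt_zero)
        obtain m where m: "m \<in> monomials n d" "\<not> \<bar>Poly_Mapping.lookup F m
            - Poly_Mapping.lookup (poly_at x) m\<bar> < e"
          using e(2)[OF F(1)] by blast
        show False using F(2)[OF m(1)] elim[rule_format, OF m(1)] m(2) by linarith
      qed
    qed
  qed
  then show "open {x. x \<notin> {x. Lorentzian n d (poly_at x)}}" by simp
qed

text \<open>Nonnegative coefficients with sum 1 are at most 1, so each number \<partial>^A f is at
  most A!, which bounds the eigencoordinates.\<close>

lemma compact_region: "compact region"
proof (rule compact_finite_support)
  have "closed (Esp ndim)" using closed_support[of "{..<ndim}"] by (simp add: Esp_def not_less)
  then have "closed (Esp ndim \<inter> {x. Lorentzian n d (poly_at x)})" using closed_Lorentzian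
      by (rule closed_Int)
  then show "closed region" by (simp add: region_def Int_def)
next
  fix x i assume x: "x \<in> region"
  obtain F where F: "\<And>k. strictly_Lorentzian n d (F k)"
    "\<And>m. (\<lambda>k. Poly_Mapping.lookup (F k) m) \<longlonglongrightarrow> Poly_Mapping.lookup (poly_at x) m"
    using x by (auto simp: region_def Lorentzian_def)
  have nn: "point x A \<ge> 0" if "A \<in> I" for A
  proof -
    have "Poly_Mapping.lookup (F k) (pm A) \<ge> 0" for k
      using zero_less_mult_pos[OF _ mfact_pos] strictly_Lorentzian_pos[OF F(1) I_subset[OF that], of k]
      unfolding tens_def by (meson less_imp_le)
    then have "Poly_Mapping.lookup (poly_at x) (pm A) \<ge> 0" using LIMSEQ_le_const[OF F(2)] by blast
    then show ?thesis unfolding tens_poly_at[symmetric] tens_def by (simp add: less_imp_le)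
  qed
  have le: "point x A \<le> mfact A" if A: "A \<in> I" for A
  proof -
    have "point x A / mfact A \<le> total (point x)"
      unfolding total_def by (rule member_le_sum[OF A]) (use nn in \<open>auto simp: less_imp_le\<close>)
    then show ?thesis by (simp add: total_point divide_le_eq)
  qed
  show "\<bar>x i\<bar> \<le> (\<Sum>A\<in>I. \<bar>ev (Suc i) A * sqrt (rho kap A)\<bar> * mfact A)"
  proof (cases "i < ndim")
    case True
    have "x i = coef (Suc i) (point x)" using coef_point[of "Suc i" x] True by (simp add: card_I)
    then have "\<bar>x i\<bar> \<le> (\<Sum>A\<in>I. \<bar>ev (Suc i) A * sqrt (rho kap A) * point x A\<bar>)" unfolding coef_def by simp
    also have "\<dots> \<le> (\<Sum>A\<in>I. \<bar>ev (Suc i) A * sqrt (rho kap A)\<bar> * mfact A)"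
    proof (rule sum_mono)
      fix A assume A: "A \<in> I"
      have "\<bar>ev (Suc i) A * sqrt (rho kap A) * point x A\<bar> = \<bar>ev (Suc i) A * sqrt (rho kap A)\<bar> * point x A"
        using nn[OF A] by (simp add: abs_mult)
      also have "\<dots> \<le> \<bar>ev (Suc i) A * sqrt (rho kap A)\<bar> * mfact A" by (rule mult_left_mono[OF le[OF A]]) simp
      finally show "\<bar>ev (Suc i) A * sqrt (rho kap A) * point x A\<bar>
          \<le> \<bar>ev (Suc i) A * sqrt (rho kap A)\<bar> * mfact A" .
    qed
    finally show ?thesis .
  next
    case False
    then have "x i = 0" using x by (simp add: region_def Esp_def)
    then show ?thesis by (simp add: sum_nonneg less_imp_le)
  qed
qed

lemma absorbing_region: "absorbing ndim decay region"
  unfolding absorbing_def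
proof (intro conjI exI[of _ "{x. strict (point x)}"] allI impI ballI)
  show "compact region" by (rule compact_region)
  show "region \<subseteq> Esp ndim" by (auto simp: region_def)
  show "open {x. strict (point x)}" by (rule open_strict)
  show sub: "Esp ndim \<inter> {x. strict (point x)} \<subseteq> region"
    using strict_imp_Lorentzian by (auto simp: region_def)
  have "(\<lambda>_. 0) \<in> Esp ndim \<inter> {x. strict (point x)}" using strict_point_0 by (simp add: Esp_def)
  then show "region \<noteq> {}" using sub by blast
  fix t :: real and x assume t: "t > 0" and x: "x \<in> region"
  have "strict (flow t (tens (poly_at x)))"
  proof (rule flow_Lorentzian_strict[OF _ _ _ t])
    show "Lorentzian n d (poly_at x)" using x by (simp add: region_def)
    show "supported (tens (poly_at x))" by (simp add: tens_poly_at supported_point)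
    show "\<exists>A. tens (poly_at x) A \<noteq> 0"
    proof (rule ccontr)
      assume "\<not> ?thesis"
      then have "total (point x) = 0" by (simp add: tens_poly_at total_def)
      then show False by (simp add: total_point)
    qed
  qed
  then show "contraction decay t x \<in> {x. strict (point x)}" by (simp add: point_contraction tens_poly_at)
qed

lemma PL_homeomorphic_region:
  "subtopology (coeff_topology n d) (PL n d \<kappa>) homeomorphic_space top_of_set region"
proof -
  let ?T = "coeff_topology n d"
  have lk: "continuous_map ?T euclideanreal (\<lambda>f. Poly_Mapping.lookup f m)" if m: "m \<in> monomials n d" for m
  proof -
    have "continuous_map ?T euclideanreal ((\<lambda>g. g m) \<circ> (\<lambda>f. restrict (Poly_Mapping.lookup f) (monomials n
        d)))"
      unfolding coeff_topology_def by (intro continuous_map_pullback continuous_map_product_projection m)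
    then show ?thesis using m by (simp add: o_def)
  qed
  have cc: "continuous_map ?T euclidean (\<lambda>f. coords (tens f))"
  proof -
    have "continuous_map ?T euclideanreal (\<lambda>f. coords (tens f) i)" for i
    proof (cases "i < ndim")
      case True
      have "continuous_map ?T euclideanreal (\<lambda>f. \<Sum>A\<in>I. ev (Suc i) A * sqrt (rho kap A) * (mfact A *
          Poly_Mapping.lookup f (pm A)))"
        using I_subset pm_in_monomials
            by (intro continuous_map_sum continuous_map_real_mult continuous_map_const[THEN iffD2] lk) auto
      then show ?thesis using True by (simp add: coords_def coef_def tens_def)
    qed (simp add: coords_def)
    then have "continuous_map ?T (product_topology (\<lambda>_. euclideanreal) UNIV) (\<lambda>f. coords (tens f))"
      by (simp add: continuous_map_componentwise_UNIV)
    then show ?thesis by (simp add: euclidean_product_topology)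
  qed
  have cp: "continuous_map euclidean ?T poly_at"
    unfolding coeff_topology_def
  proof (rule continuous_map_pullback')
    show "continuous_map euclidean (powertop_real (monomials n d)) ((\<lambda>f. restrict (Poly_Mapping.lookup f)
        (monomials n d)) \<circ> poly_at)"
      unfolding continuous_map_componentwise
    proof (intro conjI ballI)
      fix m assume m: "m \<in> monomials n d"
      have "continuous_on UNIV (\<lambda>x. point x (mp m) * inverse (mfact (mp m)))"
        by (intro continuous_on_mult continuous_on_const continuous_on_point continuous_on_coord)
      then show "continuous_map euclidean euclideanreal (\<lambda>x. ((\<lambda>f. restrict (Poly_Mapping.lookup f)
          (monomials n d)) \<circ> poly_at) x m)"
        using m by (simp add: poly_at_def lookup_poly_of divide_inverse)
    qed auto
    show "topspace euclidean \<subseteq> poly_at -` homogeneous_polys n d"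
      by (auto simp: poly_at_def poly_of_homogeneous)
  qed
  have top: "topspace ?T = homogeneous_polys n d"
    by (auto simp: coeff_topology_def topspace_pullback_topology)
  have PL_Lorentzian: "f \<in> PL n d \<kappa> \<Longrightarrow> Lorentzian n d f" for f by (simp add: PL_def)
  have PLh: "PL n d \<kappa> \<subseteq> homogeneous_polys n d" by (auto simp: PL_def Lorentzian_def)
  have "homeomorphic_maps (subtopology ?T (PL n d \<kappa>)) (top_of_set region) (\<lambda>f. coords (tens f)) poly_at"
    unfolding homeomorphic_maps_def
  proof (intro conjI ballI)
    show "continuous_map (subtopology ?T (PL n d \<kappa>)) (top_of_set region) (\<lambda>f. coords (tens f))"
      unfolding continuous_map_in_subtopology
    proof (intro conjI continuous_map_from_subtopology cc)
      show "(\<lambda>f. coords (tens f)) \<in> topspace (subtopology ?T (PL n d \<kappa>)) \<rightarrow> region"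
        using PL_eq_poly_at PL_Lorentzian by (auto simp: region_def)
    qed
    show "continuous_map (top_of_set region) (subtopology ?T (PL n d \<kappa>)) poly_at"
      unfolding continuous_map_in_subtopology
    proof (intro conjI continuous_map_from_subtopology cp)
      show "poly_at \<in> topspace (top_of_set region) \<rightarrow> PL n d \<kappa>"
        using poly_at_PL_iff by (auto simp: region_def)
    qed
    show "poly_at (coords (tens f)) = f" if "f \<in> topspace (subtopology ?T (PL n d \<kappa>))" for f
      using that PL_eq_poly_at by auto
    show "coords (tens (poly_at x)) = x" if "x \<in> topspace (top_of_set region)" for x
      using that by (auto simp: tens_poly_at coords_point region_def)
  qed
  then show ?thesis by (auto simp: homeomorphic_space_def)
qed

end

theorem theorem3p3:
  fixes n d :: nat and \<kappa> :: "nat \<Rightarrow> nat"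
  assumes "n \<ge> 1"
    and "\<And>i. i < n \<Longrightarrow> \<kappa> i > 0"
    and "d \<le> (\<Sum>i<n. \<kappa> i)"
  shows "\<exists>k. subtopology (coeff_topology n d) (PL n d \<kappa>) homeomorphic_space closed_ball_topology k"
proof -
  interpret lorentzian_box n d \<kappa> by unfold_locales (use assms in auto)
  \<comment> \<open>The ball is absorbing for any positive rates, in particular for the decay rates
    of the exclusion flow, so region and ball are compared along the same orbits.\<close>
  have "homeomorphism region {x \<in> Esp ndim. (\<Sum>i<ndim. (x i)\<^sup>2) \<le> 1}
      (transport decay region {x \<in> Esp ndim. (\<Sum>i<ndim. (x i)\<^sup>2) \<le> 1})
      (transport decay {x \<in> Esp ndim. (\<Sum>i<ndim. (x i)\<^sup>2) \<le> 1} region)"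
    using absorbing_homeomorphic[of ndim decay, OF decay_pos absorbing_region absorbing_ball[OF decay_pos]]
        by simp
  then have "top_of_set region homeomorphic_space closed_ball_topology ndim"
    unfolding closed_ball_topology_eq by (rule homeomorphism_imp_homeomorphic_space)
  then show ?thesis using PL_homeomorphic_region homeomorphic_space_trans by blast
qed

end
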